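(* Let $0=\alpha_0<\alpha_1<\dots<\alpha_k<1$ and let $\mathfrak{W}$ be a nonempty closed convex subset of $\Delta_{k+1}=\{w\in\mathbb{R}^{k+1}_+: w_0+\dots+w_k=1\}$ such that for every $i\in\{1,\dots,k\}$ there exists $w\in\mathfrak{W}$ with $w_i\neq 0$. For a cdf $F$ with finite first moment put $$\mathcal{R}(F)=\sup_{w\in\mathfrak{W}}\Big\{w_0\,\mathbb{E}_F[Z]+\sum_{i=1}^k w_i\,\mathsf{AVaR}_{\alpha_i}(F)\Big\}.$$ Let $Z$ be a random variable with cdf $F$ and $\mathbb{E}_F[Z^2]<+\infty$, let $Z_1,\dots,Z_N$ be an i.i.d. sample of $Z$ with empirical cdf $\hat F_N$, and let $\bar Z=N^{-1}\sum_{j=1}^N Z_j$. Let $\overline{\mathfrak{W}}=\arg\max_{w\in\mathfrak{W}}\big\{w_0\mathbb{E}_F[Z]+\sum_{i=1}^k w_i\mathsf{AVaR}_{\alpha_i}(F)\big\}$ and $\overline{\mathfrak{T}}=\mathfrak{Q}_F(\alpha_1)\times\cdots\times\mathfrak{Q}_F(\alpha_k)\subset\mathbb{R}^k$. Then, as $N\to\infty$, $$\mathcal{R}(\hat F_N)=\sup_{w\in\overline{\mathfrak{W}}}\ \inf_{\tau\in\overline{\mathfrak{T}}}\Big\{w_0\bar Z+\sum_{i=1}^k w_i\Big(\tau_i+\frac{1}{N(1-\alpha_i)}\sum_{j=1}^N[Z_j-\tau_i]_+\Big)\Big\}+o_p(N^{-1/2})$$ and $$N^{1/2}\big[\mathcal{R}(\hat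 F_N)-\mathcal{R}(F)\big]\ \xrightarrow{\ \mathcal{D}\ }\ \sup_{w\in\overline{\mathfrak{W}}}\ \inf_{\tau\in\overline{\mathfrak{T}}}\mathbb{Y}(w,\tau),$$ where $\mathbb{Y}(w,\tau)$ is a Gaussian process with mean zero and covariances $$\mathbb{E}_F[\mathbb{Y}(w,\tau)\mathbb{Y}(w',\tau')]=\mathrm{Cov}_F\Big(w_0Z+\sum_{i=1}^k\frac{w_i}{1-\alpha_i}[Z-\tau_i]_+,\ w_0'Z+\sum_{i=1}^k\frac{w_i'}{1-\alpha_i}[Z-\tau_i']_+\Big).$$ Moreover, if the sets $\overline{\mathfrak{W}}=\{\bar w\}$ and $\overline{\mathfrak{T}}=\{\bar\tau\}$ are singletons, then $N^{1/2}[\mathcal{R}(\hat F_N)-\mathcal{R}(F)]$ converges in distribution to the normal $\mathcal{N}(0,\nu^2)$ with variance $$\nu^2=\mathrm{Var}_F\Big\{\bar w_0Z+\sum_{i=1}^k\frac{\bar w_i}{1-\alpha_i}[Z-\bar\tau_i]_+\Big\}.$$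
   Context: For a cdf $F$, $F^{-1}(\alpha)=\inf\{t:F(t)\ge\alpha\}$ is the left-side quantile, and for $\alpha\in(0,1)$ the interval of $\alpha$-quantiles is $\mathfrak{Q}_F(\alpha)=[a,b]$ with $a=F^{-1}(\alpha)$, $b=\sup\{t:F(t)\le\alpha\}$. For $F$ with finite first moment and $\alpha\in[0,1)$, the Average Value-at-Risk is $\mathsf{AVaR}_\alpha(F)=\frac{1}{1-\alpha}\int_\alpha^1F^{-1}(\tau)\,d\tau$; equivalently $\mathsf{AVaR}_\alpha(F)=\inf_{\tau\in\mathbb{R}}\{\tau+(1-\alpha)^{-1}\mathbb{E}_F[Z-\tau]_+\}$, and $\mathsf{AVaR}_0(F)=\mathbb{E}_F[Z]$. Here $[a]_+=\max\{a,0\}$. The empirical cdf is $\hat F_N=N^{-1}\sum_{j=1}^N\mathbf{1}_{[Z_j,\infty)}$. $\mathbb{E}_F,\mathrm{Var}_F,\mathrm{Cov}_F$ are taken with respect to $Z\sim F$. $\xrightarrow{\mathcal{D}}$ denotes convergence in distribution, and $o_p(N^{-1/2})$ denotes a term which multiplied by $N^{1/2}$ tends to zero in probability. The Gaussian process $\mathbb{Y}$ is taken in its version with continuous sample paths, i.e. as a random element of the space of continuous functions. *)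

theory Defs
  imports "HOL-Probability.Probability"
begin

section \<open>Cumulative distribution functions and Average Value-at-Risk\<close>

definition left_quantile :: "(real \<Rightarrow> real) \<Rightarrow> real \<Rightarrow> real" where
  "left_quantile F \<alpha> = Inf {t. F t \<ge> \<alpha>}"

definition quantiles :: "(real \<Rightarrow> real) \<Rightarrow> real \<Rightarrow> real set" where
  "quantiles F \<alpha> = {left_quantile F \<alpha> .. Sup {t. F t \<le> \<alpha>}}"

definition AVaR :: "real \<Rightarrow> (real \<Rightarrow> real) \<Rightarrow> real" where
  "AVaR \<alpha> F = 1 / (1 - \<alpha>) * (LBINT t=\<alpha>..1. left_quantile F t)"

text \<open>
  The subscript \<open>F\<close> in \<open>E\<^sub>F\<close>, \<open>Cov\<^sub>F\<close> and \<open>Var\<^sub>F\<close> refers to the Lebesgue--Stieltjes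
  measure of the cdf \<open>F\<close>, that is, to the law of \<open>Z \<sim> F\<close>; a function \<open>f\<close> stands for \<open>f(Z)\<close>.
\<close>

definition expect_cdf :: "(real \<Rightarrow> real) \<Rightarrow> (real \<Rightarrow> real) \<Rightarrow> real" where
  "expect_cdf F f = (\<integral>z. f z \<partial>interval_measure F)"

definition cov_cdf :: "(real \<Rightarrow> real) \<Rightarrow> (real \<Rightarrow> real) \<Rightarrow> (real \<Rightarrow> real) \<Rightarrow> real" where
  "cov_cdf F f g = expect_cdf F (\<lambda>z. (f z - expect_cdf F f) * (g z - expect_cdf F g))"

definition var_cdf :: "(real \<Rightarrow> real) \<Rightarrow> (real \<Rightarrow> real) \<Rightarrow> real" where
  "var_cdf F f = expect_cdf F (\<lambda>z. (f z - expect_cdf F f)\<^sup>2)"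

text \<open>The sample points are \<open>z 0, \<dots>, z (N - 1)\<close>.\<close>

definition empirical_cdf :: "(nat \<Rightarrow> real) \<Rightarrow> nat \<Rightarrow> real \<Rightarrow> real" where
  "empirical_cdf z N t = (\<Sum>j<N. indicator {z j ..} t) / real N"


section \<open>The risk measure\<close>

text \<open>
  The index set \<open>{1, \<dots>, k}\<close> is a finite linearly ordered type \<open>'n\<close>. A vector
  \<open>(w\<^sub>0, w\<^sub>1, \<dots>, w\<^sub>k)\<close> is the pair of \<open>w\<^sub>0\<close> and \<open>(w\<^sub>1, \<dots>, w\<^sub>k)\<close>.
\<close>

type_synonym 'n weights = "real \<times> (real ^ 'n)"

definition weight_simplex :: "('n::finite) weights set" where
  "weight_simplex = {w. fst w \<ge> 0 \<and> (\<forall>i. snd w $ i \<ge> 0) \<and> fst w + (\<Sum>i\<in>UNIV. snd w $ i) = 1}"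

definition risk_mix :: "('n::finite \<Rightarrow> real) \<Rightarrow> (real \<Rightarrow> real) \<Rightarrow> 'n weights \<Rightarrow> real" where
  "risk_mix \<alpha> F w = fst w * expect_cdf F (\<lambda>z. z) + (\<Sum>i\<in>UNIV. snd w $ i * AVaR (\<alpha> i) F)"

definition risk :: "('n::finite) weights set \<Rightarrow> ('n \<Rightarrow> real) \<Rightarrow> (real \<Rightarrow> real) \<Rightarrow> real" where
  "risk W \<alpha> F = (SUP w\<in>W. risk_mix \<alpha> F w)"

definition opt_weights ::
    "('n::finite) weights set \<Rightarrow> ('n \<Rightarrow> real) \<Rightarrow> (real \<Rightarrow> real) \<Rightarrow> 'n weights set" where
  "opt_weights W \<alpha> F = {w. is_arg_max (risk_mix \<alpha> F) (\<lambda>w. w \<in> W) w}"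

definition quantile_box :: "('n::finite \<Rightarrow> real) \<Rightarrow> (real \<Rightarrow> real) \<Rightarrow> (real ^ 'n) set" where
  "quantile_box \<alpha> F = {\<tau>. \<forall>i. \<tau> $ i \<in> quantiles F (\<alpha> i)}"

definition sample_objective ::
    "('n::finite \<Rightarrow> real) \<Rightarrow> (nat \<Rightarrow> real) \<Rightarrow> nat \<Rightarrow> 'n weights \<Rightarrow> real ^ 'n \<Rightarrow> real" where
  "sample_objective \<alpha> z N w \<tau> =
     fst w * ((\<Sum>j<N. z j) / real N) +
     (\<Sum>i\<in>UNIV. snd w $ i *
        (\<tau> $ i + 1 / (real N * (1 - \<alpha> i)) * (\<Sum>j<N. max (z j - \<tau> $ i) 0)))"

definition influence :: "('n::finite \<Rightarrow> real) \<Rightarrow> 'n weights \<Rightarrow> real ^ 'n \<Rightarrow> real \<Rightarrow> real" where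
  "influence \<alpha> w \<tau> z =
     fst w * z + (\<Sum>i\<in>UNIV. snd w $ i / (1 - \<alpha> i) * max (z - \<tau> $ i) 0)"


section \<open>Probabilistic notions\<close>

definition tendsto_0_in_prob :: "'a measure \<Rightarrow> (nat \<Rightarrow> 'a \<Rightarrow> real) \<Rightarrow> bool" where
  "tendsto_0_in_prob M X \<longleftrightarrow>
     (\<forall>n. X n \<in> borel_measurable M) \<and>
     (\<forall>\<epsilon>>0. (\<lambda>n. measure M {\<omega> \<in> space M. \<bar>X n \<omega>\<bar> > \<epsilon>}) \<longlonglongrightarrow> 0)"

text \<open>The normal law with mean \<open>m\<close> and variance \<open>v \<ge> 0\<close>; for \<open>v = 0\<close> it is a point mass.\<close>

definition normal_law :: "real \<Rightarrow> real \<Rightarrow> real measure" where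
  "normal_law m v = (if v = 0 then return borel m else density lborel (normal_density m (sqrt v)))"

text \<open>
  Joint normality of the finite-dimensional distributions is expressed by normality
  (possibly degenerate) of all finite linear combinations.
\<close>

definition gaussian_process :: "'b measure \<Rightarrow> 'i set \<Rightarrow> ('i \<Rightarrow> 'b \<Rightarrow> real) \<Rightarrow> bool" where
  "gaussian_process P I Y \<longleftrightarrow>
     prob_space P \<and> (\<forall>t\<in>I. Y t \<in> borel_measurable P) \<and>
     (\<forall>J c. finite J \<and> J \<subseteq> I \<longrightarrow>
        (\<exists>m v. v \<ge> 0 \<and> distr P borel (\<lambda>\<omega>. \<Sum>t\<in>J. c t * Y t \<omega>) = normal_law m v))"

text \<open>
  For a process with continuous paths, measurability of all coordinates is the same as
  measurability as a random element of the space of continuous functions on the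
  (compact) index set.
\<close>

definition continuous_centered_gaussian_process ::
    "'b measure \<Rightarrow> ('i::topological_space) set \<Rightarrow> ('i \<Rightarrow> 'i \<Rightarrow> real) \<Rightarrow> ('i \<Rightarrow> 'b \<Rightarrow> real) \<Rightarrow> bool" where
  "continuous_centered_gaussian_process P I K Y \<longleftrightarrow>
     gaussian_process P I Y \<and>
     (\<forall>\<omega>\<in>space P. continuous_on I (\<lambda>t. Y t \<omega>)) \<and>
     (\<forall>t\<in>I. (\<integral>\<omega>. Y t \<omega> \<partial>P) = 0) \<and>
     (\<forall>s\<in>I. \<forall>t\<in>I. (\<integral>\<omega>. Y s \<omega> * Y t \<omega> \<partial>P) = K s t)"

definition influence_cov ::
    "('n::finite \<Rightarrow> real) \<Rightarrow> (real \<Rightarrow> real) \<Rightarrow>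
     'n weights \<times> (real ^ 'n) \<Rightarrow> 'n weights \<times> (real ^ 'n) \<Rightarrow> real" where
  "influence_cov \<alpha> F s t =
     cov_cdf F (influence \<alpha> (fst s) (snd s)) (influence \<alpha> (fst t) (snd t))"

end

theory Submission
  imports Defs
begin

text \<open>
  By the Rockafellar--Uryasev formula, \<open>AVaR\<close> at level \<open>\<alpha>\<close> is the minimum over \<open>t\<close> of the convex function
  \<open>t + E[Z - t]\<^sub>+ / (1 - \<alpha>)\<close>, attained exactly on the interval of quantiles; this holds for \<open>F\<close> and for the
  empirical distribution. Convexity makes the sample version localize: outside the quantile interval the
  one-sided derivatives at its endpoints are averages with mean of the right sign, so the sample minimum over
  the whole line and the one over the interval differ by \<open>o\<^sub>p\<close> of \<open>1 / sqrt N\<close>. The supremum over the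
  weights is the support function of a compact set, whose directional derivative is the support function
  of the set of maximizers.

  Since \<open>F\<close> is constant on the quantile interval \<open>[a, b]\<close>, almost surely
  \<open>[Z - t]\<^sub>+ = [Z - b]\<^sub>+ + (b - t) 1{Z \<ge> b}\<close> for all \<open>t\<close> in it. Hence the limiting process depends linearly on a
  finite-dimensional Gaussian vector, and no functional limit theorem is needed: the one-dimensional
  central limit theorem and the Cramer--Wold device suffice.
\<close>

section \<open>Weak convergence from one-dimensional projections\<close>

text \<open>The risk is handled as the support function of \<open>W\<close> at the vector
  \<open>\<theta>\<close> of mean and AVaR values. Between \<open>\<theta>\<close> and its sample
  version \<open>\<theta>_emp\<close> stands \<open>\<theta>_loc\<close>, whose infima run over the
  population quantile intervals: passing from \<open>\<theta>_emp\<close> to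
  \<open>\<theta>_loc\<close> costs the localization error, passing from \<open>W\<close> to its
  maximizers the directional-derivative error, and what remains is the sup-inf of the statement,
  because nonnegative weights let an infimum over a box split into coordinates. The limit is claimed
  for every continuous Gaussian process with the given covariance, on any probability space, so the
  Gaussian vector behind it has to be rebuilt from finitely many values of the process. The law of Z
  may have atoms at the ends of a quantile interval, hence the care with closed and open half-lines
  and with left and right derivatives. Cramer-Wold is proved without characteristic functions:
  trigonometric polynomials are sums of functions of one projection each, and they approximate
  bounded continuous functions up to an error that is small in mean.\<close>

inductive trig_poly :: "('e::euclidean_space \<Rightarrow> real) \<Rightarrow> bool" where
  trig_poly_0: "trig_poly (\<lambda>x. 0)"
| trig_poly_cos: "trig_poly f \<Longrightarrow> trig_poly (\<lambda>x. f x + a * cos (t \<bullet> x + c))"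

lemma trig_poly_eq: "trig_poly f \<Longrightarrow> (\<And>x. f x = g x) \<Longrightarrow> trig_poly g"
  by (metis ext)

lemma trig_poly_add: "trig_poly g \<Longrightarrow> trig_poly f \<Longrightarrow> trig_poly (\<lambda>x. f x + g x)"
proof (induction rule: trig_poly.induct)
  case trig_poly_0
  then show ?case by simp
next
  case (trig_poly_cos g a t c)
  have "trig_poly (\<lambda>x. (f x + g x) + a * cos (t \<bullet> x + c))"
    using trig_poly_cos by (intro trig_poly.intros) auto
  then show ?case by (simp add: add.assoc)
qed

lemma trig_poly_cos1: "trig_poly (\<lambda>x. a * cos (t \<bullet> x + c))"
  using trig_poly_cos[OF trig_poly_0, of a t c] by simp

lemma trig_poly_const: "trig_poly (\<lambda>x. a)"
  using trig_poly_cos1[of a 0 0] by simp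

lemma trig_poly_cmult: "trig_poly f \<Longrightarrow> trig_poly (\<lambda>x. r * f x)"
proof (induction rule: trig_poly.induct)
  case trig_poly_0
  then show ?case by (simp add: trig_poly.trig_poly_0)
next
  case (trig_poly_cos g a t c)
  have "trig_poly (\<lambda>x. r * g x + (r * a) * cos (t \<bullet> x + c))"
    using trig_poly_cos by (intro trig_poly.intros) auto
  then show ?case by (simp add: algebra_simps)
qed

text \<open>The product-to-sum formula keeps products of cosines in the class. The phases
  \<open>c\<close> are part of the class so that sines are covered too.\<close>

lemma trig_poly_mult_cos: "trig_poly f \<Longrightarrow> trig_poly (\<lambda>x. f x * cos (s \<bullet> x + d))"
proof (induction rule: trig_poly.induct)
  case trig_poly_0
  then show ?case by (simp add: trig_poly.trig_poly_0)
next
  case (trig_poly_cos g a t c)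
  have "trig_poly (\<lambda>x. g x * cos (s \<bullet> x + d) +
      (a / 2 * cos ((t - s) \<bullet> x + (c - d)) + a / 2 * cos ((t + s) \<bullet> x + (c + d))))"
    by (intro trig_poly_add trig_poly_cos1 trig_poly_cos.IH)
  then show ?case
    by (rule trig_poly_eq) (simp add: algebra_simps cos_times_cos inner_add_left inner_diff_left add_divide_distrib)
qed

lemma trig_poly_mult: "trig_poly g \<Longrightarrow> trig_poly f \<Longrightarrow> trig_poly (\<lambda>x. f x * g x)"
proof (induction rule: trig_poly.induct)
  case trig_poly_0
  then show ?case by (simp add: trig_poly.trig_poly_0)
next
  case (trig_poly_cos g a t c)
  have "trig_poly (\<lambda>x. f x * g x + a * (f x * cos (t \<bullet> x + c)))"
    using trig_poly_cos by (intro trig_poly_add trig_poly_cmult trig_poly_mult_cos) auto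
  then show ?case by (rule trig_poly_eq) (simp add: algebra_simps)
qed

lemma trig_poly_sum: "finite A \<Longrightarrow> (\<And>i. i \<in> A \<Longrightarrow> trig_poly (f i)) \<Longrightarrow> trig_poly (\<lambda>x. \<Sum>i\<in>A. f i x)"
  by (induction rule: finite_induct) (auto intro: trig_poly_add trig_poly_0)

lemma trig_poly_sin: "trig_poly (\<lambda>x. sin (t \<bullet> x))"
  using trig_poly_cos1[of 1 t "- pi/2"] by (simp add: cos_diff)

text \<open>
  A polynomial in these coordinates is a trigonometric polynomial, and \<open>R * arcsin\<close> inverts them on the
  cube of radius \<open>R\<close>; so a bounded continuous function agrees on that cube with a continuous function
  of the coordinates obeying the same bound everywhere.
\<close>

definition sin_coords :: "real \<Rightarrow> 'e::euclidean_space \<Rightarrow> 'e" where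
  "sin_coords R x = (\<Sum>b\<in>Basis. sin ((b \<bullet> x) / R) *\<^sub>R b)"

lemma trig_poly_sin_coords:
  "real_polynomial_function p \<Longrightarrow> trig_poly (\<lambda>x. p (sin_coords R x))"
proof (induction rule: real_polynomial_function.induct)
  case (linear f)
  then interpret bounded_linear f .
  have "trig_poly (\<lambda>x. \<Sum>b\<in>Basis. f b * sin (((1/R) *\<^sub>R b) \<bullet> x))"
    by (intro trig_poly_sum trig_poly_cmult trig_poly_sin) auto
  then show ?case
    by (rule trig_poly_eq) (simp add: sin_coords_def sum scaleR mult.commute)
qed (auto intro: trig_poly_const trig_poly_add trig_poly_mult)

lemma trig_poly_bounded_continuous:
  "trig_poly f \<Longrightarrow> continuous_on UNIV f \<and> (\<exists>B. \<forall>x. \<bar>f x\<bar> \<le> B)"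
proof (induction rule: trig_poly.induct)
  case trig_poly_0
  then show ?case by auto
next
  case (trig_poly_cos f a t c)
  then obtain B where B: "\<And>x. \<bar>f x\<bar> \<le> B" by auto
  have "\<bar>f x + a * cos (t \<bullet> x + c)\<bar> \<le> B + \<bar>a\<bar>" for x
  proof -
    have "\<bar>a * cos (t \<bullet> x + c)\<bar> \<le> \<bar>a\<bar> * 1"
      unfolding abs_mult by (intro mult_left_mono) auto
    with B[of x] show ?thesis by linarith
  qed
  with trig_poly_cos show ?case by (auto intro!: continuous_intros)
qed

lemma (in prob_space) integrable_bounded_continuous_compose:
  fixes f :: "'e::euclidean_space \<Rightarrow> real"
  assumes "continuous_on UNIV f" "\<And>x. \<bar>f x\<bar> \<le> B" "X \<in> borel_measurable M"
  shows "integrable M (\<lambda>\<omega>. f (X \<omega>))"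
proof (rule integrable_const_bound[of _ B])
  show "(\<lambda>\<omega>. f (X \<omega>)) \<in> borel_measurable M"
    using assms borel_measurable_continuous_onI by (intro measurable_compose[OF assms(3)]) auto
qed (use assms in auto)

lemma abs_integral_diff_le:
  fixes f g d :: "'a \<Rightarrow> real"
  assumes "integrable M f" "integrable M g" "integrable M d"
    and "\<And>x. x \<in> space M \<Longrightarrow> \<bar>f x - g x\<bar> \<le> d x"
  shows "\<bar>integral\<^sup>L M f - integral\<^sup>L M g\<bar> \<le> integral\<^sup>L M d"
proof -
  have "\<bar>integral\<^sup>L M f - integral\<^sup>L M g\<bar> = \<bar>\<integral>x. f x - g x \<partial>M\<bar>"
    using assms by simp
  also have "\<dots> \<le> (\<integral>x. \<bar>f x - g x\<bar> \<partial>M)" by (rule integral_abs_bound)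
  also have "\<dots> \<le> integral\<^sup>L M d"
    using assms by (intro integral_mono integrable_abs Bochner_Integration.integrable_diff) auto
  finally show ?thesis .
qed

section \<open>The Cramer-Wold device\<close>

locale weak_convergence_of_projections = M: prob_space M + P: prob_space P
  for M :: "'a measure" and P :: "'b measure" +
  fixes X :: "nat \<Rightarrow> 'a \<Rightarrow> 'e::euclidean_space" and Y :: "'b \<Rightarrow> 'e"
  assumes X_measurable [measurable]: "\<And>n. X n \<in> borel_measurable M"
    and Y_measurable [measurable]: "Y \<in> borel_measurable P"
    and projections: "\<And>t. weak_conv_m (\<lambda>n. distr M borel (\<lambda>\<omega>. t \<bullet> X n \<omega>)) (distr P borel (\<lambda>\<omega>. t \<bullet> Y \<omega>))"
begin

definition conv_mean :: "('e \<Rightarrow> real) \<Rightarrow> bool" where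
  "conv_mean f \<longleftrightarrow> (\<lambda>n. \<integral>\<omega>. f (X n \<omega>) \<partial>M) \<longlonglongrightarrow> (\<integral>\<omega>. f (Y \<omega>) \<partial>P)"

lemma conv_mean_projection:
  fixes g :: "real \<Rightarrow> real"
  assumes g: "continuous_on UNIV g" "\<And>x. \<bar>g x\<bar> \<le> B"
  shows "conv_mean (\<lambda>x. g (t \<bullet> x))"
proof -
  have [measurable]: "g \<in> borel_measurable borel"
    using g by (intro borel_measurable_continuous_onI)
  have "(\<lambda>n. integral\<^sup>L (distr M borel (\<lambda>\<omega>. t \<bullet> X n \<omega>)) g) \<longlonglongrightarrow> integral\<^sup>L (distr P borel (\<lambda>\<omega>. t \<bullet> Y \<omega>)) g"
    using g by (intro weak_conv_imp_integral_bdd_continuous_conv[OF _ _ projections, of _ _ B]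
        M.real_distribution_distr P.real_distribution_distr)
      (auto simp: continuous_on_eq_continuous_at)
  then show ?thesis
    by (simp add: conv_mean_def integral_distr)
qed

text \<open>Each summand is a bounded continuous function of the single projection
  \<open>t \<bullet> x\<close>, so the hypothesis on projections applies term by term.\<close>

lemma conv_mean_trig_poly: "trig_poly f \<Longrightarrow> conv_mean f"
proof (induction rule: trig_poly.induct)
  case trig_poly_0
  then show ?case by (simp add: conv_mean_def)
next
  case (trig_poly_cos f a t c)
  from trig_poly_bounded_continuous[OF trig_poly_cos(1)]
  obtain B where f: "continuous_on UNIV f" "\<And>x. \<bar>f x\<bar> \<le> B" by auto
  have g: "conv_mean (\<lambda>x. (\<lambda>u. a * cos (u + c)) (t \<bullet> x))"
    by (rule conv_mean_projection[of _ "\<bar>a\<bar>"]) (auto intro!: continuous_intros mult_left_le simp: abs_mult)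
  have ab: "continuous_on UNIV (\<lambda>x. a * cos (t \<bullet> x + c))" "\<And>x. \<bar>a * cos (t \<bullet> x + c)\<bar> \<le> \<bar>a\<bar>"
    by (auto intro!: continuous_intros mult_left_le simp: abs_mult)
  show ?case
    using tendsto_add[OF trig_poly_cos.IH[unfolded conv_mean_def] g[unfolded conv_mean_def]]
    unfolding conv_mean_def
    using M.integrable_bounded_continuous_compose[OF f X_measurable]
      M.integrable_bounded_continuous_compose[OF ab X_measurable]
      P.integrable_bounded_continuous_compose[OF f Y_measurable]
      P.integrable_bounded_continuous_compose[OF ab Y_measurable]
    by (subst (1 2) Bochner_Integration.integral_add) auto
qed

text \<open>Uniform approximation is out of reach on the unbounded space, so the error bound
  \<open>d\<close> is only asked to be small in mean under the limit. Convergence of the means of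
  \<open>d\<close> carries the smallness over to \<open>X n\<close> for large \<open>n\<close>; this
  is how tightness enters.\<close>

definition conv_mean_close :: "real \<Rightarrow> ('e \<Rightarrow> real) \<Rightarrow> bool" where
  "conv_mean_close e f \<longleftrightarrow> (\<exists>g d B'. conv_mean g \<and> conv_mean d \<and> continuous_on UNIV g \<and> continuous_on UNIV d
      \<and> (\<forall>x. \<bar>g x\<bar> \<le> B' \<and> \<bar>d x\<bar> \<le> B') \<and> (\<forall>x. \<bar>f x - g x\<bar> \<le> d x) \<and> (\<integral>\<omega>. d (Y \<omega>) \<partial>P) < e)"

lemma conv_mean_approx:
  fixes f :: "'e \<Rightarrow> real"
  assumes f: "continuous_on UNIV f" "\<And>x. \<bar>f x\<bar> \<le> B"
  assumes approx: "\<And>e. e > 0 \<Longrightarrow> conv_mean_close e f"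
  shows "conv_mean f"
  unfolding conv_mean_def
proof (rule LIMSEQ_I)
  fix r :: real assume r: "r > 0"
  obtain g d B' where g: "conv_mean g" "continuous_on UNIV g" "\<And>x. \<bar>g x\<bar> \<le> B'"
    and d: "conv_mean d" "continuous_on UNIV d" "\<And>x. \<bar>d x\<bar> \<le> B'"
    and fg: "\<And>x. \<bar>f x - g x\<bar> \<le> d x" and small: "(\<integral>\<omega>. d (Y \<omega>) \<partial>P) < r/3"
    using approx[of "r/3"] r unfolding conv_mean_close_def by auto
  note int = M.integrable_bounded_continuous_compose[OF f X_measurable]
    M.integrable_bounded_continuous_compose[OF g(2,3) X_measurable]
    M.integrable_bounded_continuous_compose[OF d(2,3) X_measurable]
    P.integrable_bounded_continuous_compose[OF f Y_measurable]
    P.integrable_bounded_continuous_compose[OF g(2,3) Y_measurable]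
    P.integrable_bounded_continuous_compose[OF d(2,3) Y_measurable]
  have 1: "\<bar>(\<integral>\<omega>. f (X n \<omega>) \<partial>M) - (\<integral>\<omega>. g (X n \<omega>) \<partial>M)\<bar> \<le> (\<integral>\<omega>. d (X n \<omega>) \<partial>M)" for n
    using int fg by (intro abs_integral_diff_le) auto
  have 2: "\<bar>(\<integral>\<omega>. f (Y \<omega>) \<partial>P) - (\<integral>\<omega>. g (Y \<omega>) \<partial>P)\<bar> \<le> (\<integral>\<omega>. d (Y \<omega>) \<partial>P)"
    using int fg by (intro abs_integral_diff_le) auto
  have ev1: "\<forall>\<^sub>F n in sequentially. (\<integral>\<omega>. d (X n \<omega>) \<partial>M) < r/3"
    using d(1) small unfolding conv_mean_def by (rule order_tendstoD)
  have ev2: "\<forall>\<^sub>F n in sequentially. dist (\<integral>\<omega>. g (X n \<omega>) \<partial>M) (\<integral>\<omega>. g (Y \<omega>) \<partial>P) < r/3"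
    using g(1) r unfolding conv_mean_def by (intro tendstoD) auto
  have "\<forall>\<^sub>F n in sequentially. norm ((\<integral>\<omega>. f (X n \<omega>) \<partial>M) - (\<integral>\<omega>. f (Y \<omega>) \<partial>P)) < r"
    using ev1 ev2
  proof eventually_elim
    case (elim n)
    then show ?case using 1[of n] 2 small unfolding dist_real_def real_norm_def by linarith
  qed
  then show "\<exists>no. \<forall>n\<ge>no. norm ((\<integral>\<omega>. f (X n \<omega>) \<partial>M) - (\<integral>\<omega>. f (Y \<omega>) \<partial>P)) < r"
    by (simp add: eventually_sequentially)
qed

text \<open>Stone-Weierstrass on the compact cube replaces \<open>q\<close> by a polynomial, which
  becomes a trigonometric polynomial after composition. The error is uniform, so the constant
  \<open>e/2\<close> serves as \<open>d\<close>.\<close>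

lemma conv_mean_sin_coords:
  fixes q :: "'e \<Rightarrow> real"
  assumes q: "continuous_on (cbox (- One) One) q"
  shows "conv_mean (\<lambda>x. q (sin_coords R x))"
proof -
  have range: "sin_coords R x \<in> cbox (- One) One" for x :: 'e
    by (auto simp: sin_coords_def mem_box)
  have cts: "continuous_on UNIV (\<lambda>x. q (sin_coords R x))"
    by (rule continuous_on_compose2[OF q]) (use range in \<open>auto simp: sin_coords_def divide_inverse intro!: continuous_intros\<close>)
  have "compact (q ` cbox (- One) One)"
    using q by (intro compact_continuous_image) auto
  then obtain B where B: "\<And>x. x \<in> cbox (- One) One \<Longrightarrow> \<bar>q x\<bar> \<le> B"
    by (fastforce dest!: compact_imp_bounded simp: bounded_iff)
  show ?thesis
  proof (rule conv_mean_approx[OF cts, of B])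
    show "\<bar>q (sin_coords R x)\<bar> \<le> B" for x by (rule B[OF range])
    fix e :: real assume e: "e > 0"
    obtain p where p: "real_polynomial_function p" "\<And>x. x \<in> cbox (- One) One \<Longrightarrow> \<bar>q x - p x\<bar> < e/2"
      using Stone_Weierstrass_real_polynomial_function[OF compact_cbox q, of "e/2"] e by auto
    have t: "trig_poly (\<lambda>x. p (sin_coords R x))" by (rule trig_poly_sin_coords[OF p(1)])
    obtain B' where "continuous_on UNIV (\<lambda>x. p (sin_coords R x))" "\<And>x. \<bar>p (sin_coords R x)\<bar> \<le> B'"
      using trig_poly_bounded_continuous[OF t] by auto
    then show "conv_mean_close e (\<lambda>x. q (sin_coords R x))"
      unfolding conv_mean_close_def
      using e p(2)[OF range] conv_mean_trig_poly[OF t]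
      by (intro exI[of _ "\<lambda>x. p (sin_coords R x)"] exI[of _ "\<lambda>x. e/2"] exI[of _ "max B' (e/2)"])
        (auto simp: conv_mean_def P.prob_space M.prob_space le_max_iff_disj intro: less_imp_le)
  qed
qed

text \<open>The approximant \<open>g R\<close> equals \<open>f\<close> on the cube of radius
  \<open>R\<close> and keeps the bound \<open>B\<close> elsewhere, so the error is at most
  \<open>2 * B\<close> and lives outside the cube. It is dominated by \<open>d R\<close>, a sum of
  functions of single coordinates, whose mean under the limit tends to 0 as \<open>R\<close> grows,
  by dominated convergence.\<close>

lemma conv_mean_bounded_continuous:
  fixes f :: "'e \<Rightarrow> real"
  assumes f: "continuous_on UNIV f" "\<And>x. \<bar>f x\<bar> \<le> B"
  shows "conv_mean f"
proof (rule conv_mean_approx[OF f])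
  fix e :: real assume e: "e > 0"
  have B0: "B \<ge> 0" using f(2)[of 0] by linarith
  define d where "d R x = 2 * B * (\<Sum>b\<in>Basis. min 1 (\<bar>b \<bullet> x\<bar> / R))" for R and x :: 'e
  define g where "g R x = f (\<Sum>b\<in>Basis. (R * arcsin (sin_coords R x \<bullet> b)) *\<^sub>R b)" for R and x :: 'e
  have "(\<lambda>R. \<integral>\<omega>. d (real (Suc R)) (Y \<omega>) \<partial>P) \<longlonglongrightarrow> (\<integral>\<omega>. 0 \<partial>P)"
  proof (rule integral_dominated_convergence[where w="\<lambda>_. 2 * B * real DIM('e)"])
    show "AE \<omega> in P. (\<lambda>R. d (real (Suc R)) (Y \<omega>)) \<longlonglongrightarrow> 0"
    proof (rule AE_I2)
      fix \<omega>
      have "(\<lambda>R. \<bar>b \<bullet> Y \<omega>\<bar> / real (Suc R)) \<longlonglongrightarrow> 0" for b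
        by (rule LIMSEQ_Suc[OF lim_const_over_n])
      then have "(\<lambda>R. d (real (Suc R)) (Y \<omega>)) \<longlonglongrightarrow> 2 * B * (\<Sum>b\<in>(Basis::'e set). min 1 0)"
        unfolding d_def by (intro tendsto_intros)
      then show "(\<lambda>R. d (real (Suc R)) (Y \<omega>)) \<longlonglongrightarrow> 0" by simp
    qed
    have "(\<Sum>b\<in>Basis. min 1 (\<bar>b \<bullet> x\<bar> / real (Suc R))) \<le> (\<Sum>b\<in>(Basis::'e set). 1)" for x :: 'e and R
      by (intro sum_mono) auto
    then show "AE \<omega> in P. norm (d (real (Suc R)) (Y \<omega>)) \<le> 2 * B * real DIM('e)" for R
      using B0 unfolding d_def by (auto intro!: AE_I2 mult_left_mono sum_nonneg simp: abs_mult abs_of_nonneg sum_nonneg)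
  qed (auto simp: d_def)
  then have "\<forall>\<^sub>F R in sequentially. (\<integral>\<omega>. d (real (Suc R)) (Y \<omega>) \<partial>P) < e"
    using e by (intro order_tendstoD) auto
  then obtain R0 where "(\<integral>\<omega>. d (real (Suc R0)) (Y \<omega>) \<partial>P) < e"
    by (auto simp: eventually_sequentially)
  then obtain R :: real where R: "R > 0" and small: "(\<integral>\<omega>. d R (Y \<omega>) \<partial>P) < e"
    by (meson of_nat_0_less_iff zero_less_Suc)
  have dcts: "continuous_on UNIV (d R)"
    unfolding d_def divide_inverse by (intro continuous_intros)
  have db: "0 \<le> d R x" "\<bar>d R x\<bar> \<le> 2 * B * real DIM('e)" for x
  proof -
    have "(\<Sum>b\<in>Basis. min 1 (\<bar>b \<bullet> x\<bar> / R)) \<le> (\<Sum>b\<in>(Basis::'e set). 1)"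
      by (intro sum_mono) auto
    moreover show "0 \<le> d R x" using B0 R unfolding d_def by (auto intro!: mult_nonneg_nonneg sum_nonneg)
    ultimately show "\<bar>d R x\<bar> \<le> 2 * B * real DIM('e)"
      using B0 unfolding d_def by (auto intro!: mult_left_mono)
  qed
  have dc: "conv_mean (d R)"
  proof -
    have c: "conv_mean (\<lambda>x. (\<lambda>u. min 1 (\<bar>u\<bar> / R)) (b \<bullet> x))" for b
      using R by (intro conv_mean_projection[of _ 1]) (auto simp: divide_inverse intro!: continuous_intros)
    have int: "integrable M (\<lambda>\<omega>. min 1 (\<bar>b \<bullet> X n \<omega>\<bar> / R))" "integrable P (\<lambda>\<omega>. min 1 (\<bar>b \<bullet> Y \<omega>\<bar> / R))" for b n
      using R by (auto intro!: M.integrable_const_bound[of _ 1] P.integrable_const_bound[of _ 1])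
    have "(\<lambda>n. 2 * B * (\<Sum>b\<in>Basis. \<integral>\<omega>. min 1 (\<bar>b \<bullet> X n \<omega>\<bar> / R) \<partial>M)) \<longlonglongrightarrow>
       2 * B * (\<Sum>b\<in>Basis. \<integral>\<omega>. min 1 (\<bar>b \<bullet> Y \<omega>\<bar> / R) \<partial>P)"
      by (intro tendsto_intros c[unfolded conv_mean_def])
    then show ?thesis unfolding conv_mean_def d_def
      by (simp add: Bochner_Integration.integral_sum[OF int(1)] Bochner_Integration.integral_sum[OF int(2)])
  qed
  have qcts: "continuous_on (cbox (- One) One) (\<lambda>s. f (\<Sum>b\<in>Basis. (R * arcsin (s \<bullet> b)) *\<^sub>R b))"
    by (rule continuous_on_compose2[OF f(1)])
      (auto intro!: continuous_intros simp: mem_box)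
  have gc: "conv_mean (g R)"
    using conv_mean_sin_coords[OF qcts] unfolding g_def .
  have gcts: "continuous_on UNIV (g R)"
    unfolding g_def
    by (rule continuous_on_compose2[OF qcts, of _ "sin_coords R"])
      (auto simp: sin_coords_def mem_box divide_inverse intro!: continuous_intros)
  have fg: "\<bar>f x - g R x\<bar> \<le> d R x" for x
  proof (cases "\<forall>b\<in>Basis. \<bar>b \<bullet> x\<bar> \<le> R")
    case True
    have "R * arcsin (sin_coords R x \<bullet> b) = x \<bullet> b" if b: "b \<in> Basis" for b
    proof -
      have "sin_coords R x \<bullet> b = sin ((b \<bullet> x) / R)" using b by (simp add: sin_coords_def)
      \<comment> \<open>On the cube the angle lies in [-1, 1], inside the interval [-pi/2, pi/2]
        where \<open>arcsin\<close> inverts \<open>sin\<close>.\<close>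
      moreover have "arcsin (sin ((b \<bullet> x) / R)) = (b \<bullet> x) / R"
      proof (rule arcsin_sin)
        have "\<bar>(b \<bullet> x) / R\<bar> \<le> 1" using True b R by auto
        then have "- 1 \<le> (b \<bullet> x) / R" "(b \<bullet> x) / R \<le> 1" by linarith+
        then show "- (pi / 2) \<le> (b \<bullet> x) / R" "(b \<bullet> x) / R \<le> pi / 2"
          using pi_ge_two by linarith+
      qed
      ultimately show ?thesis using R by (simp add: inner_commute)
    qed
    then have "g R x = f x" unfolding g_def by (simp add: euclidean_representation)
    then show ?thesis using db by simp
  next
    case False
    then obtain b where b: "b \<in> Basis" "\<bar>b \<bullet> x\<bar> > R" by auto
    have "1 = min 1 (\<bar>b \<bullet> x\<bar> / R)" using b R by auto
    also have "\<dots> \<le> (\<Sum>b\<in>Basis. min 1 (\<bar>b \<bullet> x\<bar> / R))"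
      using b R by (intro member_le_sum) auto
    finally have "2 * B * 1 \<le> d R x" unfolding d_def using B0 by (intro mult_left_mono) auto
    moreover have "\<bar>g R x\<bar> \<le> B" unfolding g_def by (rule f(2))
    ultimately show ?thesis using f(2)[of x] by linarith
  qed
  have gb: "\<bar>g R x\<bar> \<le> B" for x unfolding g_def by (rule f(2))
  show "conv_mean_close e f"
    unfolding conv_mean_close_def
    using gc dc gcts dcts gb db fg small
    by (intro exI[of _ "g R"] exI[of _ "d R"] exI[of _ "max B (2 * B * real DIM('e))"]) (auto simp: le_max_iff_disj)
qed

text \<open>Cramer-Wold and continuous mapping at once: a bounded continuous test function composed
  with \<open>h\<close> is bounded and continuous on the whole space.\<close>

theorem continuous_image:
  fixes h :: "'e \<Rightarrow> real"
  assumes h: "continuous_on UNIV h"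
  shows "weak_conv_m (\<lambda>n. distr M borel (\<lambda>\<omega>. h (X n \<omega>))) (distr P borel (\<lambda>\<omega>. h (Y \<omega>)))"
proof -
  have [measurable]: "h \<in> borel_measurable borel"
    using h by (rule borel_measurable_continuous_onI)
  show ?thesis
  proof (rule integral_bdd_continuous_conv_imp_weak_conv)
    fix f :: "real \<Rightarrow> real" assume f: "\<And>x. isCont f x" "\<And>x. \<bar>f x\<bar> \<le> 1"
    then have c: "continuous_on UNIV f" by (simp add: continuous_on_eq_continuous_at)
    then have [measurable]: "f \<in> borel_measurable borel" by (rule borel_measurable_continuous_onI)
    have "conv_mean (\<lambda>x. f (h x))"
      using f by (intro conv_mean_bounded_continuous[of _ 1] continuous_on_compose2[OF c h]) auto
    then show "(\<lambda>n. integral\<^sup>L (distr M borel (\<lambda>\<omega>. h (X n \<omega>))) f) \<longlonglongrightarrow> integral\<^sup>L (distr P borel (\<lambda>\<omega>. h (Y \<omega>))) f"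
      by (simp add: conv_mean_def integral_distr)
  qed (auto intro!: M.real_distribution_distr P.real_distribution_distr)
qed

end

section \<open>Slutsky's lemma\<close>

lemma cts_step_bounds: "a < b \<Longrightarrow> 0 \<le> cts_step a b x \<and> cts_step a b x \<le> 1"
  by (auto simp: cts_step_def)

text \<open>The ramps \<open>cts_step\<close> suffice as test functions. They are uniformly
  continuous with values in [0, 1], so adding \<open>D n\<close> changes their mean by at most
  \<open>r/2\<close> plus the probability that \<open>\<bar>D n \<omega>\<bar>\<close> exceeds
  \<open>\<delta>/2\<close>.\<close>

lemma (in prob_space) weak_conv_m_add_tendsto_0_in_prob:
  assumes X [measurable]: "\<And>n. X n \<in> borel_measurable M"
    and \<nu>: "real_distribution \<nu>"
    and conv: "weak_conv_m (\<lambda>n. distr M borel (X n)) \<nu>"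
    and D: "tendsto_0_in_prob M D"
  shows "weak_conv_m (\<lambda>n. distr M borel (\<lambda>\<omega>. X n \<omega> + D n \<omega>)) \<nu>"
proof -
  have [measurable]: "D n \<in> borel_measurable M" for n
    using D by (auto simp: tendsto_0_in_prob_def)
  have D0: "(\<lambda>n. prob {\<omega> \<in> space M. \<bar>D n \<omega>\<bar> > \<epsilon>}) \<longlonglongrightarrow> 0" if "\<epsilon> > 0" for \<epsilon>
    using D that by (auto simp: tendsto_0_in_prob_def)
  show ?thesis
  proof (rule integral_cts_step_conv_imp_weak_conv[OF _ \<nu>])
    show "real_distribution (distr M borel (\<lambda>\<omega>. X n \<omega> + D n \<omega>))" for n by auto
    fix x y :: real assume xy: "x < y"
    let ?f = "cts_step x y"
    have uc: "uniformly_continuous_on UNIV ?f" by (rule cts_step_uniformly_continuous[OF xy])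
    have f: "continuous_on UNIV ?f" by (rule uniformly_continuous_imp_continuous[OF uc])
    then have [measurable]: "?f \<in> borel_measurable borel" by (rule borel_measurable_continuous_onI)
    have f01: "0 \<le> ?f z" "?f z \<le> 1" for z using cts_step_bounds[OF xy] by auto
    have lim: "(\<lambda>n. integral\<^sup>L (distr M borel (X n)) ?f) \<longlonglongrightarrow> integral\<^sup>L \<nu> ?f"
      using f f01 by (intro weak_conv_imp_integral_bdd_continuous_conv[OF _ \<nu> conv, of _ 1])
        (auto simp: continuous_on_eq_continuous_at)
    have "(\<lambda>n. expectation (\<lambda>\<omega>. ?f (X n \<omega> + D n \<omega>)) - expectation (\<lambda>\<omega>. ?f (X n \<omega>))) \<longlonglongrightarrow> 0"
    proof (rule LIMSEQ_I)
      fix r :: real assume r: "r > 0"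
      obtain \<delta> where \<delta>: "\<delta> > 0" "\<And>u v. dist u v < \<delta> \<Longrightarrow> dist (?f u) (?f v) < r/2"
        using uc r unfolding uniformly_continuous_on_def by (metis UNIV_I half_gt_zero)
      let ?A = "\<lambda>n. {\<omega> \<in> space M. \<bar>D n \<omega>\<bar> > \<delta>/2}"
      have int: "integrable M (\<lambda>\<omega>. ?f (X n \<omega> + D n \<omega>))" "integrable M (\<lambda>\<omega>. ?f (X n \<omega>))" for n
        using f01 by (auto intro!: integrable_const_bound[of _ 1])
      have int2: "integrable M (\<lambda>\<omega>. r/2 + indicator (?A n) \<omega>)" for n
        by (intro Bochner_Integration.integrable_add integrable_const integrable_real_indicator) (auto simp: emeasure_eq_measure)
      have bd: "\<bar>?f (X n \<omega> + D n \<omega>) - ?f (X n \<omega>)\<bar> \<le> r/2 + indicator (?A n) \<omega>" if "\<omega> \<in> space M" for n \<omega>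
      proof (cases "\<bar>D n \<omega>\<bar> > \<delta>/2")
        case True
        then show ?thesis using that r f01[of "X n \<omega> + D n \<omega>"] f01[of "X n \<omega>"] by (auto simp: abs_le_iff)
      next
        case False
        then have "dist (X n \<omega> + D n \<omega>) (X n \<omega>) < \<delta>" using \<delta>(1) by (auto simp: dist_real_def)
        from \<delta>(2)[OF this] show ?thesis using False by (auto simp: dist_real_def)
      qed
      have "\<bar>expectation (\<lambda>\<omega>. ?f (X n \<omega> + D n \<omega>)) - expectation (\<lambda>\<omega>. ?f (X n \<omega>))\<bar> \<le> r/2 + prob (?A n)" for n
      proof -
        have "\<bar>expectation (\<lambda>\<omega>. ?f (X n \<omega> + D n \<omega>)) - expectation (\<lambda>\<omega>. ?f (X n \<omega>))\<bar>
          \<le> expectation (\<lambda>\<omega>. r/2 + indicator (?A n) \<omega>)"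
          using bd int int2 by (intro abs_integral_diff_le) auto
        also have "\<dots> = r/2 + prob (?A n)"
          by (subst Bochner_Integration.integral_add) (auto simp: prob_space emeasure_eq_measure)
        finally show ?thesis .
      qed
      note le = this
      have "\<forall>\<^sub>F n in sequentially. prob (?A n) < r/2"
        using D0[of "\<delta>/2"] \<delta>(1) r by (intro order_tendstoD) auto
      then have "\<forall>\<^sub>F n in sequentially. norm (expectation (\<lambda>\<omega>. ?f (X n \<omega> + D n \<omega>)) - expectation (\<lambda>\<omega>. ?f (X n \<omega>)) - 0) < r"
      proof eventually_elim
        case (elim n)
        then show ?case using le[of n] unfolding real_norm_def diff_zero by linarith
      qed
      then show "\<exists>no. \<forall>n\<ge>no. norm (expectation (\<lambda>\<omega>. ?f (X n \<omega> + D n \<omega>)) - expectation (\<lambda>\<omega>. ?f (X n \<omega>)) - 0) < r"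
        by (simp add: eventually_sequentially)
    qed
    from tendsto_add[OF this lim]
    show "(\<lambda>n. integral\<^sup>L (distr M borel (\<lambda>\<omega>. X n \<omega> + D n \<omega>)) ?f) \<longlonglongrightarrow> integral\<^sup>L \<nu> ?f"
      by (simp add: integral_distr)
  qed
qed

section \<open>Average Value-at-Risk\<close>

definition right_quantile :: "(real \<Rightarrow> real) \<Rightarrow> real \<Rightarrow> real" where
  "right_quantile F \<alpha> = Sup {t. F t \<le> \<alpha>}"

lemma quantiles_eq: "quantiles F \<alpha> = {left_quantile F \<alpha> .. right_quantile F \<alpha>}"
  by (simp add: quantiles_def right_quantile_def)

lemma interval_measure_cdf:
  assumes "real_distribution \<mu>"
  shows "interval_measure (cdf \<mu>) = \<mu>"
proof -
  interpret real_distribution \<mu> by fact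
  show ?thesis
    using cdf_nondecreasing cdf_is_right_cont cdf_lim_at_bot cdf_lim_at_top_prob
    by (intro cdf_unique real_distribution_interval_measure cdf_interval_measure assms) auto
qed

text \<open>The parent locale brings \<open>C\<close>, the cdf of \<open>M\<close>, and its
  generalized inverse \<open>I\<close>, which is \<open>left_quantile C\<close>. Under the uniform
  law on (0, 1) the variable \<open>I\<close> has law \<open>M\<close>, so quantile integrals and
  expectations under \<open>M\<close> can be compared inside one integral.\<close>

locale cdf_level = cdf_distribution M for M :: "real measure" +
  fixes \<alpha> :: real
  assumes \<alpha>: "0 < \<alpha>" "\<alpha> < 1"
begin

abbreviation "lq \<equiv> left_quantile C \<alpha>"
abbreviation "rq \<equiv> right_quantile C \<alpha>"

lemma le_C_iff_lq_le: "\<alpha> \<le> C x \<longleftrightarrow> lq \<le> x"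
  unfolding left_quantile_def by (rule pseudoinverse[OF \<alpha>])

lemma C_less_iff_less_lq: "C x < \<alpha> \<longleftrightarrow> x < lq"
  using le_C_iff_lq_le[of x] by auto

lemma C_le_nonempty: "{t. C t \<le> \<alpha>} \<noteq> {}"
proof -
  have "\<forall>\<^sub>F x in at_bot. C x < \<alpha>" by (rule order_tendstoD(2)[OF bot \<alpha>(1)])
  then obtain x where "C x < \<alpha>" using eventually_happens'[OF trivial_limit_at_bot_linorder] by blast
  then show ?thesis by (auto intro: less_imp_le)
qed

lemma C_le_bdd_above: "bdd_above {t. C t \<le> \<alpha>}"
proof -
  have "\<forall>\<^sub>F x in at_top. \<alpha> < C x" by (rule order_tendstoD(1)[OF top \<alpha>(2)])
  then obtain x where "\<alpha> < C x" using eventually_happens'[OF trivial_limit_at_top_linorder] by blast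
  then have "t \<le> x" if "C t \<le> \<alpha>" for t
    using that monoD[OF mono, of x t] by linarith
  then show ?thesis by (intro bdd_aboveI[of _ x]) auto
qed

lemma C_le_of_less_rq:
  assumes "x < rq"
  shows "C x \<le> \<alpha>"
proof -
  obtain y where "C y \<le> \<alpha>" "x < y"
    using less_cSupD[OF C_le_nonempty assms[unfolded right_quantile_def]] by auto
  then show ?thesis using monoD[OF mono, of x y] by linarith
qed

lemma less_C_of_rq_less:
  assumes "rq < x"
  shows "\<alpha> < C x"
proof (rule ccontr)
  assume "\<not> \<alpha> < C x"
  then have "x \<le> rq" unfolding right_quantile_def by (intro cSup_upper C_le_bdd_above) auto
  then show False using assms by simp
qed

lemma lq_le_rq: "lq \<le> rq"
proof (rule ccontr)
  assume "\<not> lq \<le> rq"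
  then obtain x where "rq < x" "x < lq" using dense[of rq lq] by (auto simp: not_le)
  then show False using C_less_iff_less_lq[of x] less_C_of_rq_less[of x] by simp
qed

lemma prob_lessThan_le: "(\<And>t. t < x \<Longrightarrow> C t \<le> \<alpha>) \<Longrightarrow> prob {..<x} \<le> \<alpha>"
  by (rule tendsto_upperbound[OF cdf_at_left]) (auto simp: eventually_at_left[of "x - 1"] intro!: exI[of _ "x - 1"])

lemma prob_atLeast: "prob {x..} = 1 - prob {..<x}"
  using prob_compl[of "{..<x}"] by (simp add: Compl_eq_Diff_UNIV[symmetric] Compl_lessThan)

lemma prob_greaterThan: "prob {x<..} = 1 - C x"
  using prob_compl[of "{..x}"] by (simp add: Compl_eq_Diff_UNIV[symmetric] Compl_atMost cdf_def)

text \<open>The one-sided derivatives of \<open>RU\<close> at \<open>x\<close> are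
  \<open>1 - prob {x..} / (1 - \<alpha>)\<close> from the left and
  \<open>1 - prob {x<..} / (1 - \<alpha>)\<close> from the right. This bound and the three after it
  fix their signs: weakly at \<open>lq\<close> and \<open>rq\<close>, strictly beyond them.\<close>

lemma prob_atLeast_lq: "prob {lq..} \<ge> 1 - \<alpha>"
  using prob_lessThan_le[of lq] C_less_iff_less_lq by (auto simp: prob_atLeast less_imp_le)

lemma prob_atLeast_less_lq: "x < lq \<Longrightarrow> prob {x..} > 1 - \<alpha>"
proof -
  assume "x < lq"
  then have "prob {..x} < \<alpha>" using C_less_iff_less_lq[of x] by (simp add: cdf_def)
  moreover have "prob {..<x} \<le> prob {..x}" by (intro finite_measure_mono) auto
  ultimately show ?thesis by (simp add: prob_atLeast)
qed

lemma prob_greaterThan_rq: "prob {rq<..} \<le> 1 - \<alpha>"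
  using le_C_iff_lq_le[of rq] lq_le_rq by (simp add: prob_greaterThan)

lemma prob_greaterThan_rq_less: "rq < x \<Longrightarrow> prob {x<..} < 1 - \<alpha>"
  using less_C_of_rq_less by (simp add: prob_greaterThan)

text \<open>\<open>C lq\<close> is at least \<open>\<alpha>\<close> while
  \<open>prob {..<rq}\<close> is at most \<open>\<alpha>\<close>, which leaves no mass for the open
  interval. Atoms at the two endpoints remain possible.\<close>

lemma AE_not_between_quantiles: "AE z in M. \<not> (lq < z \<and> z < rq)"
proof -
  have "prob {lq<..<rq} = 0"
  proof (cases "lq < rq")
    case True
    have "prob {..<rq} = prob ({..lq} \<union> {lq<..<rq})"
      using True by (intro arg_cong[of _ _ prob]) auto
    also have "\<dots> = C lq + prob {lq<..<rq}"
      by (subst finite_measure_Union) (auto simp: cdf_def)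
    finally have "C lq + prob {lq<..<rq} = prob {..<rq}" by simp
    moreover have "prob {..<rq} \<le> \<alpha>" by (rule prob_lessThan_le[OF C_le_of_less_rq])
    moreover have "\<alpha> \<le> C lq" using le_C_iff_lq_le by simp
    ultimately show ?thesis using measure_nonneg[of M "{lq<..<rq}"] by linarith
  qed auto
  then show ?thesis
    by (intro AE_I[where N="{lq<..<rq}"]) (auto simp: emeasure_eq_measure)
qed

definition RU :: "real \<Rightarrow> real" where
  "RU t = t + 1 / (1 - \<alpha>) * (\<integral>z. max (z - t) 0 \<partial>M)"

lemma integral_C_transform:
  fixes f :: "real \<Rightarrow> real"
  assumes [measurable]: "f \<in> borel_measurable borel"
  shows "integral\<^sup>L M f = (\<integral>u. f (I u) \<partial>restrict_space lborel {0<..<1})"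
    and "integrable M f \<longleftrightarrow> integrable (restrict_space lborel {0<..<1}) (\<lambda>u. f (I u))"
proof -
  have *: "I \<in> measurable (restrict_space lborel {0<..<1}) borel"
    using measurable_CI by (simp add: measurable_def space_restrict_space sets_restrict_space)
  show "integral\<^sup>L M f = (\<integral>u. f (I u) \<partial>restrict_space lborel {0<..<1})"
    by (subst distr_I_eq_M[symmetric], subst integral_distr[OF *]) auto
  show "integrable M f \<longleftrightarrow> integrable (restrict_space lborel {0<..<1}) (\<lambda>u. f (I u))"
    by (subst distr_I_eq_M[symmetric], subst integrable_distr_eq[OF *]) auto
qed

lemma AVaR_eq_integral:
  "AVaR \<alpha> C = 1 / (1 - \<alpha>) * (\<integral>u. indicator {\<alpha><..} u * I u \<partial>restrict_space lborel {0<..<1})"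
proof -
  have "(LBINT t=\<alpha>..1. left_quantile C t) = (LBINT t:{\<alpha><..<1}. I t)"
    using \<alpha> by (simp add: interval_lebesgue_integral_def left_quantile_def one_ereal_def)
  also have "\<dots> = (\<integral>u. indicator {\<alpha><..} u * I u \<partial>restrict_space lborel {0<..<1})"
    using \<alpha> by (subst integral_restrict_space)
      (auto simp: set_lebesgue_integral_def indicator_def intro!: Bochner_Integration.integral_cong)
  finally show ?thesis by (simp add: AVaR_def)
qed

context
  assumes int: "integrable M (\<lambda>z. z)"
begin

text \<open>With \<open>x = I u - t\<close> the integrand is \<open>max x 0\<close> or
  \<open>max x 0 - x\<close>, nonnegative in either case. The terms in \<open>t\<close> cancel
  because \<open>{\<alpha><..}\<close> has mass \<open>1 - \<alpha>\<close>. One identity thus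
  yields both the lower bound and the case of equality.\<close>

lemma RU_eq_integral:
  "RU t = AVaR \<alpha> C + 1 / (1 - \<alpha>) *
     (\<integral>u. max (I u - t) 0 - indicator {\<alpha><..} u * (I u - t) \<partial>restrict_space lborel {0<..<1})"
  "integrable (restrict_space lborel {0<..<1}) (\<lambda>u. max (I u - t) 0 - indicator {\<alpha><..} u * (I u - t))"
proof -
  let ?\<Omega> = "restrict_space lborel {0<..<1::real}"
  interpret \<Omega>: prob_space ?\<Omega>
    by (auto simp add: emeasure_restrict_space space_restrict_space intro!: prob_spaceI)
  have [measurable]: "(indicator {\<alpha><..} :: real \<Rightarrow> real) \<in> borel_measurable ?\<Omega>"
    by (rule measurable_restrict_space1) simp
  have I: "integrable ?\<Omega> I" using iffD1[OF integral_C_transform(2)[of "\<lambda>z. z"] int] by simp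
  have "integrable M (\<lambda>z. max (z - t) 0)" using int by auto
  then have 1: "integrable ?\<Omega> (\<lambda>u. max (I u - t) 0)" by (rule iffD1[OF integral_C_transform(2), rotated]) simp
  have 2: "integrable ?\<Omega> (\<lambda>u. indicator {\<alpha><..} u * I u)"
  proof (rule Bochner_Integration.integrable_bound[OF I])
    show "(\<lambda>u. indicator {\<alpha><..} u * I u) \<in> borel_measurable ?\<Omega>"
      using borel_measurable_integrable[OF I] by measurable
  qed (auto simp: indicator_def)
  have 3: "integrable ?\<Omega> (\<lambda>u. indicator {\<alpha><..} u :: real)"
    by (rule \<Omega>.integrable_const_bound[of _ 1]) (auto simp del: indicator_simps simp: indicator_le_1)
  have ind: "(\<integral>u. indicator {\<alpha><..} u \<partial>?\<Omega>) = 1 - \<alpha>"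
  proof -
    have "indicator {0<..<1} u *\<^sub>R indicator {\<alpha><..} u = (indicator {\<alpha><..<1} u :: real)" for u
      using \<alpha> by (auto simp: indicator_def)
    then show ?thesis using \<alpha> by (subst integral_restrict_space) auto
  qed
  show "integrable ?\<Omega> (\<lambda>u. max (I u - t) 0 - indicator {\<alpha><..} u * (I u - t))"
    using 1 2 3 by (auto simp: right_diff_distrib)
  define D J m where "D = (\<integral>u. max (I u - t) 0 - indicator {\<alpha><..} u * (I u - t) \<partial>?\<Omega>)"
    and "J = (\<integral>u. indicator {\<alpha><..} u * I u \<partial>?\<Omega>)" and "m = (\<integral>z. max (z - t) 0 \<partial>M)"
  have "D = m - (J - (1 - \<alpha>) * t)"
    using 1 2 3 ind integral_C_transform(1)[of "\<lambda>z. max (z - t) 0"]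
    by (simp add: D_def J_def m_def right_diff_distrib)
  then have "1 / (1 - \<alpha>) * J + 1 / (1 - \<alpha>) * D = 1 / (1 - \<alpha>) * (m + (1 - \<alpha>) * t)"
    by (simp only: distrib_left[symmetric]) simp
  also have "\<dots> = t + 1 / (1 - \<alpha>) * m"
    using \<alpha> by (simp add: add_divide_distrib)
  finally show "RU t = AVaR \<alpha> C + 1 / (1 - \<alpha>) *
     (\<integral>u. max (I u - t) 0 - indicator {\<alpha><..} u * (I u - t) \<partial>restrict_space lborel {0<..<1})"
    unfolding RU_def AVaR_eq_integral D_def J_def m_def by simp
qed

lemma AVaR_le_RU: "AVaR \<alpha> C \<le> RU t"
  using \<alpha> unfolding RU_eq_integral(1)
  by (auto intro!: Bochner_Integration.integral_nonneg simp: indicator_def)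

text \<open>The integrand of \<open>RU_eq_integral\<close> vanishes pointwise:
  \<open>\<alpha> < u\<close> forces \<open>I u \<ge> rq \<ge> t\<close>, and
  \<open>u \<le> \<alpha>\<close> forces \<open>I u \<le> lq \<le> t\<close>.\<close>

lemma AVaR_eq_RU:
  assumes t: "t \<in> quantiles C \<alpha>"
  shows "AVaR \<alpha> C = RU t"
proof -
  have "max (I u - t) 0 - indicator {\<alpha><..} u * (I u - t) = 0" if u: "u \<in> {0<..<1}" for u
  proof (cases "\<alpha> < u")
    case True
    have "t \<le> I u"
    proof (rule ccontr)
      assume "\<not> t \<le> I u"
      then have "I u < rq" using t by (auto simp: quantiles_eq)
      then have "C (I u) \<le> \<alpha>" by (rule C_le_of_less_rq)
      moreover have "u \<le> C (I u)" using pseudoinverse[of u "I u"] u by auto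
      ultimately show False using True by simp
    qed
    then show ?thesis using True by simp
  next
    case False
    have "I u \<le> I \<alpha>" using u False \<alpha> by (intro mono_onD[OF mono_I]) auto
    also have "\<dots> \<le> t" using t by (auto simp: quantiles_eq left_quantile_def)
    finally show ?thesis using False by simp
  qed
  then have "(\<integral>u. max (I u - t) 0 - indicator {\<alpha><..} u * (I u - t) \<partial>restrict_space lborel {0<..<1}) = 0"
    by (intro integral_eq_zero_AE AE_I2) (simp add: space_restrict_space)
  then show ?thesis unfolding RU_eq_integral(1) by simp
qed

lemma RU_less_lq:
  assumes e: "e > 0"
  shows "RU lq < RU (lq - e)"
proof -
  \<comment> \<open>At \<open>lq\<close> only the weak inequality
    \<open>prob {lq..} \<ge> 1 - \<alpha>\<close> is available; the strict one needs a point below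
    \<open>lq\<close>. The midpoint of the step provides it, and each of the two closed half-lines
    accounts for an increment \<open>e/2\<close> of the positive part.\<close>
  let ?c = "lq - e/2"
  have i: "integrable M (\<lambda>z. max (z - t) 0)" for t using int by auto
  have j: "integrable M (\<lambda>z. e/2 * indicator {lq..} z + e/2 * indicator {?c..} z)"
    by (intro Bochner_Integration.integrable_add integrable_mult_right integrable_real_indicator)
      (auto simp: emeasure_eq_measure)
  have "e/2 * (1 - \<alpha>) + e/2 * (1 - \<alpha>) < e/2 * prob {lq..} + e/2 * prob {?c..}"
    using prob_atLeast_less_lq[of ?c] prob_atLeast_lq e by (intro add_le_less_mono) auto
  also have "\<dots> = (\<integral>z. e/2 * indicator {lq..} z + e/2 * indicator {?c..} z \<partial>M)"
    by (subst Bochner_Integration.integral_add) (auto simp: emeasure_eq_measure)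
  also have "\<dots> \<le> (\<integral>z. max (z - (lq - e)) 0 - max (z - lq) 0 \<partial>M)"
    by (intro integral_mono Bochner_Integration.integrable_diff i j) (use e in \<open>auto simp: indicator_def\<close>)
  also have "\<dots> = (\<integral>z. max (z - (lq - e)) 0 \<partial>M) - (\<integral>z. max (z - lq) 0 \<partial>M)"
    using i by (intro Bochner_Integration.integral_diff) auto
  finally have "e * (1 - \<alpha>) < (\<integral>z. max (z - (lq - e)) 0 \<partial>M) - (\<integral>z. max (z - lq) 0 \<partial>M)"
    by (simp add: algebra_simps)
  then have "e < ((\<integral>z. max (z - (lq - e)) 0 \<partial>M) - (\<integral>z. max (z - lq) 0 \<partial>M)) / (1 - \<alpha>)"
    using \<alpha> by (subst pos_less_divide_eq) auto
  then show ?thesis unfolding RU_def by (simp add: diff_divide_distrib)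
qed

lemma RU_greater_rq:
  assumes e: "e > 0"
  shows "RU rq < RU (rq + e)"
proof -
  \<comment> \<open>Mirror image of the argument at \<open>lq\<close>, now an upper bound with open
    half-lines, since the right derivative at a point ignores an atom there.\<close>
  let ?c = "rq + e/2"
  have i: "integrable M (\<lambda>z. max (z - t) 0)" for t using int by auto
  have j: "integrable M (\<lambda>z. e/2 * indicator {rq<..} z + e/2 * indicator {?c<..} z)"
    by (intro Bochner_Integration.integrable_add integrable_mult_right integrable_real_indicator)
      (auto simp: emeasure_eq_measure)
  have "(\<integral>z. max (z - rq) 0 \<partial>M) - (\<integral>z. max (z - (rq + e)) 0 \<partial>M) = (\<integral>z. max (z - rq) 0 - max (z - (rq + e)) 0 \<partial>M)"
    using i by (intro Bochner_Integration.integral_diff[symmetric]) auto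
  also have "\<dots> \<le> (\<integral>z. e/2 * indicator {rq<..} z + e/2 * indicator {?c<..} z \<partial>M)"
    by (intro integral_mono Bochner_Integration.integrable_diff i j) (use e in \<open>auto simp: indicator_def\<close>)
  also have "\<dots> = e/2 * prob {rq<..} + e/2 * prob {?c<..}"
    by (subst Bochner_Integration.integral_add) (auto simp: emeasure_eq_measure)
  also have "\<dots> < e/2 * (1 - \<alpha>) + e/2 * (1 - \<alpha>)"
    using prob_greaterThan_rq_less[of ?c] prob_greaterThan_rq e by (intro add_le_less_mono) auto
  finally have "(\<integral>z. max (z - rq) 0 \<partial>M) - (\<integral>z. max (z - (rq + e)) 0 \<partial>M) < e * (1 - \<alpha>)"
    by (simp add: algebra_simps)
  then have "((\<integral>z. max (z - rq) 0 \<partial>M) - (\<integral>z. max (z - (rq + e)) 0 \<partial>M)) / (1 - \<alpha>) < e"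
    using \<alpha> by (subst pos_divide_less_eq) auto
  then show ?thesis unfolding RU_def by (simp add: diff_divide_distrib)
qed

end

end

section \<open>The empirical distribution\<close>

definition sample_RU :: "real \<Rightarrow> (nat \<Rightarrow> real) \<Rightarrow> nat \<Rightarrow> real \<Rightarrow> real" where
  "sample_RU \<alpha> z N t = t + 1 / (real N * (1 - \<alpha>)) * (\<Sum>j<N. max (z j - t) 0)"

text \<open>The uniform law is put on the indices, not on the sample values, so that ties keep their
  multiplicity.\<close>

definition empirical_measure :: "(nat \<Rightarrow> real) \<Rightarrow> nat \<Rightarrow> real measure" where
  "empirical_measure z N = distr (measure_pmf (pmf_of_set {..<N})) borel z"

lemma empirical_measure:
  assumes N: "N > 0"
  shows "real_distribution (empirical_measure z N)"
    and "cdf (empirical_measure z N) = empirical_cdf z N"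
    and "f \<in> borel_measurable borel \<Longrightarrow> integrable (empirical_measure z N) (f :: real \<Rightarrow> real)"
    and "f \<in> borel_measurable borel \<Longrightarrow> integral\<^sup>L (empirical_measure z N) f = (\<Sum>j<N. f (z j)) / real N"
proof -
  let ?p = "pmf_of_set {..<N}"
  have ne: "{..<N} \<noteq> {}" using N by auto
  have supp: "set_pmf ?p = {..<N}" using ne by (simp add: set_pmf_of_set)
  show rd: "real_distribution (empirical_measure z N)"
    unfolding empirical_measure_def by (rule prob_space.real_distribution_distr[OF prob_space_measure_pmf]) simp
  show i: "f \<in> borel_measurable borel \<Longrightarrow> integrable (empirical_measure z N) f" for f :: "real \<Rightarrow> real"
    unfolding empirical_measure_def
    by (subst integrable_distr_eq) (auto intro!: integrable_measure_pmf_finite simp: supp)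
  show e: "f \<in> borel_measurable borel \<Longrightarrow> integral\<^sup>L (empirical_measure z N) f = (\<Sum>j<N. f (z j)) / real N" for f :: "real \<Rightarrow> real"
    unfolding empirical_measure_def using ne
    by (subst integral_distr) (auto simp: integral_pmf_of_set)
  show "cdf (empirical_measure z N) = empirical_cdf z N"
  proof
    fix t
    interpret real_distribution "empirical_measure z N" by (rule rd)
    have "cdf (empirical_measure z N) t = (\<integral>x. indicator {..t} x \<partial>empirical_measure z N)"
      by (simp add: cdf_def emeasure_eq_measure)
    also have "\<dots> = (\<Sum>j<N. indicator {..t} (z j)) / real N" by (rule e) simp
    finally show "cdf (empirical_measure z N) t = empirical_cdf z N t"
      by (simp add: empirical_cdf_def indicator_def)
  qed
qed

lemma expect_cdf_empirical:
  assumes N: "N > 0"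
  shows "expect_cdf (empirical_cdf z N) (\<lambda>z. z) = (\<Sum>j<N. z j) / real N"
proof -
  have "interval_measure (empirical_cdf z N) = empirical_measure z N"
    unfolding empirical_measure(2)[OF N, symmetric]
    by (rule interval_measure_cdf[OF empirical_measure(1)[OF N]])
  then show ?thesis
    unfolding expect_cdf_def by (simp add: empirical_measure(4)[OF N])
qed

text \<open>The Rockafellar-Uryasev formula for the empirical law. The infimum over all real
  \<open>t\<close> is the form that serves measurability in the sample and the comparison with
  population quantiles.\<close>

lemma AVaR_empirical:
  assumes N: "N > 0" and \<alpha>: "0 < \<alpha>" "\<alpha> < 1"
  shows "AVaR \<alpha> (empirical_cdf z N) = (INF t. sample_RU \<alpha> z N t)"
    and "AVaR \<alpha> (empirical_cdf z N) \<le> sample_RU \<alpha> z N t"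
proof -
  interpret cdf_level "empirical_measure z N" \<alpha>
    using empirical_measure(1)[OF N] \<alpha> by (simp add: cdf_level_def cdf_distribution_def cdf_level_axioms_def)
  have RU: "RU t = sample_RU \<alpha> z N t" for t
    unfolding RU_def sample_RU_def by (subst empirical_measure(4)[OF N]) auto
  have int: "integrable (empirical_measure z N) (\<lambda>z. z)" by (rule empirical_measure(3)[OF N]) auto
  note C = empirical_measure(2)[OF N, of z]
  show le: "AVaR \<alpha> (empirical_cdf z N) \<le> sample_RU \<alpha> z N t" for t
    using AVaR_le_RU[OF int, of t] by (simp add: C RU)
  have eq: "AVaR \<alpha> (empirical_cdf z N) = sample_RU \<alpha> z N lq"
    using AVaR_eq_RU[OF int, of lq] lq_le_rq by (simp add: C RU quantiles_eq)
  show "AVaR \<alpha> (empirical_cdf z N) = (INF t. sample_RU \<alpha> z N t)"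
    using eq le by (intro cInf_eq_minimum[symmetric]) auto
qed

section \<open>Sample averages\<close>

text \<open>Independence turns each cross term into a product of means, which are zero.\<close>

lemma (in prob_space) expectation_square_sum_indep:
  fixes X :: "'i \<Rightarrow> 'a \<Rightarrow> real"
  assumes "finite I" "indep_vars (\<lambda>_. borel) X I"
    and "\<And>i. i \<in> I \<Longrightarrow> integrable M (\<lambda>\<omega>. (X i \<omega>)\<^sup>2)"
    and "\<And>i. i \<in> I \<Longrightarrow> expectation (X i) = 0"
  shows "integrable M (\<lambda>\<omega>. (\<Sum>i\<in>I. X i \<omega>)\<^sup>2) \<and>
    expectation (\<lambda>\<omega>. (\<Sum>i\<in>I. X i \<omega>)\<^sup>2) = (\<Sum>i\<in>I. expectation (\<lambda>\<omega>. (X i \<omega>)\<^sup>2))"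
  using assms
proof (induction I rule: finite_induct)
  case (insert i I)
  have ind: "indep_vars (\<lambda>_. borel) X I" by (rule indep_vars_subset[OF insert.prems(1)]) auto
  have X [measurable]: "X j \<in> borel_measurable M" if "j \<in> insert i I" for j
    using insert.prems(1) that by (auto simp: indep_vars_def)
  have X_int: "integrable M (X j)" if "j \<in> insert i I" for j
    by (rule square_integrable_imp_integrable[OF X[OF that] insert.prems(2)[OF that]])
  let ?S = "\<lambda>\<omega>. \<Sum>i\<in>I. X i \<omega>"
  have IH: "integrable M (\<lambda>\<omega>. (?S \<omega>)\<^sup>2)"
    "expectation (\<lambda>\<omega>. (?S \<omega>)\<^sup>2) = (\<Sum>i\<in>I. expectation (\<lambda>\<omega>. (X i \<omega>)\<^sup>2))"
    using insert.IH[OF ind] insert.prems by auto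
  have S: "integrable M ?S" "expectation ?S = 0"
    using X_int insert.prems(3) by (auto simp: Bochner_Integration.integral_sum)
  have iv: "indep_var borel (X i) borel ?S"
    by (rule indep_vars_sum[OF insert.hyps insert.prems(1)])
  have cross: "integrable M (\<lambda>\<omega>. X i \<omega> * ?S \<omega>)" "expectation (\<lambda>\<omega>. X i \<omega> * ?S \<omega>) = 0"
    using indep_var_integrable[OF iv X_int S(1)] indep_var_lebesgue_integral[OF iv X_int S(1)] S(2) by auto
  have "(\<lambda>\<omega>. (\<Sum>j\<in>insert i I. X j \<omega>)\<^sup>2) = (\<lambda>\<omega>. (X i \<omega>)\<^sup>2 + (?S \<omega>)\<^sup>2 + 2 * (X i \<omega> * ?S \<omega>))"
    using insert.hyps by (auto simp: power2_sum)
  then show ?case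
    using IH cross insert.prems(2)[of i] insert.hyps by simp
qed simp

section \<open>Square-integrable functions\<close>

definition square_integrable :: "'a measure \<Rightarrow> ('a \<Rightarrow> real) \<Rightarrow> bool" where
  "square_integrable \<mu> f \<longleftrightarrow> f \<in> borel_measurable \<mu> \<and> integrable \<mu> (\<lambda>z. (f z)\<^sup>2)"

context prob_space
begin

lemma square_integrable_integrable: "square_integrable M f \<Longrightarrow> integrable M f"
  by (auto simp: square_integrable_def intro: square_integrable_imp_integrable)

lemma square_integrable_times:
  assumes "square_integrable M f" "square_integrable M g"
  shows "integrable M (\<lambda>z. f z * g z)"
proof (rule Bochner_Integration.integrable_bound)
  show "integrable M (\<lambda>z. (f z)\<^sup>2 + (g z)\<^sup>2)"
    using assms by (auto simp: square_integrable_def)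
  have "\<bar>x * y\<bar> \<le> x\<^sup>2 + y\<^sup>2" for x y :: real
  proof -
    have "2 * (\<bar>x\<bar> * \<bar>y\<bar>) \<le> x\<^sup>2 + y\<^sup>2" using sum_squares_bound[of "\<bar>x\<bar>" "\<bar>y\<bar>"] by (simp add: mult.assoc)
    moreover have "0 \<le> \<bar>x\<bar> * \<bar>y\<bar>" by simp
    ultimately show ?thesis unfolding abs_mult by linarith
  qed
  then show "AE z in M. norm (f z * g z) \<le> norm ((f z)\<^sup>2 + (g z)\<^sup>2)"
    by (auto simp: abs_mult)
qed (use assms in \<open>auto simp: square_integrable_def\<close>)

lemma square_integrable_const: "square_integrable M (\<lambda>z. c)"
  by (simp add: square_integrable_def)

lemma square_integrable_cmult: "square_integrable M f \<Longrightarrow> square_integrable M (\<lambda>z. c * f z)"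
  by (auto simp: square_integrable_def power_mult_distrib)

lemma square_integrable_add:
  assumes "square_integrable M f" "square_integrable M g"
  shows "square_integrable M (\<lambda>z. f z + g z)"
  using assms square_integrable_times[OF assms]
  by (auto simp: square_integrable_def power2_sum mult.assoc)

lemma square_integrable_diff:
  assumes "square_integrable M f" "square_integrable M g"
  shows "square_integrable M (\<lambda>z. f z - g z)"
  using square_integrable_add[OF assms(1) square_integrable_cmult[OF assms(2), of "-1"]] by simp

lemma square_integrable_sum:
  "(\<And>i. i \<in> A \<Longrightarrow> square_integrable M (f i)) \<Longrightarrow> square_integrable M (\<lambda>z. \<Sum>i\<in>A. f i z)"
proof (induction A rule: infinite_finite_induct)
  case (insert i A)
  then have "square_integrable M (\<lambda>z. f i z + (\<Sum>i\<in>A. f i z))"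
    by (intro square_integrable_add) auto
  then show ?case using insert by simp
qed (simp_all add: square_integrable_const)

lemma square_integrable_bound:
  assumes "square_integrable M g" "f \<in> borel_measurable M" "\<And>z. \<bar>f z\<bar> \<le> \<bar>g z\<bar>"
  shows "square_integrable M f"
  unfolding square_integrable_def
proof
  show "integrable M (\<lambda>z. (f z)\<^sup>2)"
  proof (rule Bochner_Integration.integrable_bound)
    show "integrable M (\<lambda>z. (g z)\<^sup>2)" using assms(1) by (simp add: square_integrable_def)
    show "AE z in M. norm ((f z)\<^sup>2) \<le> norm ((g z)\<^sup>2)"
      using assms(3) by (intro AE_I2) (simp add: abs_le_square_iff[symmetric])
  qed (use assms(2) in measurable)
qed fact

end

section \<open>Normal laws, including the degenerate ones\<close>

lemma normal_law_zero_scaled: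
  assumes "v > 0"
  shows "distr std_normal_distribution borel (\<lambda>x. sqrt v * x) = normal_law 0 v"
proof -
  interpret prob_space std_normal_distribution
    using real_dist_normal_dist by (simp add: real_distribution_def)
  have "distributed std_normal_distribution lborel (\<lambda>x. x) std_normal_density"
    unfolding distributed_def by (auto simp: distr_id2)
  from normal_density_affine[OF this, of "sqrt v" 0] assms
  have "distributed std_normal_distribution lborel (\<lambda>x. sqrt v * x) (normal_density 0 (sqrt v))"
    by simp
  then have "distr std_normal_distribution lborel (\<lambda>x. sqrt v * x) = density lborel (normal_density 0 (sqrt v))"
    by (simp add: distributed_def)
  moreover have "distr std_normal_distribution lborel (\<lambda>x. sqrt v * x) = distr std_normal_distribution borel (\<lambda>x. sqrt v * x)"
    by (rule distr_cong) auto
  ultimately show ?thesis using assms by (simp add: normal_law_def)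
qed

lemma real_distribution_normal_law:
  assumes "v \<ge> 0"
  shows "real_distribution (normal_law m v)"
proof (cases "v = 0")
  case True
  then show ?thesis
    by (auto simp: normal_law_def real_distribution_def real_distribution_axioms_def intro!: prob_space_return)
next
  case False
  then show ?thesis using assms
    by (auto simp: normal_law_def real_distribution_def real_distribution_axioms_def intro!: prob_space_normal_density)
qed

lemma normal_law_moments:
  assumes "v \<ge> 0"
  shows "(\<integral>x. x \<partial>normal_law m v) = m"
    and "(\<integral>x. (x - m)\<^sup>2 \<partial>normal_law m v) = v"
    and "integrable (normal_law m v) (\<lambda>x. x\<^sup>2)"
proof -
  have "(\<integral>x. x \<partial>normal_law m v) = m \<and> (\<integral>x. (x - m)\<^sup>2 \<partial>normal_law m v) = v \<and> integrable (normal_law m v) (\<lambda>x. (x - m)\<^sup>2)"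
  proof (cases "v = 0")
    case True
    have "integrable (return borel m) (\<lambda>x. (x - m)\<^sup>2)"
      by (rule integrableI_bounded) (auto simp: nn_integral_return)
    with True show ?thesis by (simp add: normal_law_def integral_return)
  next
    case False
    then have v: "sqrt v > 0" using assms by simp
    show ?thesis
      using False v assms integral_normal_moment_even[OF v, of m 1] integral_normal_moment_nz_1[OF v, of m]
        integrable_normal_moment[OF v, of m 2]
      by (auto simp: normal_law_def integral_density integrable_density eval_nat_numeral)
  qed
  moreover interpret real_distribution "normal_law m v" by (rule real_distribution_normal_law[OF assms])
  have "square_integrable (normal_law m v) (\<lambda>x. (x - m) + m)" if "integrable (normal_law m v) (\<lambda>x. (x - m)\<^sup>2)"
    using that by (intro square_integrable_add square_integrable_const) (auto simp: square_integrable_def)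
  ultimately show "(\<integral>x. x \<partial>normal_law m v) = m" "(\<integral>x. (x - m)\<^sup>2 \<partial>normal_law m v) = v"
    "integrable (normal_law m v) (\<lambda>x. x\<^sup>2)" by (auto simp: square_integrable_def)
qed

lemma weak_conv_m_cong_eventually:
  assumes "weak_conv_m \<mu> \<nu>" "\<forall>\<^sub>F n in sequentially. \<mu> n = \<mu>' n"
  shows "weak_conv_m \<mu>' \<nu>"
  unfolding weak_conv_m_def weak_conv_def
proof safe
  fix x assume "isCont (cdf \<nu>) x"
  then have "(\<lambda>n. cdf (\<mu> n) x) \<longlonglongrightarrow> cdf \<nu> x" using assms(1) by (auto simp: weak_conv_m_def weak_conv_def)
  then show "(\<lambda>n. cdf (\<mu>' n) x) \<longlonglongrightarrow> cdf \<nu> x"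
    by (rule Lim_transform_eventually) (use assms(2) in \<open>auto elim: eventually_mono\<close>)
qed

lemma weak_conv_m_const: "weak_conv_m (\<lambda>n. \<nu>) \<nu>"
  by (simp add: weak_conv_m_def weak_conv_def)

lemma weak_conv_m_distr_continuous:
  fixes h :: "real \<Rightarrow> real"
  assumes \<mu>: "\<And>n. real_distribution (\<mu> n)" and \<nu>: "real_distribution \<nu>"
    and conv: "weak_conv_m \<mu> \<nu>" and h: "continuous_on UNIV h"
  shows "weak_conv_m (\<lambda>n. distr (\<mu> n) borel h) (distr \<nu> borel h)"
proof -
  interpret \<mu>: real_distribution "\<mu> n" for n by fact
  interpret \<nu>: real_distribution \<nu> by fact
  have [measurable]: "h \<in> borel_measurable borel"
    using h by (rule borel_measurable_continuous_onI)
  show ?thesis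
  proof (rule integral_bdd_continuous_conv_imp_weak_conv)
    show "real_distribution (distr (\<mu> n) borel h)" for n by (rule \<mu>.real_distribution_distr) simp
    show "real_distribution (distr \<nu> borel h)" by (rule \<nu>.real_distribution_distr) simp
    fix f :: "real \<Rightarrow> real" assume f: "\<And>x. isCont f x" "\<And>x. \<bar>f x\<bar> \<le> 1"
    then have [measurable]: "f \<in> borel_measurable borel"
      by (intro borel_measurable_continuous_onI) (simp add: continuous_on_eq_continuous_at)
    have "(\<lambda>n. integral\<^sup>L (\<mu> n) (\<lambda>x. f (h x))) \<longlonglongrightarrow> integral\<^sup>L \<nu> (\<lambda>x. f (h x))"
      using f h by (intro weak_conv_imp_integral_bdd_continuous_conv[OF \<mu> \<nu> conv, of _ 1])
        (auto simp: continuous_on_eq_continuous_at intro: continuous_at_compose[unfolded o_def])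
    then show "(\<lambda>n. integral\<^sup>L (distr (\<mu> n) borel h) f) \<longlonglongrightarrow> integral\<^sup>L (distr \<nu> borel h) f"
      by (simp add: integral_distr)
  qed
qed

section \<open>Centered means of an i.i.d. sample: Chebyshev's inequality and the central limit
  theorem\<close>

definition var :: "'a measure \<Rightarrow> ('a \<Rightarrow> real) \<Rightarrow> real" where
  "var \<mu> f = (\<integral>z. (f z - integral\<^sup>L \<mu> f)\<^sup>2 \<partial>\<mu>)"

lemma var_nonneg: "var \<mu> f \<ge> 0"
  unfolding var_def by (intro Bochner_Integration.integral_nonneg) auto

locale iid_sample = prob_space M for M :: "'a measure" +
  fixes Z :: "nat \<Rightarrow> 'a \<Rightarrow> real" and \<mu> :: "real measure"
  assumes indep: "indep_vars (\<lambda>_. borel) Z UNIV"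
    and law: "\<And>j. distr M borel (Z j) = \<mu>"
begin

lemma Z_measurable [measurable]: "Z j \<in> borel_measurable M"
  using indep by (auto simp: indep_vars_def)

sublocale \<mu>: real_distribution \<mu>
  unfolding law[of 0, symmetric] by (rule real_distribution_distr) simp

lemma square_integrable_borel: "square_integrable \<mu> f \<Longrightarrow> f \<in> borel_measurable borel"
  by (simp add: square_integrable_def measurable_cong_sets[OF \<mu>.events_eq_borel refl])

text \<open>The empirical process at \<open>f\<close>. It is linear in \<open>f\<close> on
  integrable functions, which later reduces a whole family of functions to finitely many. At
  \<open>N = 0\<close> the factor \<open>sqrt 0\<close> makes it zero.\<close>

definition centered_mean :: "nat \<Rightarrow> (real \<Rightarrow> real) \<Rightarrow> 'a \<Rightarrow> real" where
  "centered_mean N f \<omega> = sqrt (real N) * ((\<Sum>j<N. f (Z j \<omega>)) / real N - integral\<^sup>L \<mu> f)"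

lemma centered_mean_measurable [measurable]:
  "f \<in> borel_measurable borel \<Longrightarrow> centered_mean N f \<in> borel_measurable M"
  unfolding centered_mean_def[abs_def]
  by (intro borel_measurable_times borel_measurable_diff borel_measurable_divide borel_measurable_sum
      borel_measurable_const measurable_compose[OF Z_measurable])

lemma centered_mean_eq:
  "N > 0 \<Longrightarrow> centered_mean N f \<omega> = (\<Sum>j<N. f (Z j \<omega>) - integral\<^sup>L \<mu> f) / sqrt (real N)"
  by (simp add: centered_mean_def sum_subtractf field_simps)

lemma centered_mean_add:
  "integrable \<mu> f \<Longrightarrow> integrable \<mu> g \<Longrightarrow>
    centered_mean N (\<lambda>z. f z + g z) \<omega> = centered_mean N f \<omega> + centered_mean N g \<omega>"
  by (simp add: centered_mean_def sum.distrib add_divide_distrib algebra_simps)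

lemma centered_mean_cmult:
  "centered_mean N (\<lambda>z. c * f z) \<omega> = c * centered_mean N f \<omega>"
  by (simp add: centered_mean_def sum_distrib_left[symmetric] algebra_simps)

lemma centered_mean_sum:
  "(\<And>i. i \<in> A \<Longrightarrow> integrable \<mu> (f i)) \<Longrightarrow>
    centered_mean N (\<lambda>z. \<Sum>i\<in>A. f i z) \<omega> = (\<Sum>i\<in>A. centered_mean N (f i) \<omega>)"
  by (induction A rule: infinite_finite_induct)
    (auto simp: centered_mean_add, auto simp: centered_mean_def)

lemma
  assumes f: "square_integrable \<mu> f"
  shows indep_centered: "indep_vars (\<lambda>_. borel) (\<lambda>j \<omega>. f (Z j \<omega>) - integral\<^sup>L \<mu> f) UNIV"
    and expectation_centered: "expectation (\<lambda>\<omega>. f (Z j \<omega>) - integral\<^sup>L \<mu> f) = 0"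
    and expectation_centered_square: "expectation (\<lambda>\<omega>. (f (Z j \<omega>) - integral\<^sup>L \<mu> f)\<^sup>2) = var \<mu> f"
    and integrable_centered_square: "integrable M (\<lambda>\<omega>. (f (Z j \<omega>) - integral\<^sup>L \<mu> f)\<^sup>2)"
proof -
  have [measurable]: "f \<in> borel_measurable borel" using f by (rule square_integrable_borel)
  show "indep_vars (\<lambda>_. borel) (\<lambda>j \<omega>. f (Z j \<omega>) - integral\<^sup>L \<mu> f) UNIV"
    by (rule indep_vars_compose2[OF indep, where Y="\<lambda>_ z. f z - integral\<^sup>L \<mu> f"]) simp
  have "integral\<^sup>L \<mu> (\<lambda>z. f z - integral\<^sup>L \<mu> f) = 0"
    using \<mu>.square_integrable_integrable[OF f] by (simp add: \<mu>.prob_space[unfolded \<mu>.space_eq_univ])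
  then show "expectation (\<lambda>\<omega>. f (Z j \<omega>) - integral\<^sup>L \<mu> f) = 0"
    unfolding law[of j, symmetric] by (simp add: integral_distr)
  show "expectation (\<lambda>\<omega>. (f (Z j \<omega>) - integral\<^sup>L \<mu> f)\<^sup>2) = var \<mu> f"
    unfolding law[of j, symmetric] var_def by (simp add: integral_distr)
  have "square_integrable \<mu> (\<lambda>z. f z - integral\<^sup>L \<mu> f)"
    by (intro \<mu>.square_integrable_diff f \<mu>.square_integrable_const)
  then show "integrable M (\<lambda>\<omega>. (f (Z j \<omega>) - integral\<^sup>L \<mu> f)\<^sup>2)"
    unfolding law[of j, symmetric] by (simp add: square_integrable_def integrable_distr_eq)
qed

text \<open>For positive \<open>N\<close> the summands are orthogonal and the second moment equals
  the variance; the inequality also covers \<open>N = 0\<close>, where the left side is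
  zero.\<close>

lemma
  assumes f: "square_integrable \<mu> f"
  shows centered_mean_second_moment_le: "expectation (\<lambda>\<omega>. (centered_mean N f \<omega>)\<^sup>2) \<le> var \<mu> f"
    and integrable_centered_mean_square: "integrable M (\<lambda>\<omega>. (centered_mean N f \<omega>)\<^sup>2)"
proof -
  have "integrable M (\<lambda>\<omega>. (centered_mean N f \<omega>)\<^sup>2) \<and> expectation (\<lambda>\<omega>. (centered_mean N f \<omega>)\<^sup>2) \<le> var \<mu> f"
  proof (cases "N = 0")
    case True
    then show ?thesis using var_nonneg[of \<mu> f] by (simp add: centered_mean_def)
  next
    case False
    let ?Y = "\<lambda>j \<omega>. f (Z j \<omega>) - integral\<^sup>L \<mu> f"
    have *: "integrable M (\<lambda>\<omega>. (\<Sum>i<N. ?Y i \<omega>)\<^sup>2) \<and>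
      expectation (\<lambda>\<omega>. (\<Sum>i<N. ?Y i \<omega>)\<^sup>2) = (\<Sum>i<N. expectation (\<lambda>\<omega>. (?Y i \<omega>)\<^sup>2))"
      by (rule expectation_square_sum_indep[OF _ indep_vars_subset[OF indep_centered[OF f]]])
        (auto simp: integrable_centered_square[OF f] expectation_centered[OF f] simp del: Bochner_Integration.integral_diff)
    then show ?thesis
      using False by (simp add: centered_mean_eq power_divide expectation_centered_square[OF f])
  qed
  then show "expectation (\<lambda>\<omega>. (centered_mean N f \<omega>)\<^sup>2) \<le> var \<mu> f" "integrable M (\<lambda>\<omega>. (centered_mean N f \<omega>)\<^sup>2)"
    by auto
qed

lemma prob_centered_mean_ge:
  assumes f: "square_integrable \<mu> f" and c: "c > 0"
  shows "prob {\<omega> \<in> space M. \<bar>centered_mean N f \<omega>\<bar> \<ge> c} \<le> var \<mu> f / c\<^sup>2"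
proof -
  have [measurable]: "f \<in> borel_measurable borel" using f by (rule square_integrable_borel)
  have "prob {\<omega> \<in> space M. \<bar>centered_mean N f \<omega>\<bar> \<ge> c} = prob {\<omega> \<in> space M. (centered_mean N f \<omega>)\<^sup>2 \<ge> c\<^sup>2}"
    using c abs_le_square_iff[of c "centered_mean N f _"] by simp
  also have "\<dots> \<le> expectation (\<lambda>\<omega>. (centered_mean N f \<omega>)\<^sup>2) / c\<^sup>2"
    using c by (intro integral_Markov_inequality_measure[where A="{}"] integrable_centered_mean_square f) auto
  also have "\<dots> \<le> var \<mu> f / c\<^sup>2"
    using centered_mean_second_moment_le[OF f] by (intro divide_right_mono) auto
  finally show ?thesis .
qed

text \<open>With zero variance the second moment vanishes, so every term is almost surely 0 and the
  limit is the point mass that \<open>normal_law\<close> assigns to variance 0. Otherwise the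
  standardized limit theorem is rescaled.\<close>

theorem centered_mean_clt:
  assumes f: "square_integrable \<mu> f"
  shows "weak_conv_m (\<lambda>N. distr M borel (centered_mean N f)) (normal_law 0 (var \<mu> f))"
proof (cases "var \<mu> f = 0")
  case True
  have [measurable]: "f \<in> borel_measurable borel" using f by (rule square_integrable_borel)
  have "AE \<omega> in M. centered_mean N f \<omega> = 0" for N
  proof -
    have "expectation (\<lambda>\<omega>. (centered_mean N f \<omega>)\<^sup>2) = 0"
      using centered_mean_second_moment_le[OF f, of N] True
      by (intro antisym Bochner_Integration.integral_nonneg) auto
    then show ?thesis
      using integral_nonneg_eq_0_iff_AE[OF integrable_centered_mean_square[OF f, of N]] by auto
  qed
  then have "distr M borel (centered_mean N f) = distr M borel (\<lambda>\<omega>. 0)" for N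
    by (intro distr_cong_AE) auto
  moreover have "distr M borel (\<lambda>\<omega>. 0::real) = return borel 0"
    by (rule distr_const) simp
  ultimately show ?thesis using True by (simp add: normal_law_def weak_conv_m_const)
next
  case False
  then have v: "var \<mu> f > 0" using var_nonneg[of \<mu> f] by simp
  have [measurable]: "f \<in> borel_measurable borel" using f by (rule square_integrable_borel)
  let ?Y = "\<lambda>j \<omega>. f (Z j \<omega>) - integral\<^sup>L \<mu> f"
  let ?\<sigma> = "sqrt (var \<mu> f)"
  let ?S = "\<lambda>n \<omega>. (\<Sum>i<n. ?Y i \<omega>) / sqrt (real n * ?\<sigma>\<^sup>2)"
  have "weak_conv_m (\<lambda>n. distr M borel (?S n)) std_normal_distribution"
  proof (rule central_limit_theorem_zero_mean[where \<mu>="distr \<mu> borel (\<lambda>z. f z - integral\<^sup>L \<mu> f)"])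
    show "distr M borel (?Y n) = distr \<mu> borel (\<lambda>z. f z - integral\<^sup>L \<mu> f)" for n
      unfolding law[of n, symmetric] by (simp add: distr_distr comp_def)
    show "variance (?Y n) = ?\<sigma>\<^sup>2" for n
      unfolding expectation_centered[OF f] using v expectation_centered_square[OF f] by simp
  qed (use v indep_centered[OF f] expectation_centered[OF f] integrable_centered_square[OF f] in auto)
  from weak_conv_m_distr_continuous[OF _ real_dist_normal_dist this, of "\<lambda>x. ?\<sigma> * x"]
  have "weak_conv_m (\<lambda>n. distr M borel (\<lambda>\<omega>. ?\<sigma> * ?S n \<omega>)) (normal_law 0 (var \<mu> f))"
    by (auto simp: distr_distr comp_def normal_law_zero_scaled[OF v] intro!: continuous_intros)
  then show ?thesis
  proof (rule weak_conv_m_cong_eventually)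
    have "(\<lambda>\<omega>. ?\<sigma> * ?S N \<omega>) = centered_mean N f" if "N > 0" for N
    proof
      fix \<omega>
      have "sqrt (real N * ?\<sigma>\<^sup>2) = sqrt (real N) * ?\<sigma>" using v by (simp add: real_sqrt_mult)
      then show "?\<sigma> * ?S N \<omega> = centered_mean N f \<omega>"
        using v by (simp only: centered_mean_eq[OF that]) simp
    qed
    then show "\<forall>\<^sub>F N in sequentially. distr M borel (\<lambda>\<omega>. ?\<sigma> * ?S N \<omega>) = distr M borel (centered_mean N f)"
      by (auto intro!: eventually_sequentiallyI[of 1])
  qed
qed

end

section \<open>Localization of the sample minimizer\<close>

text \<open>By continuity a dense subset determines the infimum; choosing it countable is what makes
  infima over uncountable sets measurable.\<close>

lemma INF_dense_eq:
  fixes f :: "'s::euclidean_space \<Rightarrow> real"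
  assumes D: "D \<subseteq> S" "S \<subseteq> closure D" and S: "S \<noteq> {}"
    and f: "continuous_on S f" and bdd: "bdd_below (f ` S)"
  shows "(INF s\<in>S. f s) = (INF s\<in>D. f s)"
proof (rule antisym)
  have D0: "D \<noteq> {}" using D S by auto
  show "(INF s\<in>S. f s) \<le> (INF s\<in>D. f s)"
    using D by (intro cINF_superset_mono D0 bdd) auto
  have bddD: "bdd_below (f ` D)" using bdd D by (meson bdd_below_mono image_mono)
  show "(INF s\<in>D. f s) \<le> (INF s\<in>S. f s)"
  proof (rule cINF_greatest[OF S])
    fix s assume s: "s \<in> S"
    then obtain x where x: "\<And>n. x n \<in> D" "x \<longlonglongrightarrow> s"
      using subsetD[OF D(2) s] unfolding closure_sequential by blast
    have "(\<lambda>n. f (x n)) \<longlonglongrightarrow> f s"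
      using x(1) D(1) by (intro continuous_on_tendsto_compose[OF f x(2) s] always_eventually) auto
    then show "(INF s\<in>D. f s) \<le> f s"
      by (rule LIMSEQ_le_const) (use x bddD in \<open>auto intro!: cINF_lower\<close>)
  qed
qed

lemma borel_measurable_INF_continuous:
  fixes f :: "'s::euclidean_space \<Rightarrow> 'a \<Rightarrow> real"
  assumes S: "S \<noteq> {}"
    and f: "\<And>\<omega>. \<omega> \<in> space M \<Longrightarrow> continuous_on S (\<lambda>s. f s \<omega>)"
    and bdd: "\<And>\<omega>. \<omega> \<in> space M \<Longrightarrow> bdd_below ((\<lambda>s. f s \<omega>) ` S)"
    and meas: "\<And>s. s \<in> S \<Longrightarrow> f s \<in> borel_measurable M"
  shows "(\<lambda>\<omega>. INF s\<in>S. f s \<omega>) \<in> borel_measurable M"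
proof -
  obtain D where D: "countable D" "D \<subseteq> S" "S \<subseteq> closure D" by (rule separable)
  have "(\<lambda>\<omega>. INF s\<in>D. f s \<omega>) \<in> borel_measurable M"
    using D meas by (intro borel_measurable_cINF_real) auto
  then show ?thesis
    by (subst measurable_cong[OF INF_dense_eq[OF D(2,3) S f bdd]])
qed

lemma borel_measurable_SUP_continuous:
  fixes f :: "'s::euclidean_space \<Rightarrow> 'a \<Rightarrow> real"
  assumes S: "S \<noteq> {}"
    and f: "\<And>\<omega>. \<omega> \<in> space M \<Longrightarrow> continuous_on S (\<lambda>s. f s \<omega>)"
    and bdd: "\<And>\<omega>. \<omega> \<in> space M \<Longrightarrow> bdd_above ((\<lambda>s. f s \<omega>) ` S)"
    and meas: "\<And>s. s \<in> S \<Longrightarrow> f s \<in> borel_measurable M"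
  shows "(\<lambda>\<omega>. SUP s\<in>S. f s \<omega>) \<in> borel_measurable M"
proof -
  have "(\<lambda>\<omega>. INF s\<in>S. - f s \<omega>) \<in> borel_measurable M"
  proof (rule borel_measurable_INF_continuous[OF S])
    fix \<omega> assume \<omega>: "\<omega> \<in> space M"
    show "continuous_on S (\<lambda>s. - f s \<omega>)" by (intro continuous_intros f \<omega>)
    obtain B where "\<And>s. s \<in> S \<Longrightarrow> f s \<omega> \<le> B" using bdd[OF \<omega>] unfolding bdd_above_def by blast
    then show "bdd_below ((\<lambda>s. - f s \<omega>) ` S)" by (intro bdd_belowI2[of _ "- B"]) simp
  qed (use meas in auto)
  then have "(\<lambda>\<omega>. - (INF s\<in>S. - f s \<omega>)) \<in> borel_measurable M" by simp
  then show ?thesis by (simp add: Inf_real_def image_image)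
qed

text \<open>Convexity of the positive part, with \<open>x + d * u\<close> as the mean of
  \<open>x\<close> and \<open>x + d * v\<close> under the weights \<open>(v - u) / v\<close> and
  \<open>u / v\<close>, multiplied through by \<open>v\<close>.\<close>

lemma pos_part_convex:
  fixes x d u v :: real
  assumes "0 \<le> u" "u \<le> v"
  shows "v * max (x + d * u) 0 \<le> (v - u) * max x 0 + u * max (x + d * v) 0"
proof -
  have 1: "(v - u) * x \<le> (v - u) * max x 0" "u * (x + d * v) \<le> u * max (x + d * v) 0"
    using assms by (auto intro!: mult_left_mono)
  have 2: "0 \<le> (v - u) * max x 0" "0 \<le> u * max (x + d * v) 0"
    using assms by auto
  have "v * (x + d * u) = (v - u) * x + u * (x + d * v)" by (simp add: algebra_simps)
  with 1 2 show ?thesis by (auto simp: max_def[of "x + d * u"])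
qed

context iid_sample
begin

lemma sample_mean_eq:
  "N > 0 \<Longrightarrow> sqrt (real N) * ((\<Sum>j<N. f (Z j \<omega>)) / real N) = centered_mean N f \<omega> + sqrt (real N) * integral\<^sup>L \<mu> f"
  by (simp add: centered_mean_def algebra_simps)

text \<open>
  Beyond a fixed small \<open>\<epsilon>\<close>, convexity and Chebyshev's inequality at the single point \<open>\<epsilon>\<close> keep the
  sample average positive; before \<open>\<epsilon>\<close>, the subgradient at 0 bounds its descent by \<open>\<epsilon>\<close> times a
  quantity of order \<open>1 / sqrt N\<close>.
\<close>

lemma convex_descent:
  fixes g :: "real \<Rightarrow> real \<Rightarrow> real" and s :: "real \<Rightarrow> real"
  assumes s: "square_integrable \<mu> s" "integral\<^sup>L \<mu> s \<ge> 0"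
    and g: "\<And>u. u > 0 \<Longrightarrow> square_integrable \<mu> (g u)" "\<And>u. u > 0 \<Longrightarrow> integral\<^sup>L \<mu> (g u) > 0"
    and subgrad: "\<And>u z. u > 0 \<Longrightarrow> u * s z \<le> g u z"
    and conv: "\<And>u v z. 0 < u \<Longrightarrow> u \<le> v \<Longrightarrow> v * g u z \<le> u * g v z"
    and \<eta>: "\<eta> > 0" and e: "e > 0"
  shows "\<forall>\<^sub>F N in sequentially. \<exists>A\<in>events. prob A \<le> e \<and>
    (\<forall>\<omega>\<in>space M - A. \<forall>u>0. sqrt (real N) * ((\<Sum>j<N. g u (Z j \<omega>)) / real N) \<ge> - \<eta>)"
proof -
  \<comment> \<open>Chosen so that the Chebyshev bound
    \<open>var \<mu> s * \<epsilon>\<^sup>2 / \<eta>\<^sup>2\<close> for the event that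
    \<open>centered_mean N s\<close> reaches \<open>\<eta> / \<epsilon>\<close> in modulus is at
    most \<open>e / 2\<close>; the added 1 covers zero variance.\<close>
  define \<epsilon> where "\<epsilon> = sqrt (e * \<eta>\<^sup>2 / (2 * (var \<mu> s + 1)))"
  have v1: "var \<mu> s + 1 > 0" using var_nonneg[of \<mu> s] by linarith
  have \<epsilon>: "\<epsilon> > 0" using e \<eta> v1 by (simp add: \<epsilon>_def)
  have "\<epsilon>\<^sup>2 = e * \<eta>\<^sup>2 / (2 * (var \<mu> s + 1))" using e \<eta> v1 by (simp add: \<epsilon>_def)
  then have "var \<mu> s / (\<eta> / \<epsilon>)\<^sup>2 = (var \<mu> s / (var \<mu> s + 1)) * (e / 2)"
    using \<eta> \<epsilon> v1 by (simp add: power_divide)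
  also have "\<dots> \<le> 1 * (e / 2)"
    using e v1 var_nonneg[of \<mu> s] by (intro mult_right_mono) auto
  finally have \<epsilon>2: "var \<mu> s / (\<eta> / \<epsilon>)\<^sup>2 \<le> e / 2" by simp
  have [measurable]: "s \<in> borel_measurable borel" "g \<epsilon> \<in> borel_measurable borel"
    using s g(1)[OF \<epsilon>] square_integrable_borel by auto
  define m where "m = integral\<^sup>L \<mu> (g \<epsilon>)"
  have m: "m > 0" using g(2)[OF \<epsilon>] by (simp add: m_def)
  define A1 where "A1 N = {\<omega> \<in> space M. \<bar>centered_mean N s \<omega>\<bar> \<ge> \<eta> / \<epsilon>}" for N
  \<comment> \<open>For positive \<open>N\<close>, the sample mean of \<open>g \<epsilon>\<close>
    stays positive off this event, whose probability is at most
    \<open>var \<mu> (g \<epsilon>) / (m\<^sup>2 * N)\<close>.\<close>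
  define A2 where "A2 N = {\<omega> \<in> space M. \<bar>centered_mean N (g \<epsilon>) \<omega>\<bar> \<ge> sqrt (real N) * m}" for N
  have A: "A1 N \<in> events" "A2 N \<in> events" for N unfolding A1_def A2_def by measurable
  have "(\<lambda>N. (var \<mu> (g \<epsilon>) / m\<^sup>2) / real N) \<longlonglongrightarrow> 0" by (rule lim_const_over_n)
  then have "\<forall>\<^sub>F N in sequentially. (var \<mu> (g \<epsilon>) / m\<^sup>2) / real N < e/2"
    using e by (intro order_tendstoD) auto
  then show ?thesis
    using eventually_gt_at_top[of 0]
  proof eventually_elim
    case (elim N)
    have "prob (A1 N) \<le> e/2"
      unfolding A1_def using \<eta> \<epsilon> by (intro order_trans[OF prob_centered_mean_ge[OF s(1)] \<epsilon>2]) auto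
    moreover have "prob (A2 N) \<le> e/2"
      using prob_centered_mean_ge[OF g(1)[OF \<epsilon>], of "sqrt (real N) * m" N] m elim
      by (simp add: A2_def power_mult_distrib mult.commute)
    moreover have "prob (A1 N \<union> A2 N) \<le> prob (A1 N) + prob (A2 N)"
      by (intro measure_Un_le A)
    ultimately have "prob (A1 N \<union> A2 N) \<le> e" by linarith
    moreover have "sqrt (real N) * ((\<Sum>j<N. g u (Z j \<omega>)) / real N) \<ge> - \<eta>"
      if \<omega>: "\<omega> \<in> space M - (A1 N \<union> A2 N)" and u: "u > 0" for \<omega> u
    proof (cases "u \<le> \<epsilon>")
      case True
      have "\<bar>centered_mean N s \<omega>\<bar> < \<eta> / \<epsilon>" using \<omega> by (auto simp: A1_def)
      then have *: "- (\<eta> / \<epsilon>) \<le> sqrt (real N) * ((\<Sum>j<N. s (Z j \<omega>)) / real N)"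
      proof -
        have "0 \<le> sqrt (real N) * integral\<^sup>L \<mu> s" using s(2) by simp
        then show ?thesis
          using \<open>\<bar>centered_mean N s \<omega>\<bar> < \<eta> / \<epsilon>\<close> unfolding sample_mean_eq[OF elim(2)] by linarith
      qed
      have "- \<eta> = - (\<epsilon> * (\<eta> / \<epsilon>))" using \<epsilon> by simp
      also have "\<dots> \<le> - (u * (\<eta> / \<epsilon>))" using True \<epsilon> \<eta> by (intro le_imp_neg_le mult_right_mono) auto
      also have "\<dots> = u * (- (\<eta> / \<epsilon>))" by simp
      also have "\<dots> \<le> u * (sqrt (real N) * ((\<Sum>j<N. s (Z j \<omega>)) / real N))"
        using * u by (intro mult_left_mono) auto
      also have "\<dots> = sqrt (real N) * ((\<Sum>j<N. u * s (Z j \<omega>)) / real N)"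
        by (simp add: sum_distrib_left[symmetric])
      also have "\<dots> \<le> sqrt (real N) * ((\<Sum>j<N. g u (Z j \<omega>)) / real N)"
        using subgrad[OF u] by (intro mult_left_mono divide_right_mono sum_mono) auto
      finally show ?thesis .
    next
      case False
      have "\<bar>centered_mean N (g \<epsilon>) \<omega>\<bar> < sqrt (real N) * m" using \<omega> by (auto simp: A2_def)
      then have *: "0 \<le> sqrt (real N) * ((\<Sum>j<N. g \<epsilon> (Z j \<omega>)) / real N)"
        using elim by (subst sample_mean_eq) (auto simp: abs_if m_def[symmetric] split: if_splits)
      have "0 \<le> u * (sqrt (real N) * ((\<Sum>j<N. g \<epsilon> (Z j \<omega>)) / real N))"
        by (rule mult_nonneg_nonneg[OF less_imp_le[OF u] *])
      also have "\<dots> = sqrt (real N) * ((\<Sum>j<N. u * g \<epsilon> (Z j \<omega>)) / real N)"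
        by (simp add: sum_distrib_left[symmetric])
      also have "\<dots> \<le> sqrt (real N) * ((\<Sum>j<N. \<epsilon> * g u (Z j \<omega>)) / real N)"
        using conv[OF \<epsilon>] False by (intro mult_left_mono divide_right_mono sum_mono) auto
      also have "\<dots> = \<epsilon> * (sqrt (real N) * ((\<Sum>j<N. g u (Z j \<omega>)) / real N))"
        by (simp add: sum_distrib_left[symmetric])
      finally have "0 \<le> sqrt (real N) * ((\<Sum>j<N. g u (Z j \<omega>)) / real N)"
        using \<epsilon> zero_le_mult_iff by (metis less_le_not_le)
      then show ?thesis using \<eta> by linarith
    qed
    ultimately show ?case using A by (intro bexI[of _ "A1 N \<union> A2 N"]) auto
  qed
qed

end

section \<open>The sample at a single AVaR level\<close>

locale iid_level = iid_sample M Z \<mu> + cdf_level \<mu> \<alpha>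
  for M :: "'a measure" and Z :: "nat \<Rightarrow> 'a \<Rightarrow> real" and \<mu> :: "real measure" and \<alpha> :: real +
  assumes square: "integrable \<mu> (\<lambda>z. z\<^sup>2)"
begin

abbreviation "sRU N \<omega> \<equiv> sample_RU \<alpha> (\<lambda>j. Z j \<omega>) N"

lemma square_integrable_id: "square_integrable \<mu> (\<lambda>z. z)"
  using square by (simp add: square_integrable_def)

lemma square_integrable_pos_part: "square_integrable \<mu> (\<lambda>z. max (z - t) 0)"
  by (rule \<mu>.square_integrable_bound[OF \<mu>.square_integrable_diff[OF square_integrable_id \<mu>.square_integrable_const[of t]]]) auto

lemma square_integrable_indicator: "A \<in> sets borel \<Longrightarrow> square_integrable \<mu> (indicator A)"
  by (rule \<mu>.square_integrable_bound[OF \<mu>.square_integrable_const[of 1]]) (auto simp: indicator_def)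

lemma integrable_id: "integrable \<mu> (\<lambda>z. z)"
  by (rule \<mu>.square_integrable_integrable[OF square_integrable_id])

lemma integrable_pos_part: "integrable \<mu> (\<lambda>z. max (z - t) 0)"
  by (rule \<mu>.square_integrable_integrable[OF square_integrable_pos_part])

lemma RU_diff_eq_integral:
  "integral\<^sup>L \<mu> (\<lambda>z. (t' - t) + 1 / (1 - \<alpha>) * (max (z - t') 0 - max (z - t) 0)) = RU t' - RU t"
  using integrable_pos_part \<mu>.prob_space
  by (simp add: RU_def right_diff_distrib)

lemma sample_RU_diff_eq:
  assumes "N > 0"
  shows "(\<Sum>j<N. (t' - t) + 1 / (1 - \<alpha>) * (max (z j - t') 0 - max (z j - t) 0)) / real N
    = sample_RU \<alpha> z N t' - sample_RU \<alpha> z N t"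
proof -
  have "(\<Sum>j<N. (t' - t) + 1 / (1 - \<alpha>) * (max (z j - t') 0 - max (z j - t) 0))
    = real N * (t' - t) + 1 / (1 - \<alpha>) * ((\<Sum>j<N. max (z j - t') 0) - (\<Sum>j<N. max (z j - t) 0))"
    unfolding sum.distrib sum_distrib_left[symmetric] sum_subtractf by (simp add: right_diff_distrib)
  then show ?thesis
    using assms by (simp add: sample_RU_def add_divide_distrib diff_divide_distrib right_diff_distrib mult.commute)
qed

lemma square_integrable_RU_diff:
  "square_integrable \<mu> (\<lambda>z. (t' - t) + 1 / (1 - \<alpha>) * (max (z - t') 0 - max (z - t) 0))"
  by (rule \<mu>.square_integrable_add \<mu>.square_integrable_const \<mu>.square_integrable_cmult
      \<mu>.square_integrable_diff square_integrable_pos_part)+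

text \<open>Secant slopes of a convex function increase with the length of the step; division is
  avoided.\<close>

lemma pos_part_slope_mono:
  assumes u: "0 < u" "u \<le> v"
  shows "v * (d * u + 1 / (1 - \<alpha>) * (max (z - (t + d * u)) 0 - max (z - t) 0))
    \<le> u * (d * v + 1 / (1 - \<alpha>) * (max (z - (t + d * v)) 0 - max (z - t) 0))"
proof -
  have "v * (max (z - (t + d * u)) 0 - max (z - t) 0) \<le> u * (max (z - (t + d * v)) 0 - max (z - t) 0)"
    using pos_part_convex[of u v "z - t" "- d"] u by (simp add: algebra_simps)
  then have "1 / (1 - \<alpha>) * (v * (max (z - (t + d * u)) 0 - max (z - t) 0))
    \<le> 1 / (1 - \<alpha>) * (u * (max (z - (t + d * v)) 0 - max (z - t) 0))"
    using \<alpha> by (intro mult_left_mono) auto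
  then show ?thesis by (simp add: algebra_simps)
qed

text \<open>It is meant for \<open>d = -1\<close> at the left and \<open>d = 1\<close> at the right
  end of the quantile interval, with \<open>u\<close> the distance from the endpoint
  \<open>c\<close> and \<open>s\<close> a subgradient there.\<close>

lemma descent:
  assumes s: "square_integrable \<mu> s" "integral\<^sup>L \<mu> s \<ge> 0"
    and sub: "\<And>u z. u > 0 \<Longrightarrow> u * s z \<le> d * u + 1 / (1 - \<alpha>) * (max (z - (c + d * u)) 0 - max (z - c) 0)"
    and less: "\<And>u. u > 0 \<Longrightarrow> RU c < RU (c + d * u)"
    and \<eta>: "\<eta> > 0" and e: "e > 0"
  shows "\<forall>\<^sub>F N in sequentially. \<exists>A\<in>events. prob A \<le> e \<and> (\<forall>\<omega>\<in>space M - A. \<forall>u>0.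
    sqrt (real N) * (sRU N \<omega> (c + d * u) - sRU N \<omega> c) \<ge> - \<eta>)"
proof -
  let ?g = "\<lambda>u z. ((c + d * u) - c) + 1 / (1 - \<alpha>) * (max (z - (c + d * u)) 0 - max (z - c) 0)"
  have "\<forall>\<^sub>F N in sequentially. \<exists>A\<in>events. prob A \<le> e \<and>
    (\<forall>\<omega>\<in>space M - A. \<forall>u>0. sqrt (real N) * ((\<Sum>j<N. ?g u (Z j \<omega>)) / real N) \<ge> - \<eta>)"
  proof (rule convex_descent[OF s square_integrable_RU_diff _ _ _ \<eta> e])
    show "integral\<^sup>L \<mu> (?g u) > 0" if "u > 0" for u
      unfolding RU_diff_eq_integral using less[OF that] by simp
    show "u * s z \<le> ?g u z" if "u > 0" for u z
      using sub[OF that, of z] by simp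
    show "v * ?g u z \<le> u * ?g v z" if "0 < u" "u \<le> v" for u v z
      using pos_part_slope_mono[OF that, of d z c] by simp
  qed
  then show ?thesis
    using eventually_gt_at_top[of 0] by eventually_elim (simp only: sample_RU_diff_eq)
qed

lemma descent_left:
  assumes \<eta>: "\<eta> > 0" and e: "e > 0"
  shows "\<forall>\<^sub>F N in sequentially. \<exists>A\<in>events. prob A \<le> e \<and> (\<forall>\<omega>\<in>space M - A. \<forall>u>0.
    sqrt (real N) * (sRU N \<omega> (lq + (-1) * u) - sRU N \<omega> lq) \<ge> - \<eta>)"
proof (rule descent[OF _ _ _ _ \<eta> e])
  \<comment> \<open>Derivative of the integrand at \<open>lq\<close> in the leftward direction. The
    half-line is closed, as an observation equal to \<open>lq\<close> contributes as soon as
    \<open>t\<close> moves left.\<close>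
  let ?s = "\<lambda>z. - 1 + 1 / (1 - \<alpha>) * indicator {lq..} z"
  show "square_integrable \<mu> ?s"
    by (rule \<mu>.square_integrable_add \<mu>.square_integrable_const \<mu>.square_integrable_cmult square_integrable_indicator | simp)+
  have "integral\<^sup>L \<mu> ?s = - 1 + 1 / (1 - \<alpha>) * \<mu>.prob {lq..}"
    using \<mu>.prob_space by (subst Bochner_Integration.integral_add) (auto simp: \<mu>.emeasure_eq_measure)
  also have "\<dots> \<ge> 0" using prob_atLeast_lq \<alpha> by (simp add: field_simps)
  finally show "integral\<^sup>L \<mu> ?s \<ge> 0" .
  show "u * ?s z \<le> (-1) * u + 1 / (1 - \<alpha>) * (max (z - (lq + (-1) * u)) 0 - max (z - lq) 0)" if u: "u > 0" for u z
  proof -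
    have "u * indicator {lq..} z \<le> max (z - (lq + (-1) * u)) 0 - max (z - lq) 0"
      using u by (auto simp: indicator_def)
    then have "1 / (1 - \<alpha>) * (u * indicator {lq..} z) \<le> 1 / (1 - \<alpha>) * (max (z - (lq + (-1) * u)) 0 - max (z - lq) 0)"
      using \<alpha> by (intro mult_left_mono) auto
    then show ?thesis by (simp add: algebra_simps)
  qed
qed (use RU_less_lq[OF integrable_id] in simp)

lemma descent_right:
  assumes \<eta>: "\<eta> > 0" and e: "e > 0"
  shows "\<forall>\<^sub>F N in sequentially. \<exists>A\<in>events. prob A \<le> e \<and> (\<forall>\<omega>\<in>space M - A. \<forall>u>0.
    sqrt (real N) * (sRU N \<omega> (rq + 1 * u) - sRU N \<omega> rq) \<ge> - \<eta>)"
proof (rule descent[OF _ _ _ _ \<eta> e])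
  \<comment> \<open>Derivative at \<open>rq\<close> in the rightward direction. An observation equal
    to \<open>rq\<close> contributes nothing for \<open>t\<close> from \<open>rq\<close> on, hence
    the open half-line.\<close>
  let ?s = "\<lambda>z. 1 + (- 1 / (1 - \<alpha>)) * indicator {rq<..} z"
  show "square_integrable \<mu> ?s"
    by (rule \<mu>.square_integrable_add \<mu>.square_integrable_const \<mu>.square_integrable_cmult square_integrable_indicator | simp)+
  have "integral\<^sup>L \<mu> ?s = 1 + (- 1 / (1 - \<alpha>)) * \<mu>.prob {rq<..}"
    using \<mu>.prob_space by (subst Bochner_Integration.integral_add) (auto simp: \<mu>.emeasure_eq_measure)
  also have "\<dots> \<ge> 0" using prob_greaterThan_rq \<alpha> by (simp add: field_simps)
  finally show "integral\<^sup>L \<mu> ?s \<ge> 0" .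
  show "u * ?s z \<le> 1 * u + 1 / (1 - \<alpha>) * (max (z - (rq + 1 * u)) 0 - max (z - rq) 0)" if u: "u > 0" for u z
  proof -
    have "- (u * indicator {rq<..} z) \<le> max (z - (rq + 1 * u)) 0 - max (z - rq) 0"
      using u by (auto simp: indicator_def)
    then have "1 / (1 - \<alpha>) * (- (u * indicator {rq<..} z)) \<le> 1 / (1 - \<alpha>) * (max (z - (rq + 1 * u)) 0 - max (z - rq) 0)"
      using \<alpha> by (intro mult_left_mono) auto
    then show ?thesis by (simp add: algebra_simps)
  qed
qed (use RU_greater_rq[OF integrable_id] in simp)

lemma continuous_on_sample_RU: "continuous_on S (sample_RU \<alpha> z N)"
  unfolding sample_RU_def[abs_def] by (intro continuous_intros)

lemma sample_RU_measurable [measurable]: "(\<lambda>\<omega>. sRU N \<omega> t) \<in> borel_measurable M"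
  unfolding sample_RU_def by measurable

lemma quantiles_compact: "compact (quantiles C \<alpha>)" "quantiles C \<alpha> \<noteq> {}"
  using lq_le_rq by (auto simp: quantiles_eq)

lemma bdd_below_sample_RU: "bdd_below (sample_RU \<alpha> z N ` quantiles C \<alpha>)"
  by (intro bounded_imp_bdd_below compact_imp_bounded compact_continuous_image continuous_on_sample_RU quantiles_compact)

lemma INF_sample_RU_measurable [measurable]:
  "(\<lambda>\<omega>. INF t\<in>quantiles C \<alpha>. sRU N \<omega> t) \<in> borel_measurable M"
  by (rule borel_measurable_INF_continuous[OF quantiles_compact(2) continuous_on_sample_RU bdd_below_sample_RU]) measurable

lemma AVaR_empirical_measurable:
  assumes N: "N > 0"
  shows "(\<lambda>\<omega>. AVaR \<alpha> (empirical_cdf (\<lambda>j. Z j \<omega>) N)) \<in> borel_measurable M"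
  unfolding AVaR_empirical(1)[OF N \<alpha>]
  by (rule borel_measurable_INF_continuous[OF _ continuous_on_sample_RU])
    (auto intro!: bdd_belowI2 AVaR_empirical(2)[OF N \<alpha>])

lemma AVaR_empirical_le_INF:
  assumes N: "N > 0"
  shows "AVaR \<alpha> (empirical_cdf z N) \<le> (INF t\<in>quantiles C \<alpha>. sample_RU \<alpha> z N t)"
  using AVaR_empirical(2)[OF N \<alpha>] quantiles_compact(2) by (intro cINF_greatest) auto

text \<open>The difference is nonnegative, as the infimum runs over fewer points, so only an upper
  bound is at stake. A point outside the interval is compared with the nearer endpoint, which it
  undercuts by at most \<open>\<eta> / sqrt N\<close> off a set of small probability that does not
  depend on the point.\<close>

theorem empirical_AVaR_localization:
  "tendsto_0_in_prob M (\<lambda>N \<omega>. sqrt (real N) *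
     ((INF t\<in>quantiles C \<alpha>. sRU N \<omega> t) - AVaR \<alpha> (empirical_cdf (\<lambda>j. Z j \<omega>) N)))"
  (is "tendsto_0_in_prob M ?X")
  unfolding tendsto_0_in_prob_def
proof safe
  show meas: "?X N \<in> borel_measurable M" for N
    using AVaR_empirical_measurable[of N] by (cases "N = 0") auto
  fix \<eta> :: real assume \<eta>: "\<eta> > 0"
  show "(\<lambda>N. prob {\<omega> \<in> space M. \<bar>?X N \<omega>\<bar> > \<eta>}) \<longlonglongrightarrow> 0"
  proof (rule order_tendstoI)
    fix e :: real assume e: "e > 0"
    \<comment> \<open>Two exceptional sets of probability at most \<open>e / 3\<close> leave the
      final inequality strict.\<close>
    then have e3: "e / 3 > 0" by simp
    show "\<forall>\<^sub>F N in sequentially. prob {\<omega> \<in> space M. \<bar>?X N \<omega>\<bar> > \<eta>} < e"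
      using descent_left[OF \<eta> e3] descent_right[OF \<eta> e3] eventually_gt_at_top[of 0]
    proof eventually_elim
      case (elim N)
      let ?d = "\<lambda>\<omega> t c. sqrt (real N) * (sRU N \<omega> t - sRU N \<omega> c)"
      obtain A where A: "A \<in> events" "prob A \<le> e/3"
        and "\<And>\<omega> u. \<omega> \<in> space M - A \<Longrightarrow> u > 0 \<Longrightarrow> ?d \<omega> (lq + (-1) * u) lq \<ge> - \<eta>"
        using elim(1) by blast
      from this(3)[of _ "lq - t" for t] have A3: "\<And>\<omega> t. \<omega> \<in> space M - A \<Longrightarrow> t < lq \<Longrightarrow> ?d \<omega> t lq \<ge> - \<eta>" by simp
      obtain B where B: "B \<in> events" "prob B \<le> e/3"
        and "\<And>\<omega> u. \<omega> \<in> space M - B \<Longrightarrow> u > 0 \<Longrightarrow> ?d \<omega> (rq + 1 * u) rq \<ge> - \<eta>"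
        using elim(2) by blast
      from this(3)[of _ "t - rq" for t] have B3: "\<And>\<omega> t. \<omega> \<in> space M - B \<Longrightarrow> t > rq \<Longrightarrow> ?d \<omega> t rq \<ge> - \<eta>" by simp
      have "\<bar>?X N \<omega>\<bar> \<le> \<eta>" if \<omega>: "\<omega> \<in> space M - (A \<union> B)" for \<omega>
      proof -
        let ?z = "\<lambda>j. Z j \<omega>"
        let ?I = "INF t\<in>quantiles C \<alpha>. sample_RU \<alpha> ?z N t"
        have I: "?I \<le> sample_RU \<alpha> ?z N t" if "t \<in> quantiles C \<alpha>" for t
          using that by (intro cINF_lower bdd_below_sample_RU)
        have N: "sqrt (real N) > 0" using elim by simp
        have key: "?I - \<eta> / sqrt (real N) \<le> sample_RU \<alpha> ?z N t" for t
        proof -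
          have *: "sample_RU \<alpha> ?z N c - \<eta> / sqrt (real N) \<le> sample_RU \<alpha> ?z N t"
            if "sqrt (real N) * (sample_RU \<alpha> ?z N t - sample_RU \<alpha> ?z N c) \<ge> - \<eta>" for c
          proof -
            have "- \<eta> / sqrt (real N) \<le> sample_RU \<alpha> ?z N t - sample_RU \<alpha> ?z N c"
              using that by (subst pos_divide_le_eq[OF N]) (simp add: mult.commute)
            then show ?thesis by simp
          qed
          have "0 \<le> \<eta> / sqrt (real N)" using \<eta> by simp
          then show ?thesis
            using A3[of \<omega> t, THEN *] B3[of \<omega> t, THEN *] I[of t] I[of lq] I[of rq] \<omega> lq_le_rq
            by (cases "t < lq"; cases "t > rq") (auto simp: quantiles_eq)
        qed
        have "?I - \<eta> / sqrt (real N) \<le> AVaR \<alpha> (empirical_cdf ?z N)"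
          unfolding AVaR_empirical(1)[OF elim(3) \<alpha>] using key by (intro cINF_greatest) auto
        then have "?I - AVaR \<alpha> (empirical_cdf ?z N) \<le> \<eta> / sqrt (real N)" by simp
        then have "?X N \<omega> \<le> \<eta>" using N by (simp add: pos_le_divide_eq mult.commute)
        moreover have "0 \<le> ?X N \<omega>" using AVaR_empirical_le_INF[OF elim(3), of ?z] by simp
        ultimately show ?thesis by simp
      qed
      then have "{\<omega> \<in> space M. \<bar>?X N \<omega>\<bar> > \<eta>} \<subseteq> A \<union> B" by (auto simp: not_le[symmetric])
      then have "prob {\<omega> \<in> space M. \<bar>?X N \<omega>\<bar> > \<eta>} \<le> prob (A \<union> B)"
        using A B by (intro finite_measure_mono) auto
      also have "\<dots> \<le> prob A + prob B" using A B by (intro measure_Un_le)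
      also have "\<dots> < e" using A B e by linarith
      finally show ?case .
    qed
  qed (auto intro!: always_eventually less_le_trans[OF _ measure_nonneg])
qed

end

section \<open>Support functions\<close>

definition support_fun :: "'e::euclidean_space set \<Rightarrow> 'e \<Rightarrow> real" where
  "support_fun W x = (SUP w\<in>W. w \<bullet> x)"

definition argmax_set :: "'e::euclidean_space set \<Rightarrow> 'e \<Rightarrow> 'e set" where
  "argmax_set W x = {w \<in> W. \<forall>v\<in>W. v \<bullet> x \<le> w \<bullet> x}"

locale compact_nonempty =
  fixes W :: "'e::euclidean_space set"
  assumes compact: "compact W" and nonempty: "W \<noteq> {}"
begin

lemma bdd_above_inner: "bdd_above ((\<lambda>w. w \<bullet> x) ` W)"
  by (intro bounded_imp_bdd_above compact_imp_bounded compact_continuous_image continuous_intros compact)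

lemma inner_le_support_fun: "w \<in> W \<Longrightarrow> w \<bullet> x \<le> support_fun W x"
  unfolding support_fun_def by (rule cSUP_upper[OF _ bdd_above_inner])

lemma support_fun_attained: "\<exists>w\<in>W. support_fun W x = w \<bullet> x"
proof -
  have "continuous_on W (\<lambda>w. w \<bullet> x)" by (intro continuous_intros)
  from continuous_attains_sup[OF compact nonempty this]
  obtain w where w: "w \<in> W" "\<And>v. v \<in> W \<Longrightarrow> v \<bullet> x \<le> w \<bullet> x" by auto
  then have "support_fun W x = w \<bullet> x"
    unfolding support_fun_def by (intro cSup_eq_maximum) auto
  with w show ?thesis by auto
qed

lemma support_fun_le: "(\<And>w. w \<in> W \<Longrightarrow> w \<bullet> x \<le> c) \<Longrightarrow> support_fun W x \<le> c"
  using support_fun_attained[of x] by auto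

lemma argmax_set_eq: "argmax_set W x = {w \<in> W. w \<bullet> x = support_fun W x}"
  using support_fun_attained[of x] inner_le_support_fun[of _ x]
  by (auto simp: argmax_set_def intro!: antisym)

lemma compact_nonempty_argmax: "compact_nonempty (argmax_set W x)"
proof
  show "argmax_set W x \<noteq> {}" using support_fun_attained[of x] by (auto simp: argmax_set_eq)
  have "closed {w. w \<bullet> x = support_fun W x}" by (intro closed_Collect_eq continuous_intros)
  moreover have "argmax_set W x = W \<inter> {w. w \<bullet> x = support_fun W x}" by (auto simp: argmax_set_eq)
  ultimately show "compact (argmax_set W x)" by (simp add: compact_Int_closed[OF compact])
qed

lemma norm_bound: "\<exists>B>0. \<forall>w\<in>W. norm w \<le> B"
  using compact_imp_bounded[OF compact] by (auto simp: bounded_pos)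

lemma support_fun_lipschitz:
  assumes "\<And>w. w \<in> W \<Longrightarrow> norm w \<le> B"
  shows "\<bar>support_fun W x - support_fun W y\<bar> \<le> B * norm (x - y)"
proof -
  have *: "support_fun W x - support_fun W y \<le> B * norm (x - y)" for x y
  proof -
    have "w \<bullet> x \<le> support_fun W y + B * norm (x - y)" if "w \<in> W" for w
    proof -
      have "w \<bullet> x = w \<bullet> y + w \<bullet> (x - y)" by (simp add: inner_diff_right)
      also have "\<dots> \<le> support_fun W y + norm w * norm (x - y)"
        by (intro add_mono inner_le_support_fun that norm_cauchy_schwarz)
      also have "\<dots> \<le> support_fun W y + B * norm (x - y)"
        by (intro add_left_mono mult_right_mono assms that) auto
      finally show ?thesis .
    qed
    from support_fun_le[OF this] show ?thesis by simp
  qed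
  from *[of x y] *[of y x] show ?thesis by (auto simp: abs_le_iff norm_minus_commute)
qed

lemma continuous_on_support_fun: "continuous_on S (support_fun W)"
proof -
  obtain B where B: "B > 0" "\<And>w. w \<in> W \<Longrightarrow> norm w \<le> B" using norm_bound by auto
  have "lipschitz_on B S (support_fun W)"
    using support_fun_lipschitz[OF B(2)] B(1) by (intro lipschitz_onI) (auto simp: dist_norm)
  then show ?thesis by (rule lipschitz_on_continuous_on)
qed

text \<open>What is left of \<open>W\<close> outside a \<open>\<delta>\<close>-neighbourhood of the
  maximizers is compact, so, unless empty, its best value falls short of the maximum by a positive
  gap, and \<open>\<rho>\<close> is half that gap.\<close>

lemma near_argmax:
  assumes \<delta>: "\<delta> > 0"
  shows "\<exists>\<rho>>0. \<forall>w\<in>W. support_fun W x - \<rho> \<le> w \<bullet> x \<longrightarrow> (\<exists>v\<in>argmax_set W x. norm (w - v) < \<delta>)"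
proof -
  let ?U = "\<Union>v\<in>argmax_set W x. ball v \<delta>"
  have U: "\<exists>v\<in>argmax_set W x. norm (w - v) < \<delta>" if "w \<in> ?U" for w
    using that by (auto simp: dist_norm norm_minus_commute)
  show ?thesis
  proof (cases "W - ?U = {}")
    case True
    then have "\<forall>w\<in>W. \<exists>v\<in>argmax_set W x. norm (w - v) < \<delta>" using U by blast
    then show ?thesis by (intro exI[of _ 1]) auto
  next
    case False
    have c: "compact (W - ?U)" by (intro compact_diff compact open_UN) auto
    have "continuous_on (W - ?U) (\<lambda>w. w \<bullet> x)" by (intro continuous_intros)
    from continuous_attains_sup[OF c False this]
    obtain w0 where w0: "w0 \<in> W - ?U" "\<forall>v\<in>W - ?U. v \<bullet> x \<le> w0 \<bullet> x" by (rule bexE)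
    have "w0 \<notin> argmax_set W x" using w0(1) \<delta> centre_in_ball by blast
    then have lt: "w0 \<bullet> x < support_fun W x"
      using w0(1) inner_le_support_fun[of w0 x] by (auto simp: argmax_set_eq)
    have "w \<in> ?U" if w: "w \<in> W" "support_fun W x - (support_fun W x - w0 \<bullet> x) / 2 \<le> w \<bullet> x" for w
    proof (rule ccontr)
      assume "w \<notin> ?U"
      then have "w \<bullet> x \<le> w0 \<bullet> x" using w(1) by (intro bspec[OF w0(2)]) simp
      then show False using w(2) lt by (simp add: field_simps)
    qed
    then show ?thesis using lt U
      by (intro exI[of _ "(support_fun W x - w0 \<bullet> x) / 2"]) (meson diff_gt_0_iff_gt half_gt_zero)
  qed
qed

text \<open>Danskin's theorem, uniformly over \<open>norm h \<le> K\<close>. A maximizer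
  \<open>w\<close> at the shifted point is within \<open>2 * B * K * t\<close> of optimal at
  \<open>x\<close>, hence close to some \<open>v\<close> in the argmax set; exchanging
  \<open>w\<close> for \<open>v\<close> costs at most
  \<open>t * norm (w - v) * norm h\<close>.\<close>

lemma support_fun_directional:
  assumes \<eta>: "\<eta> > 0" and K: "K \<ge> 0"
  shows "\<exists>\<rho>>0. \<forall>t h. 0 < t \<and> t < \<rho> \<and> norm h \<le> K \<longrightarrow>
    support_fun W (x + t *\<^sub>R h) - support_fun (argmax_set W x) (x + t *\<^sub>R h) \<le> t * \<eta>"
proof -
  interpret A: compact_nonempty "argmax_set W x" by (rule compact_nonempty_argmax)
  obtain B where B: "B > 0" "\<And>w. w \<in> W \<Longrightarrow> norm w \<le> B" using norm_bound by auto
  \<comment> \<open>This closeness of \<open>w\<close> and \<open>v\<close> gives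
    \<open>(w - v) \<bullet> h \<le> \<eta>\<close>. The added 1, here and in \<open>\<rho>\<close>,
    covers \<open>K = 0\<close>.\<close>
  have "\<eta> / (K + 1) > 0" using \<eta> K by simp
  from near_argmax[OF this, of x] obtain r where r: "r > 0"
    "\<And>w. w \<in> W \<Longrightarrow> support_fun W x - r \<le> w \<bullet> x \<Longrightarrow> \<exists>v\<in>argmax_set W x. norm (w - v) < \<eta> / (K + 1)"
    by auto
  define \<rho> where "\<rho> = r / (2 * B * K + 1)"
  have BK: "0 \<le> 2 * B * K" using B K by simp
  have \<rho>: "\<rho> > 0" using r BK by (simp add: \<rho>_def)
  have "support_fun W (x + t *\<^sub>R h) - support_fun (argmax_set W x) (x + t *\<^sub>R h) \<le> t * \<eta>"
    if t: "0 < t" "t < \<rho>" and h: "norm h \<le> K" for t h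
  proof -
    obtain w where w: "w \<in> W" "support_fun W (x + t *\<^sub>R h) = w \<bullet> (x + t *\<^sub>R h)"
      using support_fun_attained by blast
    obtain v0 where v0: "v0 \<in> W" "support_fun W x = v0 \<bullet> x" using support_fun_attained by blast
    have "v0 \<bullet> (x + t *\<^sub>R h) \<le> w \<bullet> (x + t *\<^sub>R h)"
      using inner_le_support_fun[OF v0(1), of "x + t *\<^sub>R h"] w by simp
    then have 1: "support_fun W x - t * ((w - v0) \<bullet> h) \<le> w \<bullet> x"
      by (simp add: v0 inner_add_right inner_diff_left algebra_simps)
    have "norm (w - v0) \<le> 2 * B"
      using B(2)[OF w(1)] B(2)[OF v0(1)] norm_triangle_ineq4[of w v0] by linarith
    moreover have "(w - v0) \<bullet> h \<le> norm (w - v0) * norm h" by (rule norm_cauchy_schwarz)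
    ultimately have "(w - v0) \<bullet> h \<le> 2 * B * K"
      using B h by (elim order_trans) (intro mult_mono, auto)
    then have "t * ((w - v0) \<bullet> h) \<le> t * (2 * B * K)" using t by (intro mult_left_mono) auto
    also have "\<dots> \<le> \<rho> * (2 * B * K + 1)" using t BK by (intro mult_mono) auto
    also have "\<dots> = r" using BK by (simp add: \<rho>_def)
    finally have "support_fun W x - r \<le> w \<bullet> x" using 1 by linarith
    from r(2)[OF w(1) this] obtain v where v: "v \<in> argmax_set W x" "norm (w - v) < \<eta> / (K + 1)" by blast
    have "w \<bullet> x \<le> v \<bullet> x" using v(1) w(1) by (simp add: argmax_set_def)
    moreover have "(w - v) \<bullet> h \<le> \<eta>"
    proof -
      have "(w - v) \<bullet> h \<le> norm (w - v) * norm h" by (rule norm_cauchy_schwarz)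
      also have "\<dots> \<le> \<eta> / (K + 1) * (K + 1)" using v(2) h K \<eta> by (intro mult_mono) auto
      also have "\<dots> = \<eta>" using K by simp
      finally show ?thesis .
    qed
    then have "t * ((w - v) \<bullet> h) \<le> t * \<eta>" using t by (intro mult_left_mono) auto
    ultimately have "w \<bullet> (x + t *\<^sub>R h) \<le> v \<bullet> (x + t *\<^sub>R h) + t * \<eta>"
      by (simp add: inner_add_right inner_diff_left algebra_simps)
    also have "\<dots> \<le> support_fun (argmax_set W x) (x + t *\<^sub>R h) + t * \<eta>"
      using A.inner_le_support_fun[OF v(1)] by simp
    finally show ?thesis using w(2) by simp
  qed
  with \<rho> show ?thesis by blast
qed

end

section \<open>Suprema and infima under affine maps and over compact parameter sets\<close>

lemma cSUP_affine:
  fixes f :: "'i \<Rightarrow> real"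
  assumes "c > 0" "A \<noteq> {}" "bdd_above (f ` A)"
  shows "(SUP x\<in>A. c * (f x - m)) = c * ((SUP x\<in>A. f x) - m)"
proof (rule cSup_eq_non_empty)
  show "(\<lambda>x. c * (f x - m)) ` A \<noteq> {}" using assms by simp
  show "y \<le> c * ((SUP x\<in>A. f x) - m)" if "y \<in> (\<lambda>x. c * (f x - m)) ` A" for y
    using that assms by (auto intro!: mult_left_mono diff_right_mono cSUP_upper)
  fix y assume y: "\<And>x. x \<in> (\<lambda>x. c * (f x - m)) ` A \<Longrightarrow> x \<le> y"
  have "(SUP x\<in>A. f x) \<le> y / c + m"
  proof (rule cSUP_least[OF assms(2)])
    fix x assume "x \<in> A"
    then have "c * (f x - m) \<le> y" using y by auto
    then have "f x - m \<le> y / c" using assms(1) by (simp add: pos_le_divide_eq mult.commute)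
    then show "f x \<le> y / c + m" by simp
  qed
  then have "(SUP x\<in>A. f x) - m \<le> y / c" by simp
  then show "c * ((SUP x\<in>A. f x) - m) \<le> y"
    using assms(1) by (simp add: pos_le_divide_eq mult.commute)
qed

lemma cINF_affine:
  fixes f :: "'i \<Rightarrow> real"
  assumes "c > 0" "A \<noteq> {}" "bdd_below (f ` A)"
  shows "(INF x\<in>A. c * (f x - m)) = c * ((INF x\<in>A. f x) - m)"
proof -
  obtain B where B: "\<And>x. x \<in> A \<Longrightarrow> B \<le> f x" using assms(3) unfolding bdd_below_def by blast
  have "bdd_above ((\<lambda>x. - f x) ` A)" by (intro bdd_aboveI2[of _ _ "- B"]) (simp add: B)
  from cSUP_affine[OF assms(1,2) this, of "- m"] show ?thesis
    by (simp add: Inf_real_def image_image algebra_simps)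
qed

lemma cINF_close:
  fixes f g :: "'i \<Rightarrow> real"
  assumes "A \<noteq> {}" "bdd_below (f ` A)" "bdd_below (g ` A)"
    and "\<And>x. x \<in> A \<Longrightarrow> \<bar>f x - g x\<bar> \<le> e"
  shows "\<bar>(INF x\<in>A. f x) - (INF x\<in>A. g x)\<bar> \<le> e"
proof -
  have *: "(INF x\<in>A. f x) - e \<le> (INF x\<in>A. g x)"
    if "bdd_below (f ` A)" "\<And>x. x \<in> A \<Longrightarrow> \<bar>f x - g x\<bar> \<le> e" for f g :: "'i \<Rightarrow> real"
  proof (rule cINF_greatest[OF assms(1)])
    fix x assume x: "x \<in> A"
    show "(INF x\<in>A. f x) - e \<le> g x"
      using cINF_lower[OF that(1) x] that(2)[OF x] by (simp add: abs_le_iff)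
  qed
  from *[OF assms(2,4)] *[OF assms(3), of f] assms(4) show ?thesis
    by (auto simp: abs_le_iff abs_minus_commute)
qed

text \<open>Compactness of \<open>B\<close> makes \<open>f (x, b)\<close> close to
  \<open>f (a, b)\<close> for all \<open>b\<close> at once as \<open>x\<close> nears
  \<open>a\<close>, and uniformly close functions have close infima.\<close>

lemma continuous_on_INF_compact:
  fixes f :: "'a::metric_space \<times> 'b::topological_space \<Rightarrow> real"
  assumes f: "continuous_on (A \<times> B) f" and B: "compact B" "B \<noteq> {}"
  shows "continuous_on A (\<lambda>a. INF b\<in>B. f (a, b))"
proof -
  have cts: "continuous_on B (\<lambda>b. f (a, b))" if "a \<in> A" for a
    by (rule continuous_on_compose2[OF f]) (use that in \<open>auto intro!: continuous_intros\<close>)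
  have bdd: "bdd_below ((\<lambda>b. f (a, b)) ` B)" if "a \<in> A" for a
    by (intro bounded_imp_bdd_below compact_imp_bounded compact_continuous_image cts that B)
  show ?thesis
    unfolding continuous_on_iff
  proof safe
    fix a and e :: real assume a: "a \<in> A" and e: "e > 0"
    then have e2: "e / 2 > 0" by simp
    obtain X where X: "a \<in> X" "open X" "\<forall>x\<in>X \<inter> A. \<forall>t\<in>B. dist (f (x, t)) (f (a, t)) \<le> e / 2"
      by (rule continuous_on_prod_compactE[OF f B(1) a e2])
    obtain d where d: "d > 0" "ball a d \<subseteq> X" using X by (meson openE)
    have "dist (INF b\<in>B. f (x, b)) (INF b\<in>B. f (a, b)) < e" if "x \<in> A" "dist x a < d" for x
    proof -
      have "x \<in> X \<inter> A" using that d by (auto simp: dist_commute)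
      then have "\<bar>(INF b\<in>B. f (x, b)) - (INF b\<in>B. f (a, b))\<bar> \<le> e / 2"
        using X(3) by (intro cINF_close B bdd that a) (auto simp: dist_real_def)
      then show ?thesis using e by (simp add: dist_real_def)
    qed
    with d show "\<exists>d>0. \<forall>x\<in>A. dist x a < d \<longrightarrow> dist (INF b\<in>B. f (x, b)) (INF b\<in>B. f (a, b)) < e" by blast
  qed
qed

lemma continuous_on_SUP_compact:
  fixes f :: "'a::metric_space \<times> 'b::topological_space \<Rightarrow> real"
  assumes f: "continuous_on (A \<times> B) f" and B: "compact B" "B \<noteq> {}"
  shows "continuous_on A (\<lambda>a. SUP b\<in>B. f (a, b))"
proof -
  have "continuous_on A (\<lambda>a. - (INF b\<in>B. - f (a, b)))"
    using continuous_on_INF_compact[of A B "\<lambda>x. - f x", OF _ B] f by (auto intro!: continuous_intros)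
  then show ?thesis by (simp add: Inf_real_def image_image)
qed

section \<open>Finite-dimensional Gaussian processes\<close>

locale psd_form =
  fixes q :: "'e::euclidean_space \<Rightarrow> 'e \<Rightarrow> real"
  assumes bilinear: "bilinear q" and sym: "q u v = q v u" and nonneg: "q u u \<ge> 0"
begin

lemma q_diff_self: "q (v - c *\<^sub>R b) (v - c *\<^sub>R b) = q v v - 2 * c * q b v + c\<^sup>2 * q b b"
  using sym[of v b]
  by (simp add: bilinear_lsub[OF bilinear] bilinear_rsub[OF bilinear] bilinear_lmul[OF bilinear]
      bilinear_rmul[OF bilinear] power2_eq_square algebra_simps)

lemma q_eq_0:
  assumes "q b b = 0"
  shows "q b v = 0"
proof (rule ccontr)
  assume n: "q b v \<noteq> 0"
  \<comment> \<open>With \<open>q b b = 0\<close> the form is affine in \<open>c\<close> along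
    \<open>v - c *\<^sub>R b\<close>; this \<open>c\<close> would give it the value -1.\<close>
  have "0 \<le> q v v - 2 * ((q v v + 1) / (2 * q b v)) * q b v"
    using nonneg[of "v - ((q v v + 1) / (2 * q b v)) *\<^sub>R b"] assms by (simp only: q_diff_self mult_zero_right add_0_right)
  then show False using n by simp
qed

end

text \<open>
  Cholesky: subtracting the square of a linear form makes one more basis vector null and keeps the
  form positive semidefinite.
\<close>

lemma psd_form_factorization:
  fixes q :: "'e::euclidean_space \<Rightarrow> 'e \<Rightarrow> real"
  assumes "psd_form q"
  shows "\<exists>(m::nat) e. \<forall>u v. q u v = (\<Sum>i<m. (u \<bullet> e i) * (v \<bullet> e i))"
  using assms
proof (induction "card {b\<in>Basis. q b b \<noteq> 0}" arbitrary: q rule: less_induct)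
  case less
  interpret psd_form q by (rule less.prems)
  show ?case
  proof (cases "\<exists>b\<in>Basis. q b b \<noteq> 0")
    case False
    have "q = (\<lambda>_ _. 0)"
      by (rule bilinear_eq_stdbasis[OF bilinear]) (use False q_eq_0 in \<open>auto simp: bilinear_def linear_iff\<close>)
    then show ?thesis by (intro exI[of _ 0]) auto
  next
    case True
    then obtain b where b: "b \<in> Basis" "q b b \<noteq> 0" by auto
    then have pos: "q b b > 0" using nonneg[of b] by simp
    \<comment> \<open>The Riesz vector of the linear form \<open>q b\<close>, scaled so that
      \<open>(u \<bullet> d)\<^sup>2\<close> is the part of \<open>q u u\<close> that
      \<open>b\<close> accounts for.\<close>
    define d where "d = (1 / sqrt (q b b)) *\<^sub>R adjoint (q b) 1"
    have lin: "linear (q b)" using bilinear by (simp add: bilinear_def)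
    have d: "u \<bullet> d = q b u / sqrt (q b b)" for u
      using adjoint_works[OF lin, of u 1] by (simp add: d_def)
    define q' where "q' u v = q u v - (u \<bullet> d) * (v \<bullet> d)" for u v
    have q': "psd_form q'"
    proof
      show "bilinear q'"
        by (auto simp: bilinear_def q'_def linear_iff bilinear_ladd[OF bilinear] bilinear_lmul[OF bilinear]
            bilinear_radd[OF bilinear] bilinear_rmul[OF bilinear] algebra_simps inner_add_left)
      show "q' u v = q' v u" for u v using sym[of u v] by (simp add: q'_def)
      show "0 \<le> q' u u" for u
      proof -
        \<comment> \<open>The multiple of \<open>b\<close> that minimizes the form is subtracted;
          the minimum is exactly \<open>q' u u\<close>.\<close>
        have "0 \<le> q u u - 2 * (q b u / q b b) * q b u + (q b u / q b b)\<^sup>2 * q b b"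
          using nonneg[of "u - (q b u / q b b) *\<^sub>R b"] by (simp only: q_diff_self)
        also have "\<dots> = q' u u"
          using pos by (simp add: q'_def d power2_eq_square)
        finally show ?thesis .
      qed
    qed
    have "{c\<in>Basis. q' c c \<noteq> 0} \<subset> {c\<in>Basis. q c c \<noteq> 0}"
    proof
      \<comment> \<open>Cauchy-Schwarz in the degenerate case: a null vector is orthogonal to
        \<open>b\<close>, so it stays null.\<close>
      have "q' c c = 0" if "q c c = 0" for c
        using q_eq_0[OF that, of b] sym[of b c] that by (simp add: q'_def d)
      then show "{c\<in>Basis. q' c c \<noteq> 0} \<subseteq> {c\<in>Basis. q c c \<noteq> 0}" by auto
      have "q' b b = 0" using pos by (simp add: q'_def d)
      then show "{c\<in>Basis. q' c c \<noteq> 0} \<noteq> {c\<in>Basis. q c c \<noteq> 0}" using b by auto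
    qed
    then have "card {c\<in>Basis. q' c c \<noteq> 0} < card {c\<in>Basis. q c c \<noteq> 0}"
      by (intro psubset_card_mono) auto
    from less.hyps[OF this q'] obtain m :: nat and e where
      e: "\<And>u v. q' u v = (\<Sum>i<m. (u \<bullet> e i) * (v \<bullet> e i))" by auto
    have "q u v = (\<Sum>i<Suc m. (u \<bullet> (e(m := d)) i) * (v \<bullet> (e(m := d)) i))" for u v
      using e[of u v] by (simp add: q'_def)
    then show ?thesis by blast
  qed
qed

section \<open>Construction of Gaussian vectors from independent standard normals\<close>

lemma std_normal_sequence:
  fixes c :: "nat \<Rightarrow> real"
  defines "P \<equiv> (\<Pi>\<^sub>M i\<in>(UNIV::nat set). std_normal_distribution)"
  shows "prob_space P"
    and "(\<lambda>\<omega>. \<omega> i) \<in> borel_measurable P"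
    and "distr P borel (\<lambda>\<omega>. \<Sum>i<m. c i * \<omega> i) = normal_law 0 (\<Sum>i<m. (c i)\<^sup>2)"
proof -
  have std: "prob_space std_normal_distribution"
    using real_dist_normal_dist by (simp add: real_distribution_def)
  show "prob_space P" unfolding P_def by (intro prob_space_PiM std)
  then interpret prob_space P .
  have m: "(\<lambda>\<omega>. \<omega> i) \<in> borel_measurable P" for i
    unfolding P_def using measurable_component_singleton[of i UNIV "\<lambda>_. std_normal_distribution"]
    by (simp cong: measurable_cong_sets)
  then show "(\<lambda>\<omega>. \<omega> i) \<in> borel_measurable P" .
  note [measurable] = m
  have law: "distr P borel (\<lambda>\<omega>. \<omega> i) = std_normal_distribution" for i
  proof -
    have "distr P borel (\<lambda>\<omega>. \<omega> i) = distr P std_normal_distribution (\<lambda>\<omega>. \<omega> i)" by (intro distr_cong) auto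
    also have "\<dots> = std_normal_distribution" unfolding P_def by (rule distr_PiM_component[OF std]) auto
    finally show ?thesis .
  qed
  have ind: "indep_vars (\<lambda>_. borel) (\<lambda>i \<omega>. \<omega> i) (UNIV :: nat set)"
  proof (subst indep_vars_iff_distr_eq_PiM')
    have "distr P (\<Pi>\<^sub>M i\<in>UNIV. borel) (\<lambda>x. \<lambda>i\<in>UNIV. x i) = distr P P (\<lambda>x. x)"
      unfolding P_def by (intro distr_cong sets_PiM_cong) auto
    also have "\<dots> = P" by simp
    also have "\<dots> = (\<Pi>\<^sub>M i\<in>UNIV. distr P borel (\<lambda>\<omega>. \<omega> i))" by (simp add: law) (simp add: P_def)
    finally show "distr P (\<Pi>\<^sub>M i\<in>UNIV. borel) (\<lambda>x. \<lambda>i\<in>UNIV. x i) = (\<Pi>\<^sub>M i\<in>UNIV. distr P borel (\<lambda>\<omega>. \<omega> i))" .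
  qed auto
  \<comment> \<open>Summands with coefficient 0 are dropped first, since describing a summand by a
    normal density demands positive variance.\<close>
  let ?I = "{i. i < m \<and> c i \<noteq> 0}"
  have sum_eq: "(\<Sum>i<m. c i * \<omega> i) = (\<Sum>i\<in>?I. c i * \<omega> i)" for \<omega> :: "nat \<Rightarrow> real"
    by (rule sum.mono_neutral_right) auto
  have var_eq: "(\<Sum>i<m. (c i)\<^sup>2) = (\<Sum>i\<in>?I. (c i)\<^sup>2)"
    by (rule sum.mono_neutral_right) auto
  show "distr P borel (\<lambda>\<omega>. \<Sum>i<m. c i * \<omega> i) = normal_law 0 (\<Sum>i<m. (c i)\<^sup>2)"
  proof (cases "?I = {}")
    case True
    have "distr P borel (\<lambda>\<omega>. 0::real) = return borel 0" by (rule distr_const) simp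
    then show ?thesis unfolding sum_eq var_eq True by (simp add: normal_law_def)
  next
    case False
    have "distributed P lborel (\<lambda>\<omega>. \<Sum>i\<in>?I. c i * \<omega> i) (normal_density (\<Sum>i\<in>?I. 0) (sqrt (\<Sum>i\<in>?I. \<bar>c i\<bar>\<^sup>2)))"
    proof (rule sum_indep_normal)
      show "indep_vars (\<lambda>i. borel) (\<lambda>i \<omega>. c i * \<omega> i) ?I"
        by (rule indep_vars_compose2[OF indep_vars_subset[OF ind], where Y="\<lambda>i z. c i * z"]) auto
      fix i assume i: "i \<in> ?I"
      have "distr P lborel (\<lambda>\<omega>. \<omega> i) = distr P borel (\<lambda>\<omega>. \<omega> i)" by (intro distr_cong) auto
      then have "distributed P lborel (\<lambda>\<omega>. \<omega> i) std_normal_density"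
        unfolding distributed_def by (simp add: law)
      from normal_density_affine[OF this, of "c i" 0] i
      show "distributed P lborel (\<lambda>\<omega>. c i * \<omega> i) (normal_density 0 \<bar>c i\<bar>)" by simp
    qed (use False in auto)
    then have "distr P lborel (\<lambda>\<omega>. \<Sum>i\<in>?I. c i * \<omega> i) = density lborel (normal_density 0 (sqrt (\<Sum>i\<in>?I. (c i)\<^sup>2)))"
      by (simp add: distributed_def)
    moreover have "distr P lborel (\<lambda>\<omega>. \<Sum>i\<in>?I. c i * \<omega> i) = distr P borel (\<lambda>\<omega>. \<Sum>i\<in>?I. c i * \<omega> i)"
      by (intro distr_cong) auto
    moreover have "(\<Sum>i\<in>?I. (c i)\<^sup>2) > 0"
      using False by (intro sum_pos) auto
    ultimately show ?thesis unfolding sum_eq var_eq by (simp add: normal_law_def)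
  qed
qed

text \<open>Once \<open>q\<close> is a sum of products of linear forms, the vectors
  \<open>e i\<close> of these forms, weighted by independent standard normals, add up to a vector
  with the required variances.\<close>

lemma (in psd_form) gaussian_vector_exists:
  "\<exists>(P :: (nat \<Rightarrow> real) measure) G. prob_space P \<and> G \<in> borel_measurable P \<and>
    (\<forall>v. distr P borel (\<lambda>\<omega>. v \<bullet> G \<omega>) = normal_law 0 (q v v))"
proof -
  obtain m :: nat and e where e: "\<And>u v. q u v = (\<Sum>i<m. (u \<bullet> e i) * (v \<bullet> e i))"
    using psd_form_factorization[of q] psd_form_axioms by auto
  let ?P = "\<Pi>\<^sub>M i\<in>(UNIV::nat set). std_normal_distribution"
  let ?G = "\<lambda>\<omega>. \<Sum>i<m. \<omega> i *\<^sub>R e i"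
  have [measurable]: "(\<lambda>\<omega>. \<omega> i) \<in> borel_measurable ?P" for i by (rule std_normal_sequence)
  have "?G \<in> borel_measurable ?P"
    by (intro borel_measurable_sum borel_measurable_scaleR) auto
  moreover have "distr ?P borel (\<lambda>\<omega>. v \<bullet> ?G \<omega>) = normal_law 0 (q v v)" for v
    using std_normal_sequence(3)[where m=m and c="\<lambda>i. v \<bullet> e i"]
    by (simp add: inner_sum_right e power2_eq_square mult.commute)
  ultimately show ?thesis using std_normal_sequence(1) by blast
qed

lemma (in prob_space) normal_law_distr_moments:
  assumes X [measurable]: "X \<in> borel_measurable M" and law: "distr M borel X = normal_law m v" and v: "v \<ge> 0"
  shows "square_integrable M X" "expectation X = m" "expectation (\<lambda>\<omega>. (X \<omega> - m)\<^sup>2) = v"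
proof -
  have "integrable (distr M borel X) (\<lambda>x. x\<^sup>2)" unfolding law by (rule normal_law_moments[OF v])
  then show "square_integrable M X" by (simp add: square_integrable_def integrable_distr_eq)
  have "integral\<^sup>L (distr M borel X) (\<lambda>x. x) = m" unfolding law by (rule normal_law_moments[OF v])
  then show "expectation X = m" by (simp add: integral_distr)
  have "integral\<^sup>L (distr M borel X) (\<lambda>x. (x - m)\<^sup>2) = v" unfolding law by (rule normal_law_moments[OF v])
  then show "expectation (\<lambda>\<omega>. (X \<omega> - m)\<^sup>2) = v" by (simp add: integral_distr)
qed

text \<open>The variances of all projections yield the covariances by polarization, and a linear
  combination of values of the process is again one projection of \<open>G\<close>.\<close>

lemma (in psd_form) linear_gaussian_process:
  fixes L :: "'i::topological_space \<Rightarrow> 'e"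
  assumes P: "prob_space P" and G [measurable]: "G \<in> borel_measurable P"
    and law: "\<And>v. distr P borel (\<lambda>\<omega>. v \<bullet> G \<omega>) = normal_law 0 (q v v)"
    and L: "continuous_on I L"
  shows "continuous_centered_gaussian_process P I (\<lambda>s t. q (L s) (L t)) (\<lambda>s \<omega>. L s \<bullet> G \<omega>)"
proof -
  interpret prob_space P by fact
  have m: "square_integrable P (\<lambda>\<omega>. v \<bullet> G \<omega>)" "expectation (\<lambda>\<omega>. v \<bullet> G \<omega>) = 0"
    "expectation (\<lambda>\<omega>. (v \<bullet> G \<omega>)\<^sup>2) = q v v" for v
    using normal_law_distr_moments[OF _ law[of v] nonneg] by auto
  have cov: "expectation (\<lambda>\<omega>. (u \<bullet> G \<omega>) * (v \<bullet> G \<omega>)) = q u v" for u v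
  proof -
    have "q (u + v) (u + v) = expectation (\<lambda>\<omega>. (u \<bullet> G \<omega>)\<^sup>2 + (v \<bullet> G \<omega>)\<^sup>2 + 2 * ((u \<bullet> G \<omega>) * (v \<bullet> G \<omega>)))"
      unfolding m(3)[symmetric] by (simp add: inner_add_left power2_sum mult.assoc)
    also have "\<dots> = q u u + q v v + 2 * expectation (\<lambda>\<omega>. (u \<bullet> G \<omega>) * (v \<bullet> G \<omega>))"
      using m(1) m(3) square_integrable_times[OF m(1)[of u] m(1)[of v]] by (simp add: square_integrable_def)
    also have "q (u + v) (u + v) = q u u + q v v + 2 * q u v"
      using sym[of u v] by (simp add: bilinear_ladd[OF bilinear] bilinear_radd[OF bilinear])
    finally show ?thesis by simp
  qed
  have "\<exists>m v. v \<ge> 0 \<and> distr P borel (\<lambda>\<omega>. \<Sum>t\<in>J. c t * (L t \<bullet> G \<omega>)) = normal_law m v" for J :: "'i set" and c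
    using law[of "\<Sum>t\<in>J. c t *\<^sub>R L t"] nonneg by (auto simp: inner_sum_left)
  then show ?thesis
    using P m(2) cov L by (auto simp: continuous_centered_gaussian_process_def gaussian_process_def intro!: continuous_intros)
qed

text \<open>
  A centered Gaussian process whose covariance factors through a linear map \<open>L\<close> into a finite-dimensional
  space is almost surely a linear image of a Gaussian vector \<open>\<Gamma>\<close>; as \<open>L s\<close> need not span the
  whole space, the law of \<open>\<Gamma>\<close> is only determined after a projection \<open>\<rho>\<close> onto the span.
\<close>

lemma (in psd_form) gaussian_process_factorization:
  fixes L :: "'i::euclidean_space \<Rightarrow> 'e"
  assumes Y: "continuous_centered_gaussian_process P I K Y"
    and K: "\<And>s t. s \<in> I \<Longrightarrow> t \<in> I \<Longrightarrow> K s t = q (L s) (L t)"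
    and L: "continuous_on I L"
  shows "\<exists>\<Gamma> \<rho>. linear \<rho> \<and> \<Gamma> \<in> borel_measurable P \<and> (\<forall>s\<in>I. \<rho> (L s) = L s) \<and>
    (\<forall>t. distr P borel (\<lambda>\<omega>. t \<bullet> \<Gamma> \<omega>) = normal_law 0 (q (\<rho> t) (\<rho> t))) \<and>
    (AE \<omega> in P. \<forall>s\<in>I. Y s \<omega> = L s \<bullet> \<Gamma> \<omega>)"
proof -
  have gp: "gaussian_process P I Y" and cts: "\<And>\<omega>. \<omega> \<in> space P \<Longrightarrow> continuous_on I (\<lambda>t. Y t \<omega>)"
    and mean: "\<And>t. t \<in> I \<Longrightarrow> (\<integral>\<omega>. Y t \<omega> \<partial>P) = 0"
    and cov: "\<And>s t. s \<in> I \<Longrightarrow> t \<in> I \<Longrightarrow> (\<integral>\<omega>. Y s \<omega> * Y t \<omega> \<partial>P) = q (L s) (L t)"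
    using Y K unfolding continuous_centered_gaussian_process_def by auto
  interpret prob_space P using gp by (simp add: gaussian_process_def)
  have Ym [measurable]: "Y t \<in> borel_measurable P" if "t \<in> I" for t
    using gp that by (simp add: gaussian_process_def)
  have lc: "\<exists>m v. v \<ge> 0 \<and> distr P borel (\<lambda>\<omega>. \<Sum>t\<in>J. c t * Y t \<omega>) = normal_law m v"
    if "finite J" "J \<subseteq> I" for J c
    using gp that unfolding gaussian_process_def by blast
  have sq: "square_integrable P (Y t)" if t: "t \<in> I" for t
  proof -
    obtain m v where "v \<ge> 0" "distr P borel (Y t) = normal_law m v"
      using lc[of "{t}" "\<lambda>_. 1"] t by auto
    then show ?thesis using normal_law_distr_moments(1)[OF Ym[OF t]] by blast
  qed
  \<comment> \<open>A basis of the span of the values of \<open>L\<close>, taken among these values,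
    so that the finitely many \<open>Y s\<close> with \<open>s\<close> in \<open>J\<close> carry the
    whole process.\<close>
  obtain B where B: "B \<subseteq> L ` I" "independent B" "L ` I \<subseteq> span B" by (rule maximal_independent_subset)
  obtain J where J: "J \<subseteq> I" "inj_on L J" "B = L ` J" using B(1) unfolding subset_image_inj by blast
  have "finite B" using B(2) by (rule independent_imp_finite)
  then have fJ: "finite J" using J by (simp add: finite_image_iff)
  have "\<forall>s. \<exists>g. linear g \<and> (\<forall>x\<in>B. g x = (if x = L s then 1 else (0::real)))"
    by (intro allI linear_independent_extend[OF B(2)])
  then obtain g where "\<forall>s. linear (g s) \<and> (\<forall>x\<in>B. g s x = (if x = L s then 1 else (0::real)))"
    by (rule choice[THEN exE])
  then have g: "\<And>s. linear (g s)" "\<And>s x. x \<in> B \<Longrightarrow> g s x = (if x = L s then 1 else (0::real))"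
    by auto
  \<comment> \<open>The \<open>g s\<close> with \<open>s\<close> in \<open>J\<close> are the
    coordinate functionals of the basis, extended to the whole space; thus \<open>\<rho>\<close> is
    a projection onto its span.\<close>
  define \<rho> where "\<rho> t = (\<Sum>s\<in>J. g s t *\<^sub>R L s)" for t
  \<comment> \<open>\<open>adjoint (g s) 1\<close> is the Riesz vector of \<open>g s\<close>, so
    \<open>t \<bullet> \<Gamma> \<omega>\<close> combines the values \<open>Y s \<omega>\<close>
    with the coordinates of \<open>\<rho> t\<close>.\<close>
  define \<Gamma> where "\<Gamma> \<omega> = (\<Sum>s\<in>J. Y s \<omega> *\<^sub>R adjoint (g s) 1)" for \<omega>
  have lin: "linear \<rho>"
    unfolding \<rho>_def using g(1) by (intro linear_compose_sum ballI) (auto simp: linear_iff scaleR_add_left)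
  have \<rho>L: "\<rho> (L s) = L s" if s: "s \<in> I" for s
  proof -
    have "\<rho> b = b" if b: "b \<in> B" for b
    proof -
      obtain r where r: "r \<in> J" "b = L r" using b J by auto
      have "g s b = (if s = r then 1 else 0)" if "s \<in> J" for s
        using g(2)[OF b, of s] r that J(2) by (auto simp: inj_on_def)
      then have "\<rho> b = (\<Sum>s\<in>J. (if s = r then 1 else 0) *\<^sub>R L s)" unfolding \<rho>_def by (intro sum.cong) auto
      also have "\<dots> = (\<Sum>s\<in>J. if s = r then L s else 0)" by (intro sum.cong) auto
      also have "\<dots> = b" using r fJ by simp
      finally show ?thesis .
    qed
    moreover have "L s \<in> span B" using B(3) s by auto
    ultimately show ?thesis using linear_eq_on[OF lin linear_id[unfolded id_def], of "L s" B] by auto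
  qed
  have G: "t \<bullet> \<Gamma> \<omega> = (\<Sum>s\<in>J. g s t * Y s \<omega>)" for t \<omega>
    using adjoint_works[OF g(1)] by (simp add: \<Gamma>_def inner_sum_right mult.commute)
  have Gm: "\<Gamma> \<in> borel_measurable P"
    unfolding \<Gamma>_def using J by (intro borel_measurable_sum borel_measurable_scaleR Ym borel_measurable_const) auto
  have sqG: "square_integrable P (\<lambda>\<omega>. t \<bullet> \<Gamma> \<omega>)" for t
    unfolding G using sq J by (intro square_integrable_sum square_integrable_cmult) auto
  have crossG: "expectation (\<lambda>\<omega>. Y s \<omega> * (t \<bullet> \<Gamma> \<omega>)) = q (L s) (\<rho> t)" if s: "s \<in> I" for s t
  proof -
    interpret linear "q (L s)" using bilinear by (simp add: bilinear_def)
    have i: "integrable P (\<lambda>\<omega>. Y s \<omega> * Y r \<omega>)" if "r \<in> J" for r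
      using square_integrable_times[OF sq[OF s] sq] that J by auto
    have "expectation (\<lambda>\<omega>. Y s \<omega> * (t \<bullet> \<Gamma> \<omega>)) = expectation (\<lambda>\<omega>. \<Sum>r\<in>J. g r t * (Y s \<omega> * Y r \<omega>))"
      by (simp add: G sum_distrib_left mult.left_commute)
    also have "\<dots> = (\<Sum>r\<in>J. g r t * q (L s) (L r))"
      using i cov[OF s] J by (subst Bochner_Integration.integral_sum) (auto intro!: sum.cong)
    also have "\<dots> = q (L s) (\<rho> t)" by (simp add: \<rho>_def sum scaleR)
    finally show ?thesis .
  qed
  have varG: "expectation (\<lambda>\<omega>. (t \<bullet> \<Gamma> \<omega>)\<^sup>2) = q (\<rho> t) (\<rho> t)" for t
  proof -
    interpret linear "\<lambda>u. q u (\<rho> t)" using bilinear by (simp add: bilinear_def)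
    have i: "integrable P (\<lambda>\<omega>. Y r \<omega> * (t \<bullet> \<Gamma> \<omega>))" if "r \<in> J" for r
      using square_integrable_times[OF sq sqG] that J by auto
    have "expectation (\<lambda>\<omega>. (t \<bullet> \<Gamma> \<omega>)\<^sup>2) = expectation (\<lambda>\<omega>. (\<Sum>r\<in>J. g r t * Y r \<omega>) * (t \<bullet> \<Gamma> \<omega>))"
      by (simp add: G power2_eq_square)
    also have "\<dots> = expectation (\<lambda>\<omega>. \<Sum>r\<in>J. g r t * (Y r \<omega> * (t \<bullet> \<Gamma> \<omega>)))"
      by (simp add: sum_distrib_right mult.assoc)
    also have "\<dots> = (\<Sum>r\<in>J. g r t * q (L r) (\<rho> t))"
      using i crossG J by (subst Bochner_Integration.integral_sum) (auto intro!: sum.cong)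
    also have "\<dots> = q (\<rho> t) (\<rho> t)" by (subst (2) \<rho>_def) (simp add: sum scaleR)
    finally show ?thesis .
  qed
  have law: "distr P borel (\<lambda>\<omega>. t \<bullet> \<Gamma> \<omega>) = normal_law 0 (q (\<rho> t) (\<rho> t))" for t
  proof -
    obtain m v where v: "v \<ge> 0" "distr P borel (\<lambda>\<omega>. t \<bullet> \<Gamma> \<omega>) = normal_law m v"
      using lc[OF fJ J(1), of "\<lambda>s. g s t"] unfolding G by blast
    have "(\<lambda>\<omega>. t \<bullet> \<Gamma> \<omega>) \<in> borel_measurable P" using Gm by measurable
    note mom = normal_law_distr_moments[OF this v(2,1)]
    have "expectation (\<lambda>\<omega>. t \<bullet> \<Gamma> \<omega>) = (\<Sum>s\<in>J. g s t * expectation (Y s))"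
      unfolding G using square_integrable_integrable[OF sq] J by (subst Bochner_Integration.integral_sum) auto
    also have "\<dots> = 0" using mean J by (intro sum.neutral) auto
    finally have "m = 0" using mom(2) by simp
    moreover have "v = q (\<rho> t) (\<rho> t)" using mom(3) \<open>m = 0\<close> varG by simp
    ultimately show ?thesis using v by simp
  qed
  \<comment> \<open>All three second moments in the expanded square equal
    \<open>q (L s) (L s)\<close>, because \<open>\<rho>\<close> fixes \<open>L s\<close>; so the
    mean square difference vanishes.\<close>
  have AE1: "AE \<omega> in P. Y s \<omega> = L s \<bullet> \<Gamma> \<omega>" if s: "s \<in> I" for s
  proof -
    have i: "integrable P (\<lambda>\<omega>. (Y s \<omega>)\<^sup>2)" "integrable P (\<lambda>\<omega>. (L s \<bullet> \<Gamma> \<omega>)\<^sup>2)" "integrable P (\<lambda>\<omega>. Y s \<omega> * (L s \<bullet> \<Gamma> \<omega>))"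
      using sq[OF s] sqG square_integrable_times[OF sq[OF s] sqG] by (auto simp: square_integrable_def)
    have eq: "(\<lambda>\<omega>. (Y s \<omega> - L s \<bullet> \<Gamma> \<omega>)\<^sup>2) = (\<lambda>\<omega>. (Y s \<omega>)\<^sup>2 + (L s \<bullet> \<Gamma> \<omega>)\<^sup>2 - 2 * (Y s \<omega> * (L s \<bullet> \<Gamma> \<omega>)))"
      by (simp add: power2_diff mult.assoc)
    have "expectation (\<lambda>\<omega>. (Y s \<omega> - L s \<bullet> \<Gamma> \<omega>)\<^sup>2) = 0"
      unfolding eq using i cov[OF s s] varG[of "L s"] crossG[OF s, of "L s"] \<rho>L[OF s]
      by (simp add: power2_eq_square)
    moreover have "integrable P (\<lambda>\<omega>. (Y s \<omega> - L s \<bullet> \<Gamma> \<omega>)\<^sup>2)" unfolding eq using i by auto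
    ultimately show ?thesis using integral_nonneg_eq_0_iff_AE[of P "\<lambda>\<omega>. (Y s \<omega> - L s \<bullet> \<Gamma> \<omega>)\<^sup>2"] by auto
  qed
  \<comment> \<open>One null set for all \<open>s\<close>: equality holds simultaneously on a
    countable dense subset and extends by continuity of the paths and of \<open>L\<close>.\<close>
  obtain D where D: "countable D" "D \<subseteq> I" "I \<subseteq> closure D" by (rule separable)
  have "AE \<omega> in P. \<forall>s\<in>D. Y s \<omega> = L s \<bullet> \<Gamma> \<omega>"
    using AE1 D by (subst AE_ball_countable) auto
  then have "AE \<omega> in P. \<forall>s\<in>I. Y s \<omega> = L s \<bullet> \<Gamma> \<omega>"
    using AE_space
  proof eventually_elim
    case (elim \<omega>)
    show ?case
    proof
      fix s assume s: "s \<in> I"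
      then obtain x where x: "\<And>n. x n \<in> D" "x \<longlonglongrightarrow> s"
        using subsetD[OF D(3) s] unfolding closure_sequential by blast
      have xI: "\<forall>\<^sub>F n in sequentially. x n \<in> I" using x(1) D(2) by (intro always_eventually) auto
      have "(\<lambda>n. Y (x n) \<omega>) \<longlonglongrightarrow> Y s \<omega>"
        by (rule continuous_on_tendsto_compose[OF cts[OF elim(2)] x(2) s xI])
      moreover have "(\<lambda>n. L (x n) \<bullet> \<Gamma> \<omega>) \<longlonglongrightarrow> L s \<bullet> \<Gamma> \<omega>"
        by (intro tendsto_inner tendsto_const continuous_on_tendsto_compose[OF L x(2) s xI])
      ultimately show "Y s \<omega> = L s \<bullet> \<Gamma> \<omega>"
        using elim(1) x(1) LIMSEQ_unique by simp
    qed
  qed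
  with lin Gm \<rho>L law show ?thesis by blast
qed

section \<open>Stochastic order and the multivariate limit\<close>

definition bounded_in_prob :: "'a measure \<Rightarrow> (nat \<Rightarrow> 'a \<Rightarrow> real) \<Rightarrow> bool" where
  "bounded_in_prob M X \<longleftrightarrow>
     (\<forall>n. X n \<in> borel_measurable M) \<and>
     (\<forall>e>0. \<exists>K. \<forall>n. measure M {\<omega> \<in> space M. \<bar>X n \<omega>\<bar> > K} \<le> e)"

context prob_space
begin

abbreviation tail :: "('a \<Rightarrow> real) \<Rightarrow> real \<Rightarrow> real" where
  "tail X c \<equiv> prob {\<omega> \<in> space M. \<bar>X \<omega>\<bar> > c}"

lemma bounded_in_prob_mono_AE:
  assumes Y: "bounded_in_prob M Y" and X [measurable]: "\<And>n. X n \<in> borel_measurable M"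
    and le: "\<And>n. AE \<omega> in M. \<bar>X n \<omega>\<bar> \<le> \<bar>Y n \<omega>\<bar>"
  shows "bounded_in_prob M X"
  unfolding bounded_in_prob_def
proof safe
  fix e :: real assume "e > 0"
  then obtain K where K: "\<And>n. tail (Y n) K \<le> e"
    using Y unfolding bounded_in_prob_def by blast
  have [measurable]: "Y n \<in> borel_measurable M" for n using Y by (simp add: bounded_in_prob_def)
  have "tail (X n) K \<le> tail (Y n) K" for n
    using le[of n] by (intro finite_measure_mono_AE) auto
  then show "\<exists>K. \<forall>n. tail (X n) K \<le> e" using K order_trans by blast
qed (rule X)

lemma prob_abs_add_gt:
  fixes X Y :: "'a \<Rightarrow> real"
  assumes [measurable]: "X \<in> borel_measurable M" "Y \<in> borel_measurable M"
  shows "tail (\<lambda>\<omega>. X \<omega> + Y \<omega>) (a + b)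
    \<le> tail X a + tail Y b"
proof -
  have "tail (\<lambda>\<omega>. X \<omega> + Y \<omega>) (a + b)
    \<le> prob ({\<omega> \<in> space M. \<bar>X \<omega>\<bar> > a} \<union> {\<omega> \<in> space M. \<bar>Y \<omega>\<bar> > b})"
    by (intro finite_measure_mono) auto
  also have "\<dots> \<le> tail X a + tail Y b"
    by (intro measure_Un_le) auto
  finally show ?thesis .
qed

lemma bounded_in_prob_add:
  assumes X: "bounded_in_prob M X" and Y: "bounded_in_prob M Y"
  shows "bounded_in_prob M (\<lambda>n \<omega>. X n \<omega> + Y n \<omega>)"
proof -
  have [measurable]: "X n \<in> borel_measurable M" "Y n \<in> borel_measurable M" for n
    using X Y by (auto simp: bounded_in_prob_def)
  have "\<exists>K. \<forall>n. tail (\<lambda>\<omega>. X n \<omega> + Y n \<omega>) K \<le> e" if "e > 0" for e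
  proof -
    have e2: "e / 2 > 0" using that by simp
    obtain K where K: "\<And>n. tail (X n) K \<le> e / 2"
      using X e2 unfolding bounded_in_prob_def by blast
    obtain L where L: "\<And>n. tail (Y n) L \<le> e / 2"
      using Y e2 unfolding bounded_in_prob_def by blast
    have "tail (\<lambda>\<omega>. X n \<omega> + Y n \<omega>) (K + L) \<le> e" for n
      using prob_abs_add_gt[of "X n" "Y n" K L] K[of n] L[of n] by simp
    then show ?thesis by blast
  qed
  then show ?thesis by (simp add: bounded_in_prob_def)
qed

lemma bounded_in_prob_0: "bounded_in_prob M (\<lambda>n \<omega>. 0)"
  by (auto simp: bounded_in_prob_def intro!: exI[of _ 0])

lemma bounded_in_prob_sum:
  "(\<And>i. i \<in> A \<Longrightarrow> bounded_in_prob M (X i)) \<Longrightarrow> bounded_in_prob M (\<lambda>n \<omega>. \<Sum>i\<in>A. X i n \<omega>)"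
proof (induction A rule: infinite_finite_induct)
  case (insert i A)
  then have "bounded_in_prob M (\<lambda>n \<omega>. X i n \<omega> + (\<Sum>i\<in>A. X i n \<omega>))"
    by (intro bounded_in_prob_add) auto
  then show ?case using insert by simp
qed (simp_all add: bounded_in_prob_0)

lemma bounded_in_prob_abs:
  assumes "bounded_in_prob M X"
  shows "bounded_in_prob M (\<lambda>n \<omega>. \<bar>X n \<omega>\<bar>)"
proof -
  have [measurable]: "X n \<in> borel_measurable M" for n
    using assms by (simp add: bounded_in_prob_def)
  have "(\<lambda>\<omega>. \<bar>X n \<omega>\<bar>) \<in> borel_measurable M" for n by measurable
  with assms show ?thesis by (simp add: bounded_in_prob_def)
qed

lemma bounded_in_prob_cmult:
  assumes X: "bounded_in_prob M X"
  shows "bounded_in_prob M (\<lambda>n \<omega>. c * X n \<omega>)"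
proof (cases "c = 0")
  case False
  have [measurable]: "X n \<in> borel_measurable M" for n
    using X by (auto simp: bounded_in_prob_def)
  have "\<exists>K. \<forall>n. tail (\<lambda>\<omega>. c * X n \<omega>) K \<le> e" if e: "e > 0" for e
  proof -
    obtain K where K: "\<And>n. tail (X n) K \<le> e"
      using X e unfolding bounded_in_prob_def by blast
    have "{\<omega> \<in> space M. \<bar>c * X n \<omega>\<bar> > \<bar>c\<bar> * K} = {\<omega> \<in> space M. \<bar>X n \<omega>\<bar> > K}" for n
      using False by (auto simp: abs_mult)
    then show ?thesis using K by (intro exI[of _ "\<bar>c\<bar> * K"]) simp
  qed
  then show ?thesis by (simp add: bounded_in_prob_def)
qed (simp add: bounded_in_prob_0)

lemma tendsto_0_in_prob_mono:
  assumes Y: "tendsto_0_in_prob M Y" and X [measurable]: "\<And>n. X n \<in> borel_measurable M"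
    and le: "\<And>n \<omega>. \<omega> \<in> space M \<Longrightarrow> \<bar>X n \<omega>\<bar> \<le> \<bar>Y n \<omega>\<bar>"
  shows "tendsto_0_in_prob M X"
  unfolding tendsto_0_in_prob_def
proof safe
  fix e :: real assume "e > 0"
  have [measurable]: "Y n \<in> borel_measurable M" for n using Y by (simp add: tendsto_0_in_prob_def)
  have "tail (X n) e \<le> tail (Y n) e" for n
    using le by (intro finite_measure_mono) (auto intro: less_le_trans)
  then have "\<forall>n. tail (X n) e \<le> tail (Y n) e" by blast
  moreover have "(\<lambda>n. tail (Y n) e) \<longlonglongrightarrow> 0"
    using Y \<open>e > 0\<close> by (simp add: tendsto_0_in_prob_def)
  ultimately show "(\<lambda>n. tail (X n) e) \<longlonglongrightarrow> 0"
    by (intro tendsto_sandwich[OF always_eventually[OF allI[OF measure_nonneg]] always_eventually tendsto_const])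
qed (rule X)

lemma tendsto_0_in_prob_add:
  assumes X: "tendsto_0_in_prob M X" and Y: "tendsto_0_in_prob M Y"
  shows "tendsto_0_in_prob M (\<lambda>n \<omega>. X n \<omega> + Y n \<omega>)"
proof -
  have [measurable]: "X n \<in> borel_measurable M" "Y n \<in> borel_measurable M" for n
    using X Y by (auto simp: tendsto_0_in_prob_def)
  have "(\<lambda>n. tail (\<lambda>\<omega>. X n \<omega> + Y n \<omega>) e) \<longlonglongrightarrow> 0" if e: "e > 0" for e
  proof (rule tendsto_sandwich[OF _ _ tendsto_const])
    have "(\<lambda>n. tail (X n) (e / 2) + tail (Y n) (e / 2)) \<longlonglongrightarrow> 0 + 0"
      using X Y half_gt_zero[OF e] unfolding tendsto_0_in_prob_def by (intro tendsto_add) blast+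
    then show "(\<lambda>n. tail (X n) (e / 2) + tail (Y n) (e / 2)) \<longlonglongrightarrow> 0"
      by simp
    show "\<forall>\<^sub>F n in sequentially. tail (\<lambda>\<omega>. X n \<omega> + Y n \<omega>) e
      \<le> tail (X n) (e / 2) + tail (Y n) (e / 2)"
    proof (intro always_eventually allI)
      fix n
      show "tail (\<lambda>\<omega>. X n \<omega> + Y n \<omega>) e
        \<le> tail (X n) (e / 2) + tail (Y n) (e / 2)"
        using prob_abs_add_gt[of "X n" "Y n" "e / 2" "e / 2"] by (simp only: field_sum_of_halves) simp
    qed
  qed (auto intro!: always_eventually)
  then show ?thesis by (simp add: tendsto_0_in_prob_def)
qed

lemma tendsto_0_in_prob_sum:
  "(\<And>i. i \<in> A \<Longrightarrow> tendsto_0_in_prob M (X i)) \<Longrightarrow> tendsto_0_in_prob M (\<lambda>n \<omega>. \<Sum>i\<in>A. X i n \<omega>)"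
proof (induction A rule: infinite_finite_induct)
  case (insert i A)
  then have "tendsto_0_in_prob M (\<lambda>n \<omega>. X i n \<omega> + (\<Sum>i\<in>A. X i n \<omega>))"
    by (intro tendsto_0_in_prob_add) auto
  then show ?case using insert by simp
qed (simp_all add: tendsto_0_in_prob_def)

text \<open>Off an event of small probability \<open>H N\<close> stays in a ball, where
  \<open>support_fun_directional\<close> applies with step \<open>1 / sqrt N\<close>; the factor
  \<open>sqrt N\<close> then leaves the bound \<open>\<eta>\<close>. The argmax set stays the one at
  \<open>x\<close> while the argument moves.\<close>

lemma support_fun_delta_method:
  fixes W :: "'e::euclidean_space set" and H :: "nat \<Rightarrow> 'a \<Rightarrow> 'e"
  assumes W: "compact_nonempty W" and H [measurable]: "\<And>N. H N \<in> borel_measurable M"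
    and bounded: "bounded_in_prob M (\<lambda>N \<omega>. norm (H N \<omega>))"
  shows "tendsto_0_in_prob M (\<lambda>N \<omega>. sqrt (real N) *
    (support_fun W (x + (1 / sqrt (real N)) *\<^sub>R H N \<omega>) - support_fun (argmax_set W x) (x + (1 / sqrt (real N)) *\<^sub>R H N \<omega>)))"
    (is "tendsto_0_in_prob M ?D")
proof -
  interpret W: compact_nonempty W by fact
  interpret A: compact_nonempty "argmax_set W x" by (rule W.compact_nonempty_argmax)
  have [measurable]: "support_fun W \<in> borel_measurable borel" "support_fun (argmax_set W x) \<in> borel_measurable borel"
    by (intro borel_measurable_continuous_onI W.continuous_on_support_fun A.continuous_on_support_fun)+
  have D0: "0 \<le> ?D N \<omega>" for N \<omega>
  proof -
    have "support_fun (argmax_set W x) y \<le> support_fun W y" for y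
      by (rule A.support_fun_le) (auto simp: argmax_set_def intro: W.inner_le_support_fun)
    then show ?thesis by simp
  qed
  have meas: "?D N \<in> borel_measurable M" for N by measurable
  show ?thesis
    unfolding tendsto_0_in_prob_def
  proof safe
    fix \<eta> :: real assume \<eta>: "\<eta> > 0"
    show "(\<lambda>N. tail (?D N) \<eta>) \<longlonglongrightarrow> 0"
    proof (rule order_tendstoI)
      fix e :: real assume e: "e > 0"
      then have "e / 2 > 0" by simp
      then obtain K where K: "\<And>N. tail (\<lambda>\<omega>. norm (H N \<omega>)) K \<le> e / 2"
        using bounded unfolding bounded_in_prob_def by blast
      obtain \<rho> where \<rho>: "\<rho> > 0" "\<And>t h. 0 < t \<Longrightarrow> t < \<rho> \<Longrightarrow> norm h \<le> max K 0 \<Longrightarrow>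
        support_fun W (x + t *\<^sub>R h) - support_fun (argmax_set W x) (x + t *\<^sub>R h) \<le> t * \<eta>"
        using W.support_fun_directional[OF \<eta>, of "max K 0" x] by auto
      have "(\<lambda>N. 1 / sqrt (real N)) \<longlonglongrightarrow> 0"
        by (intro tendsto_divide_0[OF tendsto_const] filterlim_at_top_imp_at_infinity
            filterlim_compose[OF sqrt_at_top filterlim_real_sequentially])
      then have "\<forall>\<^sub>F N in sequentially. 1 / sqrt (real N) < \<rho>" using \<rho>(1) by (rule order_tendstoD)
      then show "\<forall>\<^sub>F N in sequentially. tail (?D N) \<eta> < e"
        using eventually_gt_at_top[of 0]
      proof eventually_elim
        case (elim N)
        have "\<bar>?D N \<omega>\<bar> \<le> \<eta>" if "norm (H N \<omega>) \<le> K" for \<omega>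
        proof -
          have s: "sqrt (real N) > 0" using elim by simp
          have "?D N \<omega> \<le> sqrt (real N) * (1 / sqrt (real N) * \<eta>)"
            using \<rho>(2)[of "1 / sqrt (real N)" "H N \<omega>"] elim that s by (intro mult_left_mono) auto
          also have "\<dots> = \<eta>" using s by simp
          finally show ?thesis using D0[of N \<omega>] by simp
        qed
        then have "{\<omega> \<in> space M. \<bar>?D N \<omega>\<bar> > \<eta>} \<subseteq> {\<omega> \<in> space M. \<bar>norm (H N \<omega>)\<bar> > K}"
          by (auto simp: not_le[symmetric])
        then have "tail (?D N) \<eta> \<le> tail (\<lambda>\<omega>. norm (H N \<omega>)) K"
          by (intro finite_measure_mono) auto
        also have "\<dots> < e" using K[of N] e by simp
        finally show ?case .
      qed
    qed (auto intro!: always_eventually less_le_trans[OF _ measure_nonneg])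
  qed (rule meas)
qed

end

context iid_sample
begin

lemma bounded_in_prob_centered_mean:
  assumes f: "square_integrable \<mu> f"
  shows "bounded_in_prob M (\<lambda>N. centered_mean N f)"
  unfolding bounded_in_prob_def
proof safe
  show "centered_mean N f \<in> borel_measurable M" for N
    by (rule centered_mean_measurable[OF square_integrable_borel[OF f]])
  then have [measurable]: "centered_mean N f \<in> borel_measurable M" for N .
  fix e :: real assume e: "e > 0"
  define K where "K = sqrt ((var \<mu> f + 1) / e)"
  have v: "var \<mu> f + 1 > 0" using var_nonneg[of \<mu> f] by linarith
  have K: "K > 0" using v e by (simp add: K_def)
  have "K\<^sup>2 = (var \<mu> f + 1) / e" using v e by (simp add: K_def)
  then have "var \<mu> f / K\<^sup>2 = var \<mu> f / (var \<mu> f + 1) * e" using v e by simp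
  also have "\<dots> \<le> 1 * e" using v e by (intro mult_right_mono) auto
  finally have *: "var \<mu> f / K\<^sup>2 \<le> e" by simp
  have "tail (centered_mean N f) K \<le> e" for N
  proof -
    have "tail (centered_mean N f) K \<le> prob {\<omega> \<in> space M. \<bar>centered_mean N f \<omega>\<bar> \<ge> K}"
      by (intro finite_measure_mono) auto
    also have "\<dots> \<le> e" using prob_centered_mean_ge[OF f K, of N] * by (rule order_trans)
    finally show ?thesis .
  qed
  then show "\<exists>K. \<forall>N. tail (centered_mean N f) K \<le> e" by blast
qed

end

section \<open>Vector-valued sample means and the sup-inf of their linear images\<close>

locale iid_vector = iid_sample M Z \<mu> for M :: "'a measure" and Z :: "nat \<Rightarrow> 'a \<Rightarrow> real" and \<mu> :: "real measure" +
  fixes X :: "real \<Rightarrow> 'e::euclidean_space"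
  assumes square_integrable_component: "\<And>b. b \<in> Basis \<Longrightarrow> square_integrable \<mu> (\<lambda>z. b \<bullet> X z)"
begin

lemma inner_X: "v \<bullet> X z = (\<Sum>b\<in>Basis. (v \<bullet> b) * (b \<bullet> X z))"
  by (subst euclidean_inner[of v]) (simp add: inner_commute)

lemma square_integrable_inner: "square_integrable \<mu> (\<lambda>z. v \<bullet> X z)"
  by (subst inner_X) (intro \<mu>.square_integrable_sum \<mu>.square_integrable_cmult square_integrable_component)

lemma integrable_inner: "integrable \<mu> (\<lambda>z. v \<bullet> X z)"
  by (rule \<mu>.square_integrable_integrable[OF square_integrable_inner])

definition G :: "nat \<Rightarrow> 'a \<Rightarrow> 'e" where
  "G N \<omega> = (\<Sum>b\<in>Basis. centered_mean N (\<lambda>z. b \<bullet> X z) \<omega> *\<^sub>R b)"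

text \<open>By linearity of the empirical process each projection of the vector is a scalar centered
  mean, and so falls under the one-dimensional central limit theorem.\<close>

lemma inner_G: "v \<bullet> G N \<omega> = centered_mean N (\<lambda>z. v \<bullet> X z) \<omega>"
proof -
  have "centered_mean N (\<lambda>z. v \<bullet> X z) \<omega> = centered_mean N (\<lambda>z. \<Sum>b\<in>Basis. (v \<bullet> b) * (b \<bullet> X z)) \<omega>"
    by (rule arg_cong[where f="\<lambda>f. centered_mean N f \<omega>"]) (rule ext, rule inner_X)
  also have "\<dots> = (\<Sum>b\<in>Basis. (v \<bullet> b) * centered_mean N (\<lambda>z. b \<bullet> X z) \<omega>)"
    using integrable_inner by (subst centered_mean_sum) (auto simp: centered_mean_cmult)
  also have "\<dots> = v \<bullet> G N \<omega>" by (simp add: G_def inner_sum_right mult.commute)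
  finally show ?thesis by simp
qed

lemma G_measurable [measurable]: "G N \<in> borel_measurable M"
  unfolding G_def
  by (intro borel_measurable_sum borel_measurable_scaleR borel_measurable_const
      centered_mean_measurable square_integrable_borel square_integrable_inner)

definition q :: "'e \<Rightarrow> 'e \<Rightarrow> real" where
  "q u v = (\<integral>z. (u \<bullet> X z - (\<integral>z. u \<bullet> X z \<partial>\<mu>)) * (v \<bullet> X z - (\<integral>z. v \<bullet> X z \<partial>\<mu>)) \<partial>\<mu>)"

lemma q_self: "q v v = var \<mu> (\<lambda>z. v \<bullet> X z)"
  by (simp add: q_def var_def power2_eq_square)

lemma integrable_q:
  "integrable \<mu> (\<lambda>z. (u \<bullet> X z - (\<integral>z. u \<bullet> X z \<partial>\<mu>)) * (v \<bullet> X z - (\<integral>z. v \<bullet> X z \<partial>\<mu>)))"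
  by (intro \<mu>.square_integrable_times \<mu>.square_integrable_diff square_integrable_inner \<mu>.square_integrable_const)

sublocale psd_form q
proof
  have 1: "q (u + u') v = q u v + q u' v" for u u' v
  proof -
    have "(u + u') \<bullet> X z - (\<integral>z. (u + u') \<bullet> X z \<partial>\<mu>) = (u \<bullet> X z - (\<integral>z. u \<bullet> X z \<partial>\<mu>)) + (u' \<bullet> X z - (\<integral>z. u' \<bullet> X z \<partial>\<mu>))" for z
      using integrable_inner by (simp add: inner_add_left)
    then show ?thesis unfolding q_def using integrable_q by (simp only: distrib_right Bochner_Integration.integral_add)
  qed
  have 2: "q (c *\<^sub>R u) v = c * q u v" for c u v
  proof -
    have "(c *\<^sub>R u) \<bullet> X z - (\<integral>z. (c *\<^sub>R u) \<bullet> X z \<partial>\<mu>) = c * (u \<bullet> X z - (\<integral>z. u \<bullet> X z \<partial>\<mu>))" for z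
      by (simp add: right_diff_distrib)
    then show ?thesis unfolding q_def by (simp only: mult.assoc integral_mult_right_zero)
  qed
  show s: "q u v = q v u" for u v by (simp add: q_def mult.commute)
  show "bilinear q"
    unfolding bilinear_def linear_iff using 1 2 s by (metis real_scaleR_def)
  show "0 \<le> q u u" for u unfolding q_self by (rule var_nonneg)
qed

lemma clt_inner: "weak_conv_m (\<lambda>N. distr M borel (\<lambda>\<omega>. v \<bullet> G N \<omega>)) (normal_law 0 (q v v))"
  using centered_mean_clt[OF square_integrable_inner[of v]] by (simp add: inner_G q_self)

text \<open>For compact \<open>A\<close> and \<open>B\<close> the sup-inf of
  \<open>L (w, \<tau>) \<bullet> g\<close> is a continuous function \<open>h\<close> of
  \<open>g\<close>, and the factorization of \<open>Y\<close> turns its sup-inf into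
  \<open>h\<close> of a Gaussian vector; the continuous image of the converging vectors is then the
  claim.\<close>

theorem weak_conv_sup_inf:
  fixes L :: "'s::euclidean_space \<times> 't::euclidean_space \<Rightarrow> 'e"
  assumes A: "compact A" "A \<noteq> {}" and B: "compact B" "B \<noteq> {}" and L: "continuous_on (A \<times> B) L"
    and Y: "continuous_centered_gaussian_process P (A \<times> B) K Y"
    and K: "\<And>s t. s \<in> A \<times> B \<Longrightarrow> t \<in> A \<times> B \<Longrightarrow> K s t = q (L s) (L t)"
  shows "weak_conv_m (\<lambda>N. distr M borel (\<lambda>\<omega>. SUP w\<in>A. INF \<tau>\<in>B. L (w, \<tau>) \<bullet> G N \<omega>))
    (distr P borel (\<lambda>\<omega>. SUP w\<in>A. INF \<tau>\<in>B. Y (w, \<tau>) \<omega>))"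
    and "(\<lambda>\<omega>. SUP w\<in>A. INF \<tau>\<in>B. Y (w, \<tau>) \<omega>) \<in> borel_measurable P"
    and "(\<lambda>\<omega>. SUP w\<in>A. INF \<tau>\<in>B. L (w, \<tau>) \<bullet> G N \<omega>) \<in> borel_measurable M"
proof -
  obtain \<Gamma> \<rho> where \<rho>: "linear \<rho>" "\<And>s. s \<in> A \<times> B \<Longrightarrow> \<rho> (L s) = L s"
    and \<Gamma> [measurable]: "\<Gamma> \<in> borel_measurable P"
    and law: "\<And>t. distr P borel (\<lambda>\<omega>. t \<bullet> \<Gamma> \<omega>) = normal_law 0 (q (\<rho> t) (\<rho> t))"
    and AE: "AE \<omega> in P. \<forall>s\<in>A \<times> B. Y s \<omega> = L s \<bullet> \<Gamma> \<omega>"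
    using gaussian_process_factorization[OF Y K L] by blast
  have P: "prob_space P" and Ym: "\<And>t. t \<in> A \<times> B \<Longrightarrow> Y t \<in> borel_measurable P"
    and Yc: "\<And>\<omega>. \<omega> \<in> space P \<Longrightarrow> continuous_on (A \<times> B) (\<lambda>t. Y t \<omega>)"
    using Y by (auto simp: continuous_centered_gaussian_process_def gaussian_process_def)
  define h where "h g = (SUP w\<in>A. INF \<tau>\<in>B. L (w, \<tau>) \<bullet> g)" for g
  have h: "continuous_on UNIV h"
  proof -
    have 1: "continuous_on ((UNIV \<times> A) \<times> B) (\<lambda>x. L (snd (fst x), snd x) \<bullet> fst (fst x))"
      by (intro continuous_intros continuous_on_compose2[OF L]) auto
    have "continuous_on (UNIV \<times> A) (\<lambda>x. INF \<tau>\<in>B. L (snd x, \<tau>) \<bullet> fst x)"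
      using continuous_on_INF_compact[OF 1 B] by simp
    from continuous_on_SUP_compact[OF this A] show ?thesis by (simp add: h_def[abs_def])
  qed
  then have hm [measurable]: "h \<in> borel_measurable borel" by (rule borel_measurable_continuous_onI)
  show "(\<lambda>\<omega>. SUP w\<in>A. INF \<tau>\<in>B. L (w, \<tau>) \<bullet> G N \<omega>) \<in> borel_measurable M" for N
    unfolding h_def[symmetric] by measurable
  have adj: "t \<bullet> adjoint \<rho> g = \<rho> t \<bullet> g" for t g by (rule adjoint_works[OF \<rho>(1)])
  have adj_lin: "linear (adjoint \<rho>)" by (rule adjoint_linear[OF \<rho>(1)])
  have [measurable]: "adjoint \<rho> \<in> borel_measurable borel"
    by (intro borel_measurable_continuous_onI linear_continuous_on linear_linear[THEN iffD2] adj_lin)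
  \<comment> \<open>The variance of \<open>t \<bullet> \<Gamma>\<close> belongs to
    \<open>\<rho> t\<close>, not to \<open>t\<close>, so \<open>G N\<close> matches
    \<open>\<Gamma>\<close> only after \<open>adjoint \<rho>\<close>. This leaves \<open>h\<close>
    unchanged, because \<open>\<rho>\<close> fixes every \<open>L s\<close>.\<close>
  interpret wc: weak_convergence_of_projections M P "\<lambda>N \<omega>. adjoint \<rho> (G N \<omega>)" \<Gamma>
  proof (intro weak_convergence_of_projections.intro weak_convergence_of_projections_axioms.intro P)
    show "prob_space M" by (rule prob_space_axioms)
    show "weak_conv_m (\<lambda>N. distr M borel (\<lambda>\<omega>. t \<bullet> adjoint \<rho> (G N \<omega>))) (distr P borel (\<lambda>\<omega>. t \<bullet> \<Gamma> \<omega>))" for t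
      using clt_inner[of "\<rho> t"] by (simp add: adj law)
  qed measurable
  have "h (adjoint \<rho> g) = h g" for g
    unfolding h_def adj using \<rho>(2) by simp
  then have conv: "weak_conv_m (\<lambda>N. distr M borel (\<lambda>\<omega>. h (G N \<omega>))) (distr P borel (\<lambda>\<omega>. h (\<Gamma> \<omega>)))"
    using wc.continuous_image[OF h] by simp
  have Yw: "continuous_on B (\<lambda>\<tau>. Y (w, \<tau>) \<omega>)" if "w \<in> A" "\<omega> \<in> space P" for w \<omega>
    by (rule continuous_on_compose2[OF Yc[OF that(2)]]) (use that(1) in \<open>auto intro!: continuous_intros\<close>)
  have I: "(\<lambda>\<omega>. INF \<tau>\<in>B. Y (w, \<tau>) \<omega>) \<in> borel_measurable P" if w: "w \<in> A" for w
    by (rule borel_measurable_INF_continuous[OF B(2) Yw[OF w]])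
      (use w in \<open>auto intro!: Ym bounded_imp_bdd_below compact_imp_bounded compact_continuous_image Yw B\<close>)
  have J: "continuous_on A (\<lambda>w. INF \<tau>\<in>B. Y (w, \<tau>) \<omega>)" if "\<omega> \<in> space P" for \<omega>
    using continuous_on_INF_compact[OF Yc[OF that] B] .
  show Sm: "(\<lambda>\<omega>. SUP w\<in>A. INF \<tau>\<in>B. Y (w, \<tau>) \<omega>) \<in> borel_measurable P"
    by (rule borel_measurable_SUP_continuous[OF A(2) J _ I])
      (auto intro!: bounded_imp_bdd_above compact_imp_bounded compact_continuous_image J A)
  have "AE \<omega> in P. h (\<Gamma> \<omega>) = (SUP w\<in>A. INF \<tau>\<in>B. Y (w, \<tau>) \<omega>)"
    using AE by eventually_elim (simp add: h_def)
  then have "distr P borel (\<lambda>\<omega>. h (\<Gamma> \<omega>)) = distr P borel (\<lambda>\<omega>. SUP w\<in>A. INF \<tau>\<in>B. Y (w, \<tau>) \<omega>)"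
    using Sm by (intro distr_cong_AE) auto
  with conv show "weak_conv_m (\<lambda>N. distr M borel (\<lambda>\<omega>. SUP w\<in>A. INF \<tau>\<in>B. L (w, \<tau>) \<bullet> G N \<omega>))
    (distr P borel (\<lambda>\<omega>. SUP w\<in>A. INF \<tau>\<in>B. Y (w, \<tau>) \<omega>))" by (simp add: h_def)
qed

end

section \<open>The risk measure\<close>

context iid_level
begin

lemma scaled_sample_RU:
  assumes N: "N > 0"
  shows "sqrt (real N) * (sRU N \<omega> t - RU t)
    = 1 / (1 - \<alpha>) * centered_mean N (\<lambda>z. max (z - t) 0) \<omega>"
proof -
  define S m where "S = (\<Sum>j<N. max (Z j \<omega> - t) 0)" and "m = (\<integral>z. max (z - t) 0 \<partial>\<mu>)"
  have "sRU N \<omega> t - RU t = 1 / (1 - \<alpha>) * (S / real N - m)"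
    by (simp add: sample_RU_def RU_def S_def m_def right_diff_distrib mult.commute)
  then show ?thesis by (simp add: centered_mean_def S_def m_def)
qed

lemma AE_pos_part_split:
  "AE z in \<mu>. \<forall>t\<in>quantiles C \<alpha>. max (z - t) 0 = max (z - rq) 0 + (rq - t) * indicator {rq..} z"
  using AE_not_between_quantiles by eventually_elim (auto simp: quantiles_eq indicator_def max_def)

lemma AE_sample:
  assumes "AE z in \<mu>. P z"
  shows "AE \<omega> in M. \<forall>j. P (Z j \<omega>)"
proof -
  have "AE \<omega> in M. P (Z j \<omega>)" for j
    using assms unfolding law[of j, symmetric] by (rule AE_distrD[rotated]) simp
  then show ?thesis by (simp add: AE_all_countable)
qed

text \<open>A single null set serves all \<open>N\<close> and all \<open>t\<close>, so infima over
  \<open>t\<close> can be taken pathwise; the dependence on \<open>t\<close> is reduced to the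
  factor \<open>rq - t\<close> of one random variable.\<close>

lemma AE_centered_mean_split:
  "AE \<omega> in M. \<forall>N. \<forall>t\<in>quantiles C \<alpha>. centered_mean N (\<lambda>z. max (z - t) 0) \<omega>
    = centered_mean N (\<lambda>z. max (z - rq) 0) \<omega> + (rq - t) * centered_mean N (indicator {rq..}) \<omega>"
  using AE_sample[OF AE_pos_part_split]
proof eventually_elim
  case (elim \<omega>)
  have i: "integrable \<mu> (indicator {rq..} :: real \<Rightarrow> real)"
    by (rule \<mu>.square_integrable_integrable[OF square_integrable_indicator]) simp
  show ?case
  proof safe
    fix N t assume t: "t \<in> quantiles C \<alpha>"
    have "AE z in \<mu>. max (z - t) 0 = max (z - rq) 0 + (rq - t) * indicator {rq..} z"
      using AE_pos_part_split by eventually_elim (use t in blast)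
    then have "(\<integral>z. max (z - t) 0 \<partial>\<mu>) = (\<integral>z. max (z - rq) 0 + (rq - t) * indicator {rq..} z \<partial>\<mu>)"
      by (intro integral_cong_AE) auto
    moreover have "max (Z j \<omega> - t) 0 = max (Z j \<omega> - rq) 0 + (rq - t) * indicator {rq..} (Z j \<omega>)" for j
      using elim t by blast
    ultimately have "centered_mean N (\<lambda>z. max (z - t) 0) \<omega>
      = centered_mean N (\<lambda>z. max (z - rq) 0 + (rq - t) * indicator {rq..} z) \<omega>"
      by (simp add: centered_mean_def)
    also have "\<dots> = centered_mean N (\<lambda>z. max (z - rq) 0) \<omega> + (rq - t) * centered_mean N (indicator {rq..}) \<omega>"
      using i integrable_pos_part by (simp add: centered_mean_add centered_mean_cmult)
    finally show "centered_mean N (\<lambda>z. max (z - t) 0) \<omega>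
      = centered_mean N (\<lambda>z. max (z - rq) 0) \<omega> + (rq - t) * centered_mean N (indicator {rq..}) \<omega>" .
  qed
qed

text \<open>On the interval \<open>rq - t\<close> is at most \<open>rq - lq\<close>, so the scaled
  deviations at all \<open>t\<close> share one bound made of two scalar centered means. Comparing
  their infimum with that of the constant 0 passes the bound on.\<close>

lemma bounded_in_prob_INF_sample_RU:
  "bounded_in_prob M (\<lambda>N \<omega>. sqrt (real N) *
     ((INF t\<in>quantiles C \<alpha>. sRU N \<omega> t) - AVaR \<alpha> C))"
proof (rule bounded_in_prob_mono_AE)
  let ?f = "\<lambda>z. max (z - rq) 0" and ?g = "indicator {rq..} :: real \<Rightarrow> real"
  show "bounded_in_prob M (\<lambda>N \<omega>. 1 / (1 - \<alpha>) * (\<bar>centered_mean N ?f \<omega>\<bar> + (rq - lq) * \<bar>centered_mean N ?g \<omega>\<bar>))"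
    by (intro bounded_in_prob_cmult bounded_in_prob_add bounded_in_prob_abs bounded_in_prob_centered_mean
        square_integrable_pos_part square_integrable_indicator) simp
  show "AE \<omega> in M. \<bar>sqrt (real N) * ((INF t\<in>quantiles C \<alpha>. sRU N \<omega> t) - AVaR \<alpha> C)\<bar>
    \<le> \<bar>1 / (1 - \<alpha>) * (\<bar>centered_mean N ?f \<omega>\<bar> + (rq - lq) * \<bar>centered_mean N ?g \<omega>\<bar>)\<bar>" for N
    using AE_centered_mean_split
  proof eventually_elim
    case (elim \<omega>)
    show ?case
    proof (cases "N = 0")
      case False
      then have N: "N > 0" by simp
      let ?b = "1 / (1 - \<alpha>) * (\<bar>centered_mean N ?f \<omega>\<bar> + (rq - lq) * \<bar>centered_mean N ?g \<omega>\<bar>)"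
      have le: "\<bar>sqrt (real N) * (sRU N \<omega> t - AVaR \<alpha> C) - 0\<bar> \<le> ?b"
        if t: "t \<in> quantiles C \<alpha>" for t
      proof -
        have "\<bar>centered_mean N (\<lambda>z. max (z - t) 0) \<omega>\<bar>
          \<le> \<bar>centered_mean N ?f \<omega>\<bar> + \<bar>(rq - t) * centered_mean N ?g \<omega>\<bar>"
          using elim t by simp
        also have "\<bar>(rq - t) * centered_mean N ?g \<omega>\<bar> \<le> (rq - lq) * \<bar>centered_mean N ?g \<omega>\<bar>"
          using t by (auto simp: abs_mult quantiles_eq intro!: mult_right_mono)
        finally have "1 / (1 - \<alpha>) * \<bar>centered_mean N (\<lambda>z. max (z - t) 0) \<omega>\<bar> \<le> ?b"
          using \<alpha> by (intro mult_left_mono) auto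
        then show ?thesis
          using \<alpha> unfolding AVaR_eq_RU[OF integrable_id t] scaled_sample_RU[OF N] by (simp add: abs_mult)
      qed
      have "\<bar>(INF t\<in>quantiles C \<alpha>. sqrt (real N) * (sRU N \<omega> t - AVaR \<alpha> C))
        - (INF t\<in>quantiles C \<alpha>. 0)\<bar> \<le> ?b"
      proof (rule cINF_close[OF quantiles_compact(2) _ _ le])
        show "bdd_below ((\<lambda>t. sqrt (real N) * (sRU N \<omega> t - AVaR \<alpha> C)) ` quantiles C \<alpha>)"
        proof (rule bdd_belowI2)
          fix t assume "t \<in> quantiles C \<alpha>"
          then show "- ?b \<le> sqrt (real N) * (sRU N \<omega> t - AVaR \<alpha> C)"
            using le[of t] by linarith
        qed
      qed auto
      also have "(INF t\<in>quantiles C \<alpha>. sqrt (real N) * (sRU N \<omega> t - AVaR \<alpha> C))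
        = sqrt (real N) * ((INF t\<in>quantiles C \<alpha>. sRU N \<omega> t) - AVaR \<alpha> C)"
        using N by (intro cINF_affine quantiles_compact(2) bdd_below_sample_RU) simp
      finally have "\<bar>sqrt (real N) * ((INF t\<in>quantiles C \<alpha>. sRU N \<omega> t) - AVaR \<alpha> C)\<bar> \<le> ?b"
        using quantiles_compact(2) by simp
      then show ?thesis by (rule order_trans[OF _ abs_ge_self])
    qed simp
  qed
qed measurable

end

lemma norm_le_sum_components:
  fixes x :: "real \<times> (real ^ 'n)"
  shows "norm x \<le> \<bar>fst x\<bar> + (\<Sum>i\<in>UNIV. \<bar>snd x $ i\<bar>)"
  using norm_Pair_le[of "fst x" "snd x"] norm_le_l1_cart[of "snd x"] by simp

lemma borel_measurable_weights:
  fixes f :: "'a \<Rightarrow> real \<times> (real ^ 'n)"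
  assumes "(\<lambda>x. fst (f x)) \<in> borel_measurable M" "\<And>i. (\<lambda>x. snd (f x) $ i) \<in> borel_measurable M"
  shows "f \<in> borel_measurable M"
  using assms
  by (subst borel_measurable_euclidean_space) (auto simp: Basis_prod_def Basis_vec_def inner_axis inner_prod_def)

lemma inner_weights:
  fixes w x :: "real \<times> (real ^ 'n)"
  shows "w \<bullet> x = fst w * fst x + (\<Sum>i\<in>UNIV. snd w $ i * snd x $ i)"
  by (simp add: inner_prod_def inner_vec_def)

lemma compact_weights:
  fixes W :: "('n::finite) weights set"
  assumes "closed W" "W \<subseteq> weight_simplex"
  shows "compact W"
proof -
  have "norm w \<le> 1" if "w \<in> W" for w
  proof -
    have "w \<in> weight_simplex" using that assms by auto
    then show ?thesis using norm_le_sum_components[of w] by (simp add: weight_simplex_def)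
  qed
  then have "bounded W" by (rule boundedI)
  with assms(1) show ?thesis by (simp add: compact_eq_bounded_closed)
qed

section \<open>The risk as a support function, and its expansion\<close>

locale risk_sample = iid_sample M Z \<mu>
  for M :: "'a measure" and Z :: "nat \<Rightarrow> 'a \<Rightarrow> real" and \<mu> :: "real measure" +
  fixes \<alpha> :: "'n::finite \<Rightarrow> real" and W :: "'n weights set"
  assumes square: "integrable \<mu> (\<lambda>z. z\<^sup>2)"
    and \<alpha>: "\<And>i. 0 < \<alpha> i" "\<And>i. \<alpha> i < 1"
    and W_nonempty: "W \<noteq> {}" and W_closed: "closed W" and W_simplex: "W \<subseteq> weight_simplex"
begin

lemma level: "iid_level M Z \<mu> (\<alpha> i)"
  using iid_sample_axioms \<mu>.real_distribution_axioms \<alpha> square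
  by (simp add: iid_level_def cdf_level_def cdf_distribution_def cdf_level_axioms_def iid_level_axioms_def)

abbreviation "F \<equiv> cdf \<mu>"
abbreviation "rq i \<equiv> right_quantile F (\<alpha> i)"
abbreviation "Wopt \<equiv> opt_weights W \<alpha> F"
abbreviation "Qbox \<equiv> quantile_box \<alpha> F"
abbreviation "emp N \<omega> \<equiv> empirical_cdf (\<lambda>j. Z j \<omega>) N"
abbreviation "sObj N \<omega> \<equiv> sample_objective \<alpha> (\<lambda>j. Z j \<omega>) N"

definition \<theta> :: "'n weights" where
  "\<theta> = (\<integral>z. z \<partial>\<mu>, \<chi> i. AVaR (\<alpha> i) F)"

definition \<theta>_emp :: "nat \<Rightarrow> 'a \<Rightarrow> 'n weights" where
  "\<theta>_emp N \<omega> = ((\<Sum>j<N. Z j \<omega>) / real N, \<chi> i. AVaR (\<alpha> i) (emp N \<omega>))"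

text \<open>The sample objectives with infima over the population quantile intervals. For positive
  \<open>N\<close> it dominates \<open>\<theta>_emp\<close> coordinatewise, and its support function
  over \<open>Wopt\<close> is the sup-inf of the expansion.\<close>

definition \<theta>_loc :: "nat \<Rightarrow> 'a \<Rightarrow> 'n weights" where
  "\<theta>_loc N \<omega> = ((\<Sum>j<N. Z j \<omega>) / real N, \<chi> i. INF t\<in>quantiles F (\<alpha> i). sample_RU (\<alpha> i) (\<lambda>j. Z j \<omega>) N t)"

sublocale W: compact_nonempty W
  using compact_weights[OF W_closed W_simplex] W_nonempty by unfold_locales

lemma expect_cdf_F: "expect_cdf F f = integral\<^sup>L \<mu> f"
  by (simp add: expect_cdf_def interval_measure_cdf[OF \<mu>.real_distribution_axioms])

lemma risk_mix_F: "risk_mix \<alpha> F w = w \<bullet> \<theta>"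
  by (simp add: risk_mix_def inner_weights \<theta>_def expect_cdf_F)

lemma risk_F: "risk W \<alpha> F = support_fun W \<theta>"
  by (simp add: risk_def support_fun_def risk_mix_F)

lemma Wopt_eq: "Wopt = argmax_set W \<theta>"
  by (auto simp: opt_weights_def is_arg_max_def argmax_set_def risk_mix_F not_less)

sublocale Wopt: compact_nonempty Wopt
  unfolding Wopt_eq by (rule W.compact_nonempty_argmax)

lemma Wopt_W: "w \<in> Wopt \<Longrightarrow> w \<in> W"
  by (simp add: Wopt_eq argmax_set_def)

lemma W_nonneg: "w \<in> W \<Longrightarrow> 0 \<le> snd w $ i"
  using W_simplex by (auto simp: weight_simplex_def)

lemma W_le_1:
  assumes "w \<in> W"
  shows "snd w $ i \<le> 1"
proof -
  have "w \<in> weight_simplex" using assms W_simplex by auto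
  moreover from this have "snd w $ i \<le> (\<Sum>i\<in>UNIV. snd w $ i)"
    by (intro member_le_sum) (auto simp: weight_simplex_def)
  ultimately show ?thesis by (simp add: weight_simplex_def)
qed

lemma risk_emp:
  assumes N: "N > 0"
  shows "risk W \<alpha> (emp N \<omega>) = support_fun W (\<theta>_emp N \<omega>)"
  by (simp add: risk_def support_fun_def risk_mix_def inner_weights \<theta>_emp_def expect_cdf_empirical[OF N])

lemma box_compact: "compact Qbox" "Qbox \<noteq> {}"
proof -
  have "Qbox = cbox (\<chi> i. left_quantile F (\<alpha> i)) (\<chi> i. rq i)"
    by (auto simp: quantile_box_def mem_box_cart quantiles_eq)
  then show "compact Qbox" by simp
  have "(\<chi> i. rq i) \<in> Qbox"
    using cdf_level.lq_le_rq[OF iid_level.axioms(2)[OF level]] by (simp add: quantile_box_def quantiles_eq)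
  then show "Qbox \<noteq> {}" by auto
qed

lemma sample_objective_eq:
  "sample_objective \<alpha> z N w \<tau> = fst w * ((\<Sum>j<N. z j) / real N) + (\<Sum>i\<in>UNIV. snd w $ i * sample_RU (\<alpha> i) z N (\<tau> $ i))"
  by (simp add: sample_objective_def sample_RU_def)

text \<open>The objective is separable in the coordinates of the box, with nonnegative weights, so
  its infimum is the weighted sum of the coordinatewise infima, attained at the vector of
  coordinatewise minimizers.\<close>

lemma
  assumes w: "w \<in> W"
  shows sample_objective_ge: "\<tau> \<in> Qbox \<Longrightarrow> w \<bullet> \<theta>_loc N \<omega> \<le> sObj N \<omega> w \<tau>"
    and INF_sample_objective: "(INF \<tau>\<in>Qbox. sObj N \<omega> w \<tau>) = w \<bullet> \<theta>_loc N \<omega>"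
proof -
  let ?z = "\<lambda>j. Z j \<omega>"
  let ?m = "\<lambda>i. INF t\<in>quantiles F (\<alpha> i). sample_RU (\<alpha> i) ?z N t"
  have m: "?m i \<le> sample_RU (\<alpha> i) ?z N t" if "t \<in> quantiles F (\<alpha> i)" for i t
    using that by (intro cINF_lower iid_level.bdd_below_sample_RU[OF level])
  show ge: "w \<bullet> \<theta>_loc N \<omega> \<le> sample_objective \<alpha> ?z N w \<tau>" if "\<tau> \<in> Qbox" for \<tau>
    using that m W_nonneg[OF w]
    by (auto simp: inner_weights \<theta>_loc_def sample_objective_eq quantile_box_def intro!: sum_mono mult_left_mono)
  have "\<exists>t\<in>quantiles F (\<alpha> i). ?m i = sample_RU (\<alpha> i) ?z N t" for i
  proof -
    obtain t where "t \<in> quantiles F (\<alpha> i)" "\<forall>s\<in>quantiles F (\<alpha> i). sample_RU (\<alpha> i) ?z N t \<le> sample_RU (\<alpha> i) ?z N s"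
      using continuous_attains_inf[OF iid_level.quantiles_compact[OF level] iid_level.continuous_on_sample_RU[OF level]]
      by blast
    then show ?thesis by (intro bexI[of _ t] cInf_eq_minimum) auto
  qed
  then obtain t where t: "\<And>i. t i \<in> quantiles F (\<alpha> i)" "\<And>i. ?m i = sample_RU (\<alpha> i) ?z N (t i)"
    by metis
  have "(\<chi> i. t i) \<in> Qbox" using t(1) by (simp add: quantile_box_def)
  moreover have "sample_objective \<alpha> ?z N w (\<chi> i. t i) = w \<bullet> \<theta>_loc N \<omega>"
    by (simp add: inner_weights \<theta>_loc_def sample_objective_eq t(2))
  ultimately have "w \<bullet> \<theta>_loc N \<omega> \<in> sample_objective \<alpha> ?z N w ` Qbox" by (metis imageI)
  then show "(INF \<tau>\<in>Qbox. sample_objective \<alpha> ?z N w \<tau>) = w \<bullet> \<theta>_loc N \<omega>"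
    using ge by (intro cInf_eq_minimum) auto
qed

lemma SUP_INF_sample_objective:
  "(SUP w\<in>Wopt. INF \<tau>\<in>Qbox. sObj N \<omega> w \<tau>) = support_fun Wopt (\<theta>_loc N \<omega>)"
  unfolding support_fun_def by (intro SUP_cong refl INF_sample_objective Wopt_W)

lemma \<theta>_loc_measurable [measurable]: "\<theta>_loc N \<in> borel_measurable M"
  using iid_level.INF_sample_RU_measurable[OF level]
  by (intro borel_measurable_weights) (simp_all add: \<theta>_loc_def)

lemma \<theta>_emp_measurable: "N > 0 \<Longrightarrow> \<theta>_emp N \<in> borel_measurable M"
  using iid_level.AVaR_empirical_measurable[OF level]
  by (intro borel_measurable_weights) (simp_all add: \<theta>_emp_def)

lemma support_fun_measurable [measurable]:
  "support_fun W \<in> borel_measurable borel" "support_fun Wopt \<in> borel_measurable borel"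
  by (intro borel_measurable_continuous_onI W.continuous_on_support_fun Wopt.continuous_on_support_fun)+

definition H :: "nat \<Rightarrow> 'a \<Rightarrow> 'n weights" where
  "H N \<omega> = sqrt (real N) *\<^sub>R (\<theta>_loc N \<omega> - \<theta>)"

lemma H_measurable [measurable]: "H N \<in> borel_measurable M"
  unfolding H_def by measurable

lemma bounded_H: "bounded_in_prob M (\<lambda>N \<omega>. norm (H N \<omega>))"
proof (rule bounded_in_prob_mono_AE)
  let ?f = "\<lambda>N \<omega>. centered_mean N (\<lambda>z. z) \<omega>"
  let ?g = "\<lambda>i N \<omega>. sqrt (real N) * ((INF t\<in>quantiles F (\<alpha> i). sample_RU (\<alpha> i) (\<lambda>j. Z j \<omega>) N t) - AVaR (\<alpha> i) F)"
  show "bounded_in_prob M (\<lambda>N \<omega>. \<bar>?f N \<omega>\<bar> + (\<Sum>i\<in>UNIV. \<bar>?g i N \<omega>\<bar>))"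
    by (intro bounded_in_prob_add bounded_in_prob_sum bounded_in_prob_abs bounded_in_prob_centered_mean
        iid_level.bounded_in_prob_INF_sample_RU[OF level] iid_level.square_integrable_id[OF level])
  have "norm (H N \<omega>) \<le> \<bar>?f N \<omega>\<bar> + (\<Sum>i\<in>UNIV. \<bar>?g i N \<omega>\<bar>)" for N \<omega>
    using norm_le_sum_components[of "H N \<omega>"] by (simp add: H_def \<theta>_loc_def \<theta>_def centered_mean_def)
  then show "AE \<omega> in M. \<bar>norm (H N \<omega>)\<bar> \<le> \<bar>\<bar>?f N \<omega>\<bar> + (\<Sum>i\<in>UNIV. \<bar>?g i N \<omega>\<bar>)\<bar>" for N
    by (intro AE_I2) (simp add: order_trans[OF _ abs_ge_self])
qed measurable

lemma \<theta>_emp_le: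
  assumes "N > 0"
  shows "snd (\<theta>_emp N \<omega>) $ i \<le> snd (\<theta>_loc N \<omega>) $ i" "fst (\<theta>_emp N \<omega>) = fst (\<theta>_loc N \<omega>)"
  using iid_level.AVaR_empirical_le_INF[OF level assms] by (simp_all add: \<theta>_emp_def \<theta>_loc_def)

text \<open>The weights lie in [0, 1] and \<open>\<theta>_emp\<close> lies below
  \<open>\<theta>_loc\<close>, so \<open>support_fun W (\<theta>_emp N \<omega>)\<close> is at most
  the value of \<open>support_fun W\<close> at \<open>\<theta>_loc\<close>, and at least that of
  \<open>support_fun Wopt\<close> there minus the summed gaps. After scaling, the first bracket is
  the delta-method error and the sum is the localization error.\<close>

lemma support_fun_emp_bounds:
  assumes N: "N > 0"
  shows "\<bar>support_fun W (\<theta>_emp N \<omega>) - support_fun Wopt (\<theta>_loc N \<omega>)\<bar>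
    \<le> (support_fun W (\<theta>_loc N \<omega>) - support_fun Wopt (\<theta>_loc N \<omega>))
      + (\<Sum>i\<in>UNIV. snd (\<theta>_loc N \<omega>) $ i - snd (\<theta>_emp N \<omega>) $ i)"
proof -
  let ?g = "\<Sum>i\<in>UNIV. snd (\<theta>_loc N \<omega>) $ i - snd (\<theta>_emp N \<omega>) $ i"
  have g: "?g \<ge> 0" using \<theta>_emp_le(1)[OF N] by (intro sum_nonneg) simp
  have diff: "w \<bullet> \<theta>_loc N \<omega> - w \<bullet> \<theta>_emp N \<omega> = (\<Sum>i\<in>UNIV. snd w $ i * (snd (\<theta>_loc N \<omega>) $ i - snd (\<theta>_emp N \<omega>) $ i))" for w
    by (simp add: inner_weights \<theta>_emp_le(2)[OF N] sum_subtractf right_diff_distrib)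
  have 1: "support_fun W (\<theta>_emp N \<omega>) \<le> support_fun W (\<theta>_loc N \<omega>)"
  proof (rule W.support_fun_le)
    fix w assume w: "w \<in> W"
    have "0 \<le> w \<bullet> \<theta>_loc N \<omega> - w \<bullet> \<theta>_emp N \<omega>"
      unfolding diff using W_nonneg[OF w] \<theta>_emp_le(1)[OF N] by (intro sum_nonneg mult_nonneg_nonneg) simp_all
    then show "w \<bullet> \<theta>_emp N \<omega> \<le> support_fun W (\<theta>_loc N \<omega>)"
      using W.inner_le_support_fun[OF w, of "\<theta>_loc N \<omega>"] by simp
  qed
  have 2: "support_fun Wopt (\<theta>_loc N \<omega>) \<le> support_fun W (\<theta>_emp N \<omega>) + ?g"
  proof (rule Wopt.support_fun_le)
    fix w assume "w \<in> Wopt"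
    then have w: "w \<in> W" by (rule Wopt_W)
    have "w \<bullet> \<theta>_loc N \<omega> - w \<bullet> \<theta>_emp N \<omega> \<le> (\<Sum>i\<in>UNIV. 1 * (snd (\<theta>_loc N \<omega>) $ i - snd (\<theta>_emp N \<omega>) $ i))"
      unfolding diff using W_le_1[OF w] \<theta>_emp_le(1)[OF N] by (intro sum_mono mult_right_mono) simp_all
    then show "w \<bullet> \<theta>_loc N \<omega> \<le> support_fun W (\<theta>_emp N \<omega>) + ?g"
      using W.inner_le_support_fun[OF w, of "\<theta>_emp N \<omega>"] by simp
  qed
  have 3: "support_fun Wopt (\<theta>_loc N \<omega>) \<le> support_fun W (\<theta>_loc N \<omega>)"
    by (rule Wopt.support_fun_le) (intro W.inner_le_support_fun Wopt_W)
  from 1 2 3 g show ?thesis by linarith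
qed

theorem risk_expansion:
  "tendsto_0_in_prob M (\<lambda>N \<omega>. sqrt (real N) * (risk W \<alpha> (emp N \<omega>) -
     (SUP w\<in>Wopt. INF \<tau>\<in>Qbox. sObj N \<omega> w \<tau>)))"
proof (rule tendsto_0_in_prob_mono)
  let ?x = "\<lambda>N \<omega>. \<theta> + (1 / sqrt (real N)) *\<^sub>R H N \<omega>"
  let ?D = "\<lambda>N \<omega>. sqrt (real N) * (support_fun W (?x N \<omega>) - support_fun (argmax_set W \<theta>) (?x N \<omega>))"
  let ?g = "\<lambda>i N \<omega>. sqrt (real N) *
     ((INF t\<in>quantiles F (\<alpha> i). sample_RU (\<alpha> i) (\<lambda>j. Z j \<omega>) N t) - AVaR (\<alpha> i) (emp N \<omega>))"
  have "tendsto_0_in_prob M ?D"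
    by (rule support_fun_delta_method[OF W.compact_nonempty_axioms H_measurable bounded_H])
  then show "tendsto_0_in_prob M (\<lambda>N \<omega>. ?D N \<omega> + (\<Sum>i\<in>UNIV. ?g i N \<omega>))"
    by (intro tendsto_0_in_prob_add tendsto_0_in_prob_sum iid_level.empirical_AVaR_localization[OF level])
  show "(\<lambda>\<omega>. sqrt (real N) * (risk W \<alpha> (emp N \<omega>) -
     (SUP w\<in>Wopt. INF \<tau>\<in>Qbox. sObj N \<omega> w \<tau>))) \<in> borel_measurable M" for N
  proof (cases "N = 0")
    case False
    then have N: "N > 0" by simp
    note [measurable] = \<theta>_emp_measurable[OF N]
    show ?thesis unfolding SUP_INF_sample_objective risk_emp[OF N] by measurable
  qed simp
  fix N \<omega>
  show "\<bar>sqrt (real N) * (risk W \<alpha> (emp N \<omega>) -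
     (SUP w\<in>Wopt. INF \<tau>\<in>Qbox. sObj N \<omega> w \<tau>))\<bar> \<le> \<bar>?D N \<omega> + (\<Sum>i\<in>UNIV. ?g i N \<omega>)\<bar>"
  proof (cases "N = 0")
    case False
    then have N: "N > 0" by simp
    then have x: "?x N \<omega> = \<theta>_loc N \<omega>" by (simp add: H_def)
    have s: "sqrt (real N) \<ge> 0" by simp
    have "\<bar>sqrt (real N) * (support_fun W (\<theta>_emp N \<omega>) - support_fun Wopt (\<theta>_loc N \<omega>))\<bar>
      \<le> sqrt (real N) * ((support_fun W (\<theta>_loc N \<omega>) - support_fun Wopt (\<theta>_loc N \<omega>))
      + (\<Sum>i\<in>UNIV. snd (\<theta>_loc N \<omega>) $ i - snd (\<theta>_emp N \<omega>) $ i))"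
      unfolding abs_mult using support_fun_emp_bounds[OF N, of \<omega>] by (simp add: mult_left_mono)
    also have "\<dots> = ?D N \<omega> + (\<Sum>i\<in>UNIV. ?g i N \<omega>)"
      unfolding x Wopt_eq by (simp add: distrib_left sum_distrib_left \<theta>_loc_def \<theta>_emp_def)
    finally show ?thesis
      unfolding SUP_INF_sample_objective risk_emp[OF N] by (rule order_trans[OF _ abs_ge_self])
  qed simp
qed

section \<open>Reduction to finitely many coordinates\<close>

definition X :: "real \<Rightarrow> real \<times> (real ^ 'n) \<times> (real ^ 'n)" where
  "X z = (z, (\<chi> i. max (z - rq i) 0), (\<chi> i. indicator {rq i..} z))"

text \<open>The coefficients of \<open>influence\<close> with respect to the coordinates of
  \<open>X\<close>. Splitting the positive part at \<open>rq i\<close> moves all dependence on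
  \<open>\<tau>\<close> into the last block of coefficients, which is affine in
  \<open>\<tau>\<close>.\<close>

definition L :: "'n weights \<times> (real ^ 'n) \<Rightarrow> real \<times> (real ^ 'n) \<times> (real ^ 'n)" where
  "L s = (fst (fst s), (\<chi> i. snd (fst s) $ i / (1 - \<alpha> i)),
     (\<chi> i. snd (fst s) $ i / (1 - \<alpha> i) * (rq i - snd s $ i)))"

sublocale iid_vector M Z \<mu> X
proof
  fix b :: "real \<times> (real ^ 'n) \<times> (real ^ 'n)"
  have "b \<bullet> X z = fst b * z + ((\<Sum>i\<in>UNIV. fst (snd b) $ i * max (z - rq i) 0)
      + (\<Sum>i\<in>UNIV. snd (snd b) $ i * indicator {rq i..} z))" for z
    by (simp add: X_def inner_prod_def inner_vec_def)
  moreover have "square_integrable \<mu> (\<lambda>z. fst b * z + ((\<Sum>i\<in>UNIV. fst (snd b) $ i * max (z - rq i) 0)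
      + (\<Sum>i\<in>UNIV. snd (snd b) $ i * indicator {rq i..} z)))"
    by (intro \<mu>.square_integrable_add \<mu>.square_integrable_sum \<mu>.square_integrable_cmult
        iid_level.square_integrable_id[OF level] iid_level.square_integrable_pos_part[OF level]
        iid_level.square_integrable_indicator[OF level]) simp
  ultimately show "square_integrable \<mu> (\<lambda>z. b \<bullet> X z)" by simp
qed

lemma continuous_on_L: "continuous_on S L"
  unfolding L_def[abs_def] divide_inverse by (intro continuous_intros)

lemma influence_eq_L:
  assumes "\<And>i. \<forall>t\<in>quantiles F (\<alpha> i). max (z - t) 0 = max (z - rq i) 0 + (rq i - t) * indicator {rq i..} z"
    and \<tau>: "\<tau> \<in> Qbox"
  shows "influence \<alpha> w \<tau> z = L (w, \<tau>) \<bullet> X z"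
proof -
  have "max (z - \<tau> $ i) 0 = max (z - rq i) 0 + (rq i - \<tau> $ i) * indicator {rq i..} z" for i
    using assms(1)[of i] \<tau> by (simp add: quantile_box_def)
  then have "influence \<alpha> w \<tau> z = fst w * z +
      (\<Sum>i\<in>UNIV. snd w $ i / (1 - \<alpha> i) * (max (z - rq i) 0 + (rq i - \<tau> $ i) * indicator {rq i..} z))"
    by (simp add: influence_def)
  also have "\<dots> = L (w, \<tau>) \<bullet> X z"
    by (simp add: L_def X_def inner_prod_def inner_vec_def sum.distrib distrib_left mult.assoc)
  finally show ?thesis .
qed

lemma AE_split:
  "AE z in \<mu>. \<forall>i. \<forall>t\<in>quantiles F (\<alpha> i). max (z - t) 0 = max (z - rq i) 0 + (rq i - t) * indicator {rq i..} z"
proof -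
  have "AE z in \<mu>. \<forall>i\<in>UNIV. \<forall>t\<in>quantiles F (\<alpha> i). max (z - t) 0 = max (z - rq i) 0 + (rq i - t) * indicator {rq i..} z"
    by (intro AE_finite_allI iid_level.AE_pos_part_split[OF level]) simp
  then show ?thesis by simp
qed

lemma influence_borel [measurable]: "influence \<alpha> w \<tau> \<in> borel_measurable borel"
  unfolding influence_def[abs_def] by measurable

lemma X_borel [measurable]: "(\<lambda>z. v \<bullet> X z) \<in> borel_measurable borel"
  by (rule square_integrable_borel[OF square_integrable_inner])

lemma AE_influence:
  assumes "\<tau> \<in> Qbox"
  shows "AE z in \<mu>. influence \<alpha> w \<tau> z = L (w, \<tau>) \<bullet> X z"
  using AE_split by eventually_elim (intro influence_eq_L assms, blast)

lemma integral_influence: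
  assumes "\<tau> \<in> Qbox"
  shows "integral\<^sup>L \<mu> (influence \<alpha> w \<tau>) = (\<integral>z. L (w, \<tau>) \<bullet> X z \<partial>\<mu>)"
  using AE_influence[OF assms] by (intro integral_cong_AE) auto

lemma influence_cov_eq:
  assumes "s \<in> Wopt \<times> Qbox" "t \<in> Wopt \<times> Qbox"
  shows "influence_cov \<alpha> F s t = q (L s) (L t)"
proof -
  obtain w \<tau> w' \<tau>' where st: "s = (w, \<tau>)" "t = (w', \<tau>')" and b: "\<tau> \<in> Qbox" "\<tau>' \<in> Qbox"
    using assms by auto
  show ?thesis
    unfolding influence_cov_def cov_cdf_def expect_cdf_F q_def st fst_conv snd_conv
      integral_influence[OF b(1)] integral_influence[OF b(2)]
    using AE_influence[OF b(1), of w] AE_influence[OF b(2), of w']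
    by (intro integral_cong_AE) auto
qed

lemma var_cdf_eq:
  assumes b: "\<tau> \<in> Qbox"
  shows "var_cdf F (influence \<alpha> w \<tau>) = q (L (w, \<tau>)) (L (w, \<tau>))"
  unfolding var_cdf_def expect_cdf_F q_self var_def integral_influence[OF b]
  using AE_influence[OF b, of w] by (intro integral_cong_AE) auto

text \<open>On \<open>Wopt\<close> and \<open>Qbox\<close> the population objective is constantly
  \<open>risk W \<alpha> F\<close>, so subtracting that number centers the sample objective, and the
  deterministic terms in \<open>\<tau>\<close> cancel.\<close>

lemma scaled_sample_objective:
  assumes N: "N > 0" and w: "w \<in> Wopt" and \<tau>: "\<tau> \<in> Qbox"
  shows "sqrt (real N) * (sObj N \<omega> w \<tau> - risk W \<alpha> F) = centered_mean N (influence \<alpha> w \<tau>) \<omega>"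
proof -
  have "risk W \<alpha> F = w \<bullet> \<theta>" using w by (simp add: risk_F Wopt_eq W.argmax_set_eq)
  also have "\<dots> = fst w * (\<integral>z. z \<partial>\<mu>) + (\<Sum>i\<in>UNIV. snd w $ i * cdf_level.RU \<mu> (\<alpha> i) (\<tau> $ i))"
    using \<tau> cdf_level.AVaR_eq_RU[OF iid_level.axioms(2)[OF level] iid_level.integrable_id[OF level]]
    by (auto simp: inner_weights \<theta>_def quantile_box_def intro!: sum.cong)
  finally have "sqrt (real N) * (sObj N \<omega> w \<tau> - risk W \<alpha> F) =
      fst w * centered_mean N (\<lambda>z. z) \<omega> + (\<Sum>i\<in>UNIV. snd w $ i *
        (sqrt (real N) * (sample_RU (\<alpha> i) (\<lambda>j. Z j \<omega>) N (\<tau> $ i) - cdf_level.RU \<mu> (\<alpha> i) (\<tau> $ i))))"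
    by (simp add: sample_objective_eq centered_mean_def right_diff_distrib distrib_left sum_subtractf
        sum_distrib_left mult.left_commute)
  also have "\<dots> = fst w * centered_mean N (\<lambda>z. z) \<omega> +
      (\<Sum>i\<in>UNIV. snd w $ i / (1 - \<alpha> i) * centered_mean N (\<lambda>z. max (z - \<tau> $ i) 0) \<omega>)"
    by (simp add: iid_level.scaled_sample_RU[OF level N])
  also have "\<dots> = centered_mean N (influence \<alpha> w \<tau>) \<omega>"
  proof -
    note int = iid_level.integrable_id[OF level] iid_level.integrable_pos_part[OF level]
    have "centered_mean N (influence \<alpha> w \<tau>) \<omega> = centered_mean N (\<lambda>z. fst w * z) \<omega>
      + centered_mean N (\<lambda>z. \<Sum>i\<in>UNIV. snd w $ i / (1 - \<alpha> i) * max (z - \<tau> $ i) 0) \<omega>"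
      unfolding influence_def[abs_def]
      by (intro centered_mean_add Bochner_Integration.integrable_sum integrable_mult_right int)
    also have "centered_mean N (\<lambda>z. \<Sum>i\<in>UNIV. snd w $ i / (1 - \<alpha> i) * max (z - \<tau> $ i) 0) \<omega>
      = (\<Sum>i\<in>UNIV. centered_mean N (\<lambda>z. snd w $ i / (1 - \<alpha> i) * max (z - \<tau> $ i) 0) \<omega>)"
      by (intro centered_mean_sum integrable_mult_right int)
    finally show ?thesis by (simp only: centered_mean_cmult)
  qed
  finally show ?thesis .
qed

text \<open>The null set is common to all \<open>N\<close>, \<open>w\<close> and
  \<open>\<tau>\<close>, which allows the sup-inf to be taken afterwards.\<close>

lemma AE_centered_mean_influence:
  "AE \<omega> in M. \<forall>N w. \<forall>\<tau>\<in>Qbox. centered_mean N (influence \<alpha> w \<tau>) \<omega> = L (w, \<tau>) \<bullet> G N \<omega>"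
  using iid_level.AE_sample[OF level AE_split]
proof eventually_elim
  case (elim \<omega>)
  have "influence \<alpha> w \<tau> (Z j \<omega>) = L (w, \<tau>) \<bullet> X (Z j \<omega>)" if "\<tau> \<in> Qbox" for w \<tau> j
    using elim by (intro influence_eq_L that) blast
  then show ?case
    unfolding inner_G by (auto simp: centered_mean_def integral_influence)
qed

lemma AE_scaled_SUP_INF:
  assumes N: "N > 0"
  shows "AE \<omega> in M. sqrt (real N) * ((SUP w\<in>Wopt. INF \<tau>\<in>Qbox. sObj N \<omega> w \<tau>) - risk W \<alpha> F)
    = (SUP w\<in>Wopt. INF \<tau>\<in>Qbox. L (w, \<tau>) \<bullet> G N \<omega>)"
  using AE_centered_mean_influence
proof eventually_elim
  case (elim \<omega>)
  let ?o = "sObj N \<omega>"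
  have s: "sqrt (real N) > 0" using N by simp
  have "bdd_above ((\<lambda>w. INF \<tau>\<in>Qbox. ?o w \<tau>) ` Wopt)"
    using Wopt.bdd_above_inner[of "\<theta>_loc N \<omega>"] INF_sample_objective Wopt_W by (simp cong: image_cong)
  then have "sqrt (real N) * ((SUP w\<in>Wopt. INF \<tau>\<in>Qbox. ?o w \<tau>) - risk W \<alpha> F)
    = (SUP w\<in>Wopt. sqrt (real N) * ((INF \<tau>\<in>Qbox. ?o w \<tau>) - risk W \<alpha> F))"
    by (intro cSUP_affine[symmetric] s Wopt.nonempty)
  also have "\<dots> = (SUP w\<in>Wopt. INF \<tau>\<in>Qbox. L (w, \<tau>) \<bullet> G N \<omega>)"
  proof (intro SUP_cong refl)
    fix w assume w: "w \<in> Wopt"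
    have "bdd_below (?o w ` Qbox)"
      using sample_objective_ge[OF Wopt_W[OF w]] by (intro bdd_belowI2) auto
    then have "sqrt (real N) * ((INF \<tau>\<in>Qbox. ?o w \<tau>) - risk W \<alpha> F) = (INF \<tau>\<in>Qbox. sqrt (real N) * (?o w \<tau> - risk W \<alpha> F))"
      by (intro cINF_affine[symmetric] s box_compact)
    also have "\<dots> = (INF \<tau>\<in>Qbox. L (w, \<tau>) \<bullet> G N \<omega>)"
      using elim[rule_format, of _ N w] by (intro INF_cong refl) (simp only: scaled_sample_objective[OF N w])
    finally show "sqrt (real N) * ((INF \<tau>\<in>Qbox. ?o w \<tau>) - risk W \<alpha> F) = (INF \<tau>\<in>Qbox. L (w, \<tau>) \<bullet> G N \<omega>)" .
  qed
  finally show ?case .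
qed

text \<open>For positive \<open>N\<close> the scaled error is almost surely the sup-inf of the
  images of \<open>G N\<close> plus the remainder of \<open>risk_expansion\<close>, so Slutsky's
  lemma applies. Both limit statements are reduced to the sup-inf in this way.\<close>

lemma risk_weak_conv:
  assumes \<nu>: "real_distribution \<nu>"
    and S: "\<And>N. (\<lambda>\<omega>. SUP w\<in>Wopt. INF \<tau>\<in>Qbox. L (w, \<tau>) \<bullet> G N \<omega>) \<in> borel_measurable M"
    and conv: "weak_conv_m (\<lambda>N. distr M borel (\<lambda>\<omega>. SUP w\<in>Wopt. INF \<tau>\<in>Qbox. L (w, \<tau>) \<bullet> G N \<omega>)) \<nu>"
  shows "weak_conv_m (\<lambda>N. distr M borel (\<lambda>\<omega>. sqrt (real N) * (risk W \<alpha> (emp N \<omega>) - risk W \<alpha> F))) \<nu>"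
proof (rule weak_conv_m_cong_eventually[OF weak_conv_m_add_tendsto_0_in_prob[OF S \<nu> conv risk_expansion]])
  let ?S = "\<lambda>N \<omega>. SUP w\<in>Wopt. INF \<tau>\<in>Qbox. L (w, \<tau>) \<bullet> G N \<omega>"
  let ?o = "\<lambda>N \<omega>. SUP w\<in>Wopt. INF \<tau>\<in>Qbox. sObj N \<omega> w \<tau>"
  let ?D = "\<lambda>N \<omega>. sqrt (real N) * (risk W \<alpha> (emp N \<omega>) - ?o N \<omega>)"
  let ?R = "\<lambda>N \<omega>. sqrt (real N) * (risk W \<alpha> (emp N \<omega>) - risk W \<alpha> F)"
  have "distr M borel (\<lambda>\<omega>. ?S N \<omega> + ?D N \<omega>) = distr M borel (?R N)" if N: "N > 0" for N
  proof (rule distr_cong_AE)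
    show "AE \<omega> in M. ?S N \<omega> + ?D N \<omega> = ?R N \<omega>"
      using AE_scaled_SUP_INF[OF N]
    proof eventually_elim
      case (elim \<omega>)
      show ?case unfolding elim[symmetric] by (simp add: algebra_simps)
    qed
    have "?D N \<in> borel_measurable M" using risk_expansion by (simp add: tendsto_0_in_prob_def)
    then show "(\<lambda>\<omega>. ?S N \<omega> + ?D N \<omega>) \<in> borel_measurable M" using S by (intro borel_measurable_add)
    note [measurable] = \<theta>_emp_measurable[OF N]
    show "?R N \<in> borel_measurable M" unfolding risk_emp[OF N] by measurable
  qed simp_all
  then show "\<forall>\<^sub>F N in sequentially. distr M borel (\<lambda>\<omega>. ?S N \<omega> + ?D N \<omega>) = distr M borel (?R N)"
    by (intro eventually_sequentiallyI[of 1]) simp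
qed

theorem risk_gaussian_limit:
  fixes P :: "'b measure"
  assumes Y: "continuous_centered_gaussian_process P (Wopt \<times> Qbox) (influence_cov \<alpha> F) Y"
  shows "weak_conv_m (\<lambda>N. distr M borel (\<lambda>\<omega>. sqrt (real N) * (risk W \<alpha> (emp N \<omega>) - risk W \<alpha> F)))
    (distr P borel (\<lambda>\<omega>. SUP w\<in>Wopt. INF \<tau>\<in>Qbox. Y (w, \<tau>) \<omega>))"
proof -
  note sup_inf = weak_conv_sup_inf[OF Wopt.compact Wopt.nonempty box_compact continuous_on_L Y influence_cov_eq]
  have "prob_space P" using Y by (simp add: continuous_centered_gaussian_process_def gaussian_process_def)
  from prob_space.real_distribution_distr[OF this sup_inf(2)] show ?thesis
    by (rule risk_weak_conv) (use sup_inf in auto)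
qed

text \<open>The limit statement quantifies over all processes with the given covariance; a Gaussian
  vector with form \<open>q\<close>, paired with the coefficients \<open>L\<close>, shows that such
  a process exists.\<close>

theorem risk_gaussian_process_exists:
  "\<exists>(P :: (nat \<Rightarrow> real) measure) Y. continuous_centered_gaussian_process P (Wopt \<times> Qbox) (influence_cov \<alpha> F) Y"
proof -
  obtain P :: "(nat \<Rightarrow> real) measure" and \<Gamma> where P: "prob_space P" "\<Gamma> \<in> borel_measurable P"
    "\<And>v. distr P borel (\<lambda>\<omega>. v \<bullet> \<Gamma> \<omega>) = normal_law 0 (q v v)"
    using gaussian_vector_exists by blast
  from linear_gaussian_process[OF P continuous_on_L, of "Wopt \<times> Qbox"]
  have "continuous_centered_gaussian_process P (Wopt \<times> Qbox) (influence_cov \<alpha> F) (\<lambda>s \<omega>. L s \<bullet> \<Gamma> \<omega>)"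
    using influence_cov_eq by (auto simp: continuous_centered_gaussian_process_def)
  then show ?thesis by blast
qed

text \<open>Over singletons the sup-inf is one projection of \<open>G N\<close>, so the
  one-dimensional central limit theorem gives the limit directly.\<close>

theorem risk_normal_limit:
  assumes w: "Wopt = {w}" and \<tau>: "Qbox = {\<tau>}"
  shows "weak_conv_m (\<lambda>N. distr M borel (\<lambda>\<omega>. sqrt (real N) * (risk W \<alpha> (emp N \<omega>) - risk W \<alpha> F)))
    (normal_law 0 (var_cdf F (influence \<alpha> w \<tau>)))"
proof -
  have v: "var_cdf F (influence \<alpha> w \<tau>) = q (L (w, \<tau>)) (L (w, \<tau>))" using \<tau> by (intro var_cdf_eq) simp
  show ?thesis
  proof (rule risk_weak_conv)
    show "real_distribution (normal_law 0 (var_cdf F (influence \<alpha> w \<tau>)))"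
      unfolding v by (rule real_distribution_normal_law[OF nonneg])
    show "weak_conv_m (\<lambda>N. distr M borel (\<lambda>\<omega>. SUP w\<in>Wopt. INF \<tau>\<in>Qbox. L (w, \<tau>) \<bullet> G N \<omega>))
      (normal_law 0 (var_cdf F (influence \<alpha> w \<tau>)))"
      unfolding v w \<tau> using clt_inner[of "L (w, \<tau>)"] by simp
  qed (simp add: w \<tau>)
qed

end

theorem theorem4p1:
  fixes M :: "'a measure" and Z :: "nat \<Rightarrow> 'a \<Rightarrow> real" and F :: "real \<Rightarrow> real"
    and \<alpha> :: "'n::{finite, linorder} \<Rightarrow> real" and W :: "'n weights set"
  assumes alpha: "strict_mono \<alpha>" "\<And>i. 0 < \<alpha> i" "\<And>i. \<alpha> i < 1"
    and W: "W \<noteq> {}" "closed W" "convex W" "W \<subseteq> weight_simplex"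
    and W_nonzero: "\<And>i. \<exists>w\<in>W. snd w $ i \<noteq> 0"
    and M: "prob_space M"
    and Z_indep: "prob_space.indep_vars M (\<lambda>_. borel) Z UNIV"
    and Z_cdf: "\<And>j. cdf (distr M borel (Z j)) = F"
    and F_moment: "integrable (interval_measure F) (\<lambda>z. z\<^sup>2)"
  shows
    "tendsto_0_in_prob M (\<lambda>N \<omega>. sqrt (real N) *
        (risk W \<alpha> (empirical_cdf (\<lambda>j. Z j \<omega>) N) -
         (SUP w\<in>opt_weights W \<alpha> F. INF \<tau>\<in>quantile_box \<alpha> F.
            sample_objective \<alpha> (\<lambda>j. Z j \<omega>) N w \<tau>)))
     \<and>
     (\<exists>(P :: (nat \<Rightarrow> real) measure) Y.
        continuous_centered_gaussian_process P (opt_weights W \<alpha> F \<times> quantile_box \<alpha> F)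
          (influence_cov \<alpha> F) Y)
     \<and>
     (\<forall>(P :: 'b measure) Y.
        continuous_centered_gaussian_process P (opt_weights W \<alpha> F \<times> quantile_box \<alpha> F)
          (influence_cov \<alpha> F) Y \<longrightarrow>
        weak_conv_m
          (\<lambda>N. distr M borel (\<lambda>\<omega>. sqrt (real N) *
             (risk W \<alpha> (empirical_cdf (\<lambda>j. Z j \<omega>) N) - risk W \<alpha> F)))
          (distr P borel (\<lambda>\<omega>.
             SUP w\<in>opt_weights W \<alpha> F. INF \<tau>\<in>quantile_box \<alpha> F. Y (w, \<tau>) \<omega>)))
     \<and>
     (\<forall>w \<tau>. opt_weights W \<alpha> F = {w} \<and> quantile_box \<alpha> F = {\<tau>} \<longrightarrow>
        weak_conv_m
          (\<lambda>N. distr M borel (\<lambda>\<omega>. sqrt (real N) *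
             (risk W \<alpha> (empirical_cdf (\<lambda>j. Z j \<omega>) N) - risk W \<alpha> F)))
          (normal_law 0 (var_cdf F (influence \<alpha> w \<tau>))))"
proof -
  interpret prob_space M by (rule M)
  define \<mu> where "\<mu> = distr M borel (Z 0)"
  have Z_measurable: "Z j \<in> borel_measurable M" for j using Z_indep by (simp add: indep_vars_def)
  then have rd: "real_distribution (distr M borel (Z j))" for j by (rule real_distribution_distr)
  \<comment> \<open>The cdf determines the law, so a common cdf makes the sample identically
    distributed.\<close>
  have law: "distr M borel (Z j) = \<mu>" for j
    unfolding \<mu>_def by (rule cdf_unique[OF rd rd]) (simp add: Z_cdf)
  have F: "F = cdf \<mu>" using Z_cdf[of 0] by (simp add: \<mu>_def)
  have "interval_measure F = \<mu>" unfolding F \<mu>_def by (rule interval_measure_cdf[OF rd])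
  then have "integrable \<mu> (\<lambda>z. z\<^sup>2)" using F_moment by simp
  then interpret risk_sample M Z \<mu> \<alpha> W
    using Z_indep law alpha(2,3) W(1,2,4) by unfold_locales auto
  show ?thesis
    unfolding F using risk_expansion risk_gaussian_process_exists risk_gaussian_limit risk_normal_limit by blast
qed

end
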